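(* Let $s\in\mathbb{C}$, $0<\operatorname{Re}s<1$, $s\neq\frac12$. The map $\theta:{}^4\mathrm{FE}_s(-\varphi^2,\varphi)_\omega\to H^1_{\mathrm{Fib}}(\Gamma;\mathcal{V}^{\mathrm{fs}}_s)$ is injective, and its image, regarded as a subspace of $H^1(\Gamma;\mathcal{V}^{\mathrm{fs}}_s)$, is equal to the image of $H^1(\Gamma;\mathcal{V}^\omega_s)$ in $H^1(\Gamma;\mathcal{V}^{\mathrm{fs}}_s)$ under the map induced by the inclusion $\mathcal{V}^\omega_s\hookrightarrow\mathcal{V}^{\mathrm{fs}}_s$.
   Context: $\Gamma=\mathrm{PSL}_2(\mathbb{Z})$, generated by $S=\begin{bmatrix}0&-1\\1&0\end{bmatrix}$, $T=\begin{bmatrix}1&1\\0&1\end{bmatrix}$ (elements of $\mathrm{PGL}_2(\mathbb{R})$, matrices modulo scalars). For $M=\begin{bmatrix}a&b\\c&d\end{bmatrix}$ and a function $h$ on a subset of $\mathbb{R}$, $(h|M)(x)=|ad-bc|^s|cx+d|^{-2s}h(\frac{ax+b}{cx+d})$ (right action, extended linearly to the group ring). For open $I\subset\mathbb{P}^1(\mathbb{R})$, $\mathcal{V}^\omega_s(I)$ = functions real-analytic on $I\cap\mathbb{R}$ such that, if $\infty\in I$, $x\mapsto|x|^{-2s}h(-1/x)$ is real-analytic near $0$; $\mathcal{V}^\omega_s=\mathcal{V}^\omega_s(\mathbb{P}^1(\mathbb{R}))$; $\mathcal{V}^{\mathrm{fs}}_s$ = inductive limit of $\mathcal{V}^\omega_s(\mathbb{P}^1(\mathbb{R})\setminus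 E)$ over finite $E$ (functions analytic outside finitely many points; the minimal $E$ is the set of singularities). Cyclic interval: for $a>b$ real, $(a,b)_c=(a,\infty)\cup\{\infty\}\cup(-\infty,b)$. $\varphi=\frac{1+\sqrt5}{2}$. For $X\subset\mathbb{R}$, ${}^4\mathrm{FE}_s(X)_\omega$ is the space of real-analytic $g:X\to\mathbb{C}$ with $g+g|ST^2=g|T^{-1}+g|T^{-1}ST^{-2}$ on $X\cap T^{-2}SX\cap TX\cap T^2STX$. Cohomology: $Z^1(\Gamma;V)$ = maps $\psi:\Gamma\to V$ with $\psi_{\gamma\delta}=\psi_\gamma|\delta+\psi_\delta$, $B^1$ = maps $\gamma\mapsto v|(1-\gamma)$, $H^1=Z^1/B^1$; $H^1_{\mathrm{Fib}}(\Gamma;V)$ = classes of $\psi\in Z^1(\Gamma;V)$ with $\psi_{TST^2}\in V|(1-TST^2)$, a subspace of $H^1(\Gamma;V)$. Definition of $\theta$: for $g\in{}^4\mathrm{FE}_s(-\varphi^2,\varphi)_\omega$ put $h=g+g|ST^2\in\mathcal{V}^\omega_s(-\varphi,\varphi)$ and $k=g|T^{-1}+h|STS\in\mathcal{V}^\omega_s(-\varphi,\varphi^{-1})$. Let $c_1\in\mathcal{V}^{\mathrm{fs}}_s$ equal $k$ on $(-\varphi,\varphi^{-1})$ and $-k|S$ on $(\varphi^{-1},-\varphi)_c$, and $c_2\in\mathcal{V}^{\mathrm{fs}}_s$ equal $h$ on $(-\varphi,\varphi)$ and $-h|(T^{-1}S+ST)$ on $(\varphi,-\varphi)_c$. There is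 a (unique) cocycle $\psi\in Z^1(\Gamma;\mathcal{V}^{\mathrm{fs}}_s)$ with $\psi_S=-c_1$ and $\psi_{T^{-1}S}=-c_2$; it satisfies the condition defining $H^1_{\mathrm{Fib}}$, and $\theta(g)$ is its class in $H^1_{\mathrm{Fib}}(\Gamma;\mathcal{V}^{\mathrm{fs}}_s)$. *)

theory Defs
  imports "HOL-Analysis.Analysis"
begin

section \<open>The modular group\<close>

(* PSL_2(Z): integer matrices of determinant 1 up to sign. *)
definition psl_rel :: "int^2^2 \<Rightarrow> int^2^2 \<Rightarrow> bool" where
  "psl_rel A B \<longleftrightarrow> det A = 1 \<and> det B = 1 \<and> (A = B \<or> A = - B)"

lemma det_uminus_2: "det (- A) = det (A :: 'a::comm_ring_1^2^2)"
  by (simp add: det_2)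

lemma matrix_mult_uminus_left: "(- A) ** B = - (A ** B)" for A B :: "'a::comm_ring_1^2^2"
  by (simp add: vec_eq_iff matrix_matrix_mult_def sum_negf)

lemma matrix_mult_uminus_right: "A ** (- B) = - (A ** B)" for A B :: "'a::comm_ring_1^2^2"
  by (simp add: vec_eq_iff matrix_matrix_mult_def sum_negf)

quotient_type psl2z = "int^2^2" / partial: psl_rel
  morphisms rep_psl2z abs_psl2z
proof (rule part_equivpI)
  show "\<exists>A. psl_rel A A" by (rule exI[of _ "mat 1"]) (simp add: psl_rel_def)
  show "symp psl_rel" by (auto simp: symp_def psl_rel_def)
  show "transp psl_rel" by (auto simp: transp_def psl_rel_def)
qed

definition mat2 :: "'a \<Rightarrow> 'a \<Rightarrow> 'a \<Rightarrow> 'a \<Rightarrow> ('a::zero)^2^2" where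
  "mat2 a b c d = vector [vector [a, b], vector [c, d]]"

lemma mat2_nth [simp]:
  "mat2 a b c d $ 1 $ 1 = a" "mat2 a b c d $ 1 $ 2 = b"
  "mat2 a b c d $ 2 $ 1 = c" "mat2 a b c d $ 2 $ 2 = d"
  by (simp_all add: mat2_def)

instantiation psl2z :: monoid_mult
begin

lift_definition one_psl2z :: psl2z is "mat 1"
  by (simp add: psl_rel_def)

lift_definition times_psl2z :: "psl2z \<Rightarrow> psl2z \<Rightarrow> psl2z" is "(**)"
  by (auto simp: psl_rel_def det_mul matrix_mult_uminus_left matrix_mult_uminus_right)

instance
  by standard (transfer; auto simp: psl_rel_def det_mul matrix_mul_assoc)+

end

instantiation psl2z :: inverse
begin

lift_definition inverse_psl2z :: "psl2z \<Rightarrow> psl2z"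
  is "\<lambda>A. mat2 (A$2$2) (- (A$1$2)) (- (A$2$1)) (A$1$1)"
  by (auto simp: psl_rel_def det_2 vec_eq_iff forall_2 algebra_simps)

definition divide_psl2z :: "psl2z \<Rightarrow> psl2z \<Rightarrow> psl2z" where
  "divide_psl2z x y = x * inverse y"

instance ..

end

lemma psl2z_left_inverse: "inverse \<gamma> * \<gamma> = (1 :: psl2z)"
  by transfer
    (simp add: psl_rel_def det_2 vec_eq_iff forall_2 matrix_matrix_mult_def sum_2 mat_def algebra_simps)

lemma psl2z_right_inverse: "\<gamma> * inverse \<gamma> = (1 :: psl2z)"
  by transfer
    (simp add: psl_rel_def det_2 vec_eq_iff forall_2 matrix_matrix_mult_def sum_2 mat_def algebra_simps)

lift_definition psl_S :: psl2z is "mat2 0 (-1) 1 0"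
  by (simp add: psl_rel_def det_2)

lift_definition psl_T :: psl2z is "mat2 1 1 0 1"
  by (simp add: psl_rel_def det_2)

section \<open>Action on the projective line, slash action on functions\<close>

(* P^1(R) is real option, with None the point at infinity. *)
definition mat_moebius :: "real^2^2 \<Rightarrow> real option \<Rightarrow> real option" where
  "mat_moebius A p =
     (case p of
        None \<Rightarrow> if A$2$1 = 0 then None else Some (A$1$1 / A$2$1)
      | Some x \<Rightarrow> if A$2$1 * x + A$2$2 = 0 then None
                  else Some ((A$1$1 * x + A$1$2) / (A$2$1 * x + A$2$2)))"

(* The value at a pole x = -d/c is a dummy value. *)
definition mat_slash :: "complex \<Rightarrow> (real \<Rightarrow> complex) \<Rightarrow> real^2^2 \<Rightarrow> real \<Rightarrow> complex" where
  "mat_slash s h A x =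
     of_real \<bar>det A\<bar> powr s * of_real \<bar>A$2$1 * x + A$2$2\<bar> powr (- 2 * s)
       * h ((A$1$1 * x + A$1$2) / (A$2$1 * x + A$2$2))"

definition real_mat :: "int^2^2 \<Rightarrow> real^2^2" where
  "real_mat A = (\<chi> i j. of_int (A$i$j))"

lemma real_mat_nth [simp]: "real_mat A $ i $ j = of_int (A$i$j)"
  by (simp add: real_mat_def)

lemma det_real_mat: "det (real_mat A) = of_int (det A)"
  by (simp add: det_2)

lemma neg_moebius:
  fixes a b c d x :: real
  shows "(- (a * x) - b) / (- (c * x) - d) = (a * x + b) / (c * x + d)"
proof -
  have "- (a * x) - b = - (a * x + b)" "- (c * x) - d = - (c * x + d)" by simp_all
  then show ?thesis by (simp only: minus_divide_left[symmetric] minus_divide_right[symmetric] minus_minus)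
qed

lemma neg_affine: "- ((- (a * x) - b) / d) = (a * x + b) / d" for a b d x :: real
proof -
  have "- (a * x) - b = - (a * x + b)" by simp
  then show ?thesis by (simp only: minus_divide_left[symmetric] minus_minus)
qed

lift_definition moebius :: "psl2z \<Rightarrow> real option \<Rightarrow> real option"
  is "\<lambda>A. mat_moebius (real_mat A)"
  by (auto simp: psl_rel_def mat_moebius_def fun_eq_iff neg_moebius neg_affine split: option.splits)

lift_definition slash :: "complex \<Rightarrow> (real \<Rightarrow> complex) \<Rightarrow> psl2z \<Rightarrow> real \<Rightarrow> complex"
  is "\<lambda>s h A. mat_slash s h (real_mat A)"
proof -
  fix s :: complex and h :: "real \<Rightarrow> complex" and A B :: "int^2^2"
  assume *: "psl_rel A B"
  have "\<bar>- (c * x) - d\<bar> = \<bar>c * x + d\<bar>" for c d x :: real by linarith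
  with * show "mat_slash s h (real_mat A) = mat_slash s h (real_mat B)"
    by (auto simp: psl_rel_def mat_slash_def fun_eq_iff neg_moebius det_real_mat)
qed

section \<open>Functions modulo finite sets\<close>

(* All functions on the reals modulo equality off a finite set.  The inductive limit
   V^fs_s and the space V^\<omega>_s are realised below as subgroups of this type. *)
quotient_type fgerm = "real \<Rightarrow> complex" / "\<lambda>f g. finite {x. f x \<noteq> g x}"
  morphisms rep_fgerm to_fgerm
proof (rule equivpI)
  show "transp (\<lambda>f g :: real \<Rightarrow> complex. finite {x. f x \<noteq> g x})"
  proof (rule transpI)
    fix f g h :: "real \<Rightarrow> complex"
    assume "finite {x. f x \<noteq> g x}" "finite {x. g x \<noteq> h x}"
    then have "finite ({x. f x \<noteq> g x} \<union> {x. g x \<noteq> h x})" by blast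
    then show "finite {x. f x \<noteq> h x}" by (rule rev_finite_subset) auto
  qed
qed (auto simp: reflp_def symp_def eq_commute)

instantiation fgerm :: ab_group_add
begin

lift_definition zero_fgerm :: fgerm is "\<lambda>_. 0" .

lift_definition uminus_fgerm :: "fgerm \<Rightarrow> fgerm" is "\<lambda>f x. - f x" by simp

lift_definition plus_fgerm :: "fgerm \<Rightarrow> fgerm \<Rightarrow> fgerm" is "\<lambda>f g x. f x + g x"
proof -
  fix f f' g g' :: "real \<Rightarrow> complex"
  assume "finite {x. f x \<noteq> f' x}" "finite {x. g x \<noteq> g' x}"
  then have "finite ({x. f x \<noteq> f' x} \<union> {x. g x \<noteq> g' x})" by blast
  then show "finite {x. f x + g x \<noteq> f' x + g' x}" by (rule rev_finite_subset) auto
qed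

lift_definition minus_fgerm :: "fgerm \<Rightarrow> fgerm \<Rightarrow> fgerm" is "\<lambda>f g x. f x - g x"
proof -
  fix f f' g g' :: "real \<Rightarrow> complex"
  assume "finite {x. f x \<noteq> f' x}" "finite {x. g x \<noteq> g' x}"
  then have "finite ({x. f x \<noteq> f' x} \<union> {x. g x \<noteq> g' x})" by blast
  then show "finite {x. f x - g x \<noteq> f' x - g' x}" by (rule rev_finite_subset) auto
qed

instance
  by standard (transfer; simp add: algebra_simps)+

end

lemma finite_moebius_vimage:
  fixes a b c d :: real
  assumes F: "finite F" and det: "a * d - b * c \<noteq> 0"
  shows "finite {x. (a * x + b) / (c * x + d) \<in> F}"
proof -
  let ?p = "{x. c * x + d = 0}"
  have p: "finite ?p"
  proof (cases "c = 0")
    case True with det show ?thesis by simp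
  next
    case False
    then have "?p \<subseteq> {- d / c}" by (auto simp: field_simps add_eq_0_iff)
    then show ?thesis by (rule finite_subset) simp
  qed
  have "inj_on (\<lambda>x. (a * x + b) / (c * x + d)) (- ?p)"
  proof (rule inj_onI)
    fix x y assume "x \<in> - ?p" "y \<in> - ?p" and "(a * x + b) / (c * x + d) = (a * y + b) / (c * y + d)"
    then have "(a * x + b) * (c * y + d) = (a * y + b) * (c * x + d)"
      by (simp add: frac_eq_eq)
    then have "(a * d - b * c) * (x - y) = 0" by algebra
    with det show "x = y" by simp
  qed
  from finite_vimage_IntI[OF F this]
  have "finite (((\<lambda>x. (a * x + b) / (c * x + d)) -` F \<inter> - ?p) \<union> ?p)" using p by blast
  then show ?thesis by (rule rev_finite_subset) auto
qed

lemma finite_mat_slash: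
  assumes "finite {x. f x \<noteq> g x}" "det A \<noteq> 0"
  shows "finite {x. mat_slash s f A x \<noteq> mat_slash s g A x}"
proof -
  have "A$1$1 * A$2$2 - A$1$2 * A$2$1 \<noteq> 0" using assms(2) by (simp add: det_2)
  from finite_moebius_vimage[OF assms(1) this]
  show ?thesis by (rule rev_finite_subset) (auto simp: mat_slash_def)
qed

lemma finite_slash:
  "finite {x. f x \<noteq> g x} \<Longrightarrow> finite {x. slash s f \<gamma> x \<noteq> slash s g \<gamma> x}"
  by (transfer fixing: f g s) (rule finite_mat_slash, auto simp: psl_rel_def det_real_mat)

lift_definition act :: "complex \<Rightarrow> fgerm \<Rightarrow> psl2z \<Rightarrow> fgerm" is slash
  by (rule finite_slash)

lemma slash_one: "slash s f 1 = f"
  by (transfer fixing: s f) (simp add: mat_slash_def fun_eq_iff det_real_mat mat_def det_2)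

lemma act_one: "act s v 1 = v"
proof -
  have "act s v \<gamma> = v" if "\<gamma> = 1" for \<gamma>
    by (transfer fixing: s \<gamma>) (simp add: that slash_one)
  then show ?thesis by simp
qed

lemma mat_slash_mult:
  assumes "B$2$1 * x + B$2$2 \<noteq> 0"
  shows "mat_slash s (mat_slash s h A) B x = mat_slash s h (A ** B) x"
proof -
  define u where "u = B$2$1 * x + B$2$2"
  define y where "y = (B$1$1 * x + B$1$2) / u"
  have u: "u \<noteq> 0" using assms by (simp add: u_def)
  have uy: "B$1$1 * x + B$1$2 = u * y" using u by (simp add: y_def)
  have n: "(A ** B)$1$1 * x + (A ** B)$1$2 = u * (A$1$1 * y + A$1$2)"
  proof -
    have "(A ** B)$1$1 * x + (A ** B)$1$2 = A$1$1 * (B$1$1 * x + B$1$2) + A$1$2 * u"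
      by (simp add: matrix_matrix_mult_def sum_2 u_def algebra_simps)
    also have "\<dots> = u * (A$1$1 * y + A$1$2)"
      by (simp only: uy) (simp add: algebra_simps)
    finally show ?thesis .
  qed
  have d: "(A ** B)$2$1 * x + (A ** B)$2$2 = u * (A$2$1 * y + A$2$2)"
  proof -
    have "(A ** B)$2$1 * x + (A ** B)$2$2 = A$2$1 * (B$1$1 * x + B$1$2) + A$2$2 * u"
      by (simp add: matrix_matrix_mult_def sum_2 u_def algebra_simps)
    also have "\<dots> = u * (A$2$1 * y + A$2$2)"
      by (simp only: uy) (simp add: algebra_simps)
    finally show ?thesis .
  qed
  have pm: "of_real (\<bar>p\<bar> * \<bar>q\<bar>) powr t = of_real \<bar>p\<bar> powr t * (of_real \<bar>q\<bar> powr t :: complex)"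
    for p q :: real and t
    by (simp add: powr_times_real)
  show ?thesis
    unfolding mat_slash_def n d det_mul abs_mult pm
    using u by (simp flip: u_def add: y_def)
qed

lemma act_mult: "act s v (\<gamma> * \<delta>) = act s (act s v \<gamma>) \<delta>"
proof (transfer fixing: s \<gamma> \<delta>)
  fix f :: "real \<Rightarrow> complex"
  show "finite {x. slash s f (\<gamma> * \<delta>) x \<noteq> slash s (slash s f \<gamma>) \<delta> x}"
  proof (transfer fixing: s f)
    fix A B :: "int^2^2" assume "psl_rel A A" and B: "psl_rel B B"
    have m: "real_mat (A ** B) = real_mat A ** real_mat B"
      by (simp add: vec_eq_iff matrix_matrix_mult_def)
    have "finite {x. real_mat B$2$1 * x + real_mat B$2$2 = 0}"
    proof (cases "B$2$1 = 0")
      case True with B show ?thesis by (auto simp: psl_rel_def det_2)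
    next
      case False
      then have "{x. real_mat B$2$1 * x + real_mat B$2$2 = 0} \<subseteq> {- of_int (B$2$2) / of_int (B$2$1)}"
        by (auto simp: field_simps add_eq_0_iff)
      then show ?thesis by (rule finite_subset) simp
    qed
    moreover have "real_mat B$2$1 * x + real_mat B$2$2 = 0"
      if "mat_slash s f (real_mat (A ** B)) x
            \<noteq> mat_slash s (mat_slash s f (real_mat A)) (real_mat B) x" for x
      using mat_slash_mult[of "real_mat B" x s f "real_mat A"] that unfolding m by metis
    ultimately show "finite {x. mat_slash s f (real_mat (A ** B)) x
                 \<noteq> mat_slash s (mat_slash s f (real_mat A)) (real_mat B) x}"
      by (elim rev_finite_subset) blast
  qed
qed

section \<open>Spaces of analytic functions\<close>

definition real_analytic_at :: "(real \<Rightarrow> complex) \<Rightarrow> real \<Rightarrow> bool" where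
  "real_analytic_at f x \<longleftrightarrow>
     (\<exists>a r. r > 0 \<and> (\<forall>y. \<bar>y - x\<bar> < r \<longrightarrow> (\<lambda>n. a n * of_real (y - x) ^ n) sums f y))"

(* V^\<omega>_s(I) for I open in P^1(R); values of h off I are irrelevant.  At infinity,
   |x|^(-2s) h(-1/x) is only defined for x \<noteq> 0 and is required to extend analytically to 0. *)
definition V_omega_on :: "complex \<Rightarrow> real option set \<Rightarrow> (real \<Rightarrow> complex) set" where
  "V_omega_on s I =
     {h. (\<forall>x. Some x \<in> I \<longrightarrow> real_analytic_at h x) \<and>
         (None \<in> I \<longrightarrow>
            (\<exists>F. real_analytic_at F 0 \<and>
                 (\<forall>\<^sub>F x in at 0. F x = of_real \<bar>x\<bar> powr (- 2 * s) * h (- 1 / x))))}"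

(* Elements of the inductive limit over finite sets E of V^\<omega>_s(P^1(R) - E): two such functions
   are identified iff they agree off some larger finite set, i.e. iff they have the same fgerm. *)
definition V_fs :: "complex \<Rightarrow> fgerm set" where
  "V_fs s = {to_fgerm h | h E. finite E \<and> h \<in> V_omega_on s (- E)}"

(* V^\<omega>_s is identified with its image in V^fs_s, see inj_on_to_fgerm_V_omega. *)
definition V_omega :: "complex \<Rightarrow> fgerm set" where
  "V_omega s = to_fgerm ` V_omega_on s UNIV"

lemma V_omega_subset_V_fs: "V_omega s \<subseteq> V_fs s"
proof
  fix v assume "v \<in> V_omega s"
  then obtain h where "v = to_fgerm h" "h \<in> V_omega_on s (- {})" by (auto simp: V_omega_def)
  then show "v \<in> V_fs s" unfolding V_fs_def by blast
qed

lemma real_analytic_at_imp_isCont: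
  assumes "real_analytic_at f x"
  shows "isCont f x"
proof -
  obtain a r where r: "r > 0"
    and a: "\<And>y. \<bar>y - x\<bar> < r \<Longrightarrow> (\<lambda>n. a n * of_real (y - x) ^ n) sums f y"
    using assms by (auto simp: real_analytic_at_def)
  let ?P = "\<lambda>z. \<Sum>n. a n * z ^ n"
  have "summable (\<lambda>n. a n * complex_of_real (r / 2) ^ n)"
    using a[of "x + r / 2"] r by (auto simp: sums_iff)
  then have "isCont ?P 0"
    by (rule isCont_powser) (use r in simp)
  then have "isCont ?P (complex_of_real (x - x))" by simp
  moreover have "isCont (\<lambda>y. complex_of_real (y - x)) x" by (intro continuous_intros)
  ultimately have c: "isCont (\<lambda>y. ?P (complex_of_real (y - x))) x"
    by (rule isCont_o2[rotated])
  have "\<forall>\<^sub>F y in nhds x. \<bar>y - x\<bar> < r"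
    using r by (auto simp: eventually_nhds_metric dist_real_def)
  then have "\<forall>\<^sub>F y in nhds x. ?P (complex_of_real (y - x)) = f y"
    by (rule eventually_mono) (metis a sums_unique)
  then show ?thesis using c by (rule isCont_cong[THEN iffD1])
qed

lemma inj_on_to_fgerm_V_omega: "inj_on to_fgerm (V_omega_on s UNIV)"
proof (rule inj_onI, rule ext)
  fix f g x
  assume f: "f \<in> V_omega_on s UNIV" and g: "g \<in> V_omega_on s UNIV"
    and "to_fgerm f = to_fgerm g"
  then have fin: "finite {x. f x \<noteq> g x}" by (simp add: fgerm.abs_eq_iff)
  have "isCont f x" "isCont g x"
    using f g by (auto simp: V_omega_on_def intro!: real_analytic_at_imp_isCont)
  then have "(f \<longlongrightarrow> f x) (at x)" "(g \<longlongrightarrow> g x) (at x)" by (auto simp: isCont_def)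
  moreover have "\<forall>\<^sub>F y in at x. f y = g y"
  proof -
    have "open (- ({y. f y \<noteq> g y} - {x}))" using fin by (intro open_Compl finite_imp_closed) auto
    then have "\<forall>\<^sub>F y in at x. y \<in> - ({y. f y \<noteq> g y} - {x})"
      by (intro eventually_at_in_open') auto
    moreover have "\<forall>\<^sub>F y in at x. y \<noteq> x" by (simp add: eventually_at_filter)
    ultimately show ?thesis by eventually_elim auto
  qed
  ultimately show "f x = g x"
    using tendsto_unique[OF trivial_limit_at] tendsto_cong by metis
qed

section \<open>Group cohomology in degree one, for right actions\<close>

definition Z1 :: "('v::ab_group_add \<Rightarrow> 'g::monoid_mult \<Rightarrow> 'v) \<Rightarrow> 'v set \<Rightarrow> ('g \<Rightarrow> 'v) set" where
  "Z1 ac V = {\<psi>. (\<forall>\<gamma>. \<psi> \<gamma> \<in> V) \<and> (\<forall>\<gamma> \<delta>. \<psi> (\<gamma> * \<delta>) = ac (\<psi> \<gamma>) \<delta> + \<psi> \<delta>)}"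

definition B1 :: "('v::ab_group_add \<Rightarrow> 'g::monoid_mult \<Rightarrow> 'v) \<Rightarrow> 'v set \<Rightarrow> ('g \<Rightarrow> 'v) set" where
  "B1 ac V = {\<lambda>\<gamma>. v - ac v \<gamma> | v. v \<in> V}"

definition cohomologous ::
    "('v::ab_group_add \<Rightarrow> 'g::monoid_mult \<Rightarrow> 'v) \<Rightarrow> 'v set \<Rightarrow> (('g \<Rightarrow> 'v) \<times> ('g \<Rightarrow> 'v)) set" where
  "cohomologous ac V = {(\<psi>, \<psi>'). \<psi> \<in> Z1 ac V \<and> \<psi>' \<in> Z1 ac V \<and> (\<lambda>\<gamma>. \<psi> \<gamma> - \<psi>' \<gamma>) \<in> B1 ac V}"

definition H1 ::
    "('v::ab_group_add \<Rightarrow> 'g::monoid_mult \<Rightarrow> 'v) \<Rightarrow> 'v set \<Rightarrow> ('g \<Rightarrow> 'v) set set" where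
  "H1 ac V = Z1 ac V // cohomologous ac V"

definition H1_class ::
    "('v::ab_group_add \<Rightarrow> 'g::monoid_mult \<Rightarrow> 'v) \<Rightarrow> 'v set \<Rightarrow> ('g \<Rightarrow> 'v) \<Rightarrow> ('g \<Rightarrow> 'v) set" where
  "H1_class ac V \<psi> = cohomologous ac V `` {\<psi>}"

(* The map H^1(G;V) \<rightarrow> H^1(G;W) induced by an inclusion of V into W: a class c goes to
   the class in H^1(G;W) of any of its representatives. *)
definition H1_incl ::
    "('v::ab_group_add \<Rightarrow> 'g::monoid_mult \<Rightarrow> 'v) \<Rightarrow> 'v set \<Rightarrow> ('g \<Rightarrow> 'v) set \<Rightarrow> ('g \<Rightarrow> 'v) set" where
  "H1_incl ac W c = (\<Union>\<psi>\<in>c. H1_class ac W \<psi>)"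

definition H1_Fib :: "complex \<Rightarrow> fgerm set \<Rightarrow> (psl2z \<Rightarrow> fgerm) set set" where
  "H1_Fib s V =
     {H1_class (act s) V \<psi> | \<psi>. \<psi> \<in> Z1 (act s) V \<and>
        (\<exists>v\<in>V. \<psi> (psl_T * psl_S * psl_T^2) = v - act s v (psl_T * psl_S * psl_T^2))}"

section \<open>The four-term equation and the map \<open>\<theta>\<close>\<close>

definition phi :: real where
  "phi = (1 + sqrt 5) / 2"

(* Functions on X (open in R) are represented by functions on R that vanish off X. *)
definition FE4 :: "complex \<Rightarrow> real set \<Rightarrow> (real \<Rightarrow> complex) set" where
  "FE4 s X =
     {g. (\<forall>x\<in>X. real_analytic_at g x) \<and> (\<forall>x. x \<notin> X \<longrightarrow> g x = 0) \<and>
         (\<forall>x. Some x \<in> Some ` X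
                 \<inter> moebius (inverse psl_T ^ 2 * psl_S) ` Some ` X
                 \<inter> moebius psl_T ` Some ` X
                 \<inter> moebius (psl_T^2 * psl_S * psl_T) ` Some ` X \<longrightarrow>
              g x + slash s g (psl_S * psl_T^2) x =
              slash s g (inverse psl_T) x
                + slash s g (inverse psl_T * psl_S * inverse psl_T ^ 2) x)}"

(* theta_h and theta_k are meaningful on (-\<phi>,\<phi>) and (-\<phi>,1/\<phi>) only. *)
definition theta_h :: "complex \<Rightarrow> (real \<Rightarrow> complex) \<Rightarrow> real \<Rightarrow> complex" where
  "theta_h s g x = g x + slash s g (psl_S * psl_T^2) x"

definition theta_k :: "complex \<Rightarrow> (real \<Rightarrow> complex) \<Rightarrow> real \<Rightarrow> complex" where
  "theta_k s g x =
     slash s g (inverse psl_T) x + slash s (theta_h s g) (psl_S * psl_T * psl_S) x"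

(* The values at the end points of the intervals do not affect the fgerm. *)
definition theta_c1 :: "complex \<Rightarrow> (real \<Rightarrow> complex) \<Rightarrow> fgerm" where
  "theta_c1 s g = to_fgerm (\<lambda>x.
     if x \<in> {- phi <..< inverse phi} then theta_k s g x
     else - slash s (theta_k s g) psl_S x)"

definition theta_c2 :: "complex \<Rightarrow> (real \<Rightarrow> complex) \<Rightarrow> fgerm" where
  "theta_c2 s g = to_fgerm (\<lambda>x.
     if x \<in> {- phi <..< phi} then theta_h s g x
     else - (slash s (theta_h s g) (inverse psl_T * psl_S) x
             + slash s (theta_h s g) (psl_S * psl_T) x))"

definition theta_cocycle :: "complex \<Rightarrow> (real \<Rightarrow> complex) \<Rightarrow> psl2z \<Rightarrow> fgerm" where
  "theta_cocycle s g =
     (THE \<psi>. \<psi> \<in> Z1 (act s) (V_fs s) \<and> \<psi> psl_S = - theta_c1 s g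
           \<and> \<psi> (inverse psl_T * psl_S) = - theta_c2 s g)"

definition theta :: "complex \<Rightarrow> (real \<Rightarrow> complex) \<Rightarrow> (psl2z \<Rightarrow> fgerm) set" where
  "theta s g = H1_class (act s) (V_fs s) (theta_cocycle s g)"

end

theory Submission
  imports Defs "HOL-Complex_Analysis.Cauchy_Integral_Formula"
begin

text \<open>Put \<open>U = T\<inverse>S\<close>, so that \<open>\<Gamma>\<close> is the free product of \<open>\<langle>S\<rangle>\<close> and \<open>\<langle>U\<rangle>\<close> and \<open>TST\<^sup>2 = SUSU\<inverse>\<close>; this
  hyperbolic element has the attracting fixed point \<open>1/\<phi>\<close> and the repelling fixed point \<open>-\<phi>\<close>.
  A cocycle vanishing at \<open>TST\<^sup>2\<close> satisfies \<open>c\<^sub>1|(1 - U) = c\<^sub>2|(1 - S)\<close> with \<open>c\<^sub>1 = -\<psi>\<^sub>S\<close>, \<open>c\<^sub>2 = -\<psi>\<^sub>U\<close>, and the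
  relations between \<open>c\<^sub>1\<close> and \<open>c\<^sub>2\<close> amount to the four-term equation for \<open>g = (c\<^sub>1 - c\<^sub>2)|SU\<close>.

  Injectivity: if two such cocycles differ by the coboundary of \<open>v\<close>, then \<open>v|TST\<^sup>2 = v\<close>, so \<open>v\<close> is singular
  at most at the two fixed points, and analyticity of \<open>g\<close> at \<open>-1/\<phi>\<close> makes \<open>v\<close> analytic at \<open>1/\<phi>\<close>. In the
  coordinate \<open>t = (x - 1/\<phi>)/(x + \<phi>)\<close> invariance reads \<open>F(t) = \<lambda>\<^sup>s F(\<lambda>t)\<close> with \<open>0 < \<lambda> < 1\<close>, hence \<open>v = 0\<close>.

  A cocycle with analytic values is made to vanish at \<open>TST\<^sup>2\<close> by subtracting the coboundary of a
  geometric series \<open>\<Sum>\<^sub>n \<psi>|(TST\<^sup>2)\<^sup>n\<close>, which is singular only at \<open>-\<phi>\<close>. Conversely, \<open>c\<^sub>1 - c\<^sub>2\<close> is analytic at \<open>-\<phi>\<close>,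
  so the coboundary of any \<open>v\<close> that is singular only at \<open>-\<phi>\<close>, with \<open>v - c\<^sub>1\<close> analytic there, removes all
  singularities of the cocycle; such a \<open>v\<close> exists by a Cousin splitting with Cauchy integrals.\<close>

section \<open>Analytic germs\<close>

text \<open>\<open>TST^2\<close> is the commutator of \<open>S\<close> and \<open>U\<close>, so
  \<psi> vanishes there exactly when it takes the same value at \<open>SU\<close> and
  \<open>US\<close>; this is the relation between c1 and c2. The intervals come from two orbits:
  \<open>S\<close> swaps -\<phi> and 1/\<phi>, while \<open>U\<close> permutes \<phi>, -\<phi>,
  -1/\<phi>^2 cyclically. Hence c1 is singular at most at -\<phi>, 1/\<phi> and c2 at most at
  -\<phi>, \<phi>. As c1 - c2 is regular at -\<phi>, only 1/\<phi> and \<phi> remain, and the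
  inverse of \<open>SU\<close> takes them to \<phi> and -\<phi>^2, the end points of the domain of
  g. Re s > 0 enters as |\<lambda>^s| < 1: it makes the geometric series converge, and it forces an
  invariant function with a limit at the attracting point to vanish. Cocycles are built from their
  values at \<open>S\<close> and \<open>U\<close>, so the free product structure has to be proved as
  well; this is done by ping-pong on the real line. Functions are taken modulo finite sets, which
  makes poles of Moebius maps and end points of intervals harmless; pointwise statements are
  recovered at the end by continuity.\<close>

lemma real_analytic_at_iff:
  "real_analytic_at f x \<longleftrightarrow>
     (\<exists>F. F analytic_on {of_real x} \<and> (\<forall>\<^sub>F y in nhds x. f y = F (of_real y)))"
proof
  assume "real_analytic_at f x"
  then obtain a r where r: "r > 0"
    and a: "\<And>y. \<bar>y - x\<bar> < r \<Longrightarrow> (\<lambda>n. a n * of_real (y - x) ^ n) sums f y"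
    by (auto simp: real_analytic_at_def)
  define F where "F = (\<lambda>z. \<Sum>n. a n * (z - complex_of_real x) ^ n)"
  have "(\<lambda>n. a n * (w - of_real x) ^ n) sums F w" if "w \<in> ball (complex_of_real x) r" for w
  proof -
    \<comment> \<open>Convergence is known only at real points. Convergence at the real point x + t,
      with t larger than the modulus of w - x, gives it at the complex point w.\<close>
    define t where "t = (norm (w - of_real x) + r) / 2"
    have t: "norm (w - of_real x) < t" "t < r"
      using that by (auto simp: t_def dist_norm norm_minus_commute)
    have "(\<lambda>n. a n * of_real (x + t - x) ^ n) sums f (x + t)"
      using t norm_ge_zero[of "w - of_real x"] by (intro a) linarith
    then have "summable (\<lambda>n. a n * of_real t ^ n)" by (simp add: sums_iff)
    then have "summable (\<lambda>n. a n * (w - of_real x) ^ n)"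
      by (rule powser_inside) (use t norm_ge_zero[of "w - of_real x"] in auto)
    then show ?thesis by (simp add: F_def summable_sums)
  qed
  then have "F holomorphic_on ball (complex_of_real x) r"
    by (rule power_series_holomorphic)
  then have "F analytic_on {of_real x}" using r by (auto simp: analytic_at_ball)
  moreover have "f y = F (of_real y)" if "\<bar>y - x\<bar> < r" for y
    using a[OF that] by (simp add: F_def sums_iff)
  then have "\<forall>\<^sub>F y in nhds x. f y = F (of_real y)"
    using r by (auto simp: eventually_nhds_metric dist_real_def)
  ultimately show "\<exists>F. F analytic_on {of_real x} \<and> (\<forall>\<^sub>F y in nhds x. f y = F (of_real y))" by blast
next
  assume "\<exists>F. F analytic_on {of_real x} \<and> (\<forall>\<^sub>F y in nhds x. f y = F (of_real y))"
  then obtain F e d where e: "e > 0" "F holomorphic_on ball (of_real x) e"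
    and d: "d > 0" "\<And>y. dist y x < d \<Longrightarrow> f y = F (of_real y)"
    by (auto simp: analytic_at_ball eventually_nhds_metric)
  show "real_analytic_at f x"
    unfolding real_analytic_at_def
  proof (intro exI conjI allI impI)
    show "min e d > 0" using e d by simp
    fix y assume y: "\<bar>y - x\<bar> < min e d"
    have "of_real y \<in> ball (complex_of_real x) e"
      using y abs_minus_commute[of x y] by (auto simp: dist_norm simp flip: of_real_diff)
    from holomorphic_power_series[OF e(2) this]
    show "(\<lambda>n. (deriv ^^ n) F (of_real x) / fact n * of_real (y - x) ^ n) sums f y"
      using d(2)[of y] y by (simp add: dist_real_def)
  qed
qed

text \<open>The value at x itself is ignored, so that the property survives a change of finitely
  many values and makes sense for an \<open>fgerm\<close>.\<close>

definition analytic_germ :: "(real \<Rightarrow> complex) \<Rightarrow> real \<Rightarrow> bool" where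
  "analytic_germ f x \<longleftrightarrow>
     (\<exists>F. F analytic_on {of_real x} \<and> (\<forall>\<^sub>F y in at x. f y = F (of_real y)))"

lemma real_analytic_at_imp_germ: "real_analytic_at f x \<Longrightarrow> analytic_germ f x"
  unfolding real_analytic_at_iff analytic_germ_def eventually_at_filter
  by (auto elim: eventually_mono)

lemma analytic_germ_cong:
  assumes "\<forall>\<^sub>F y in at x. f y = g y"
  shows "analytic_germ f x \<longleftrightarrow> analytic_germ g x"
proof -
  have "(\<forall>\<^sub>F y in at x. f y = F (of_real y)) \<longleftrightarrow> (\<forall>\<^sub>F y in at x. g y = F (of_real y))" for F :: "complex \<Rightarrow> complex"
    by (rule eventually_subst) (use assms in eventually_elim, simp)
  then show ?thesis unfolding analytic_germ_def by simp
qed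

lemma real_analytic_at_cong:
  assumes "\<forall>\<^sub>F y in nhds x. f y = g y"
  shows "real_analytic_at f x \<longleftrightarrow> real_analytic_at g x"
proof -
  have "(\<forall>\<^sub>F y in nhds x. f y = F (of_real y)) \<longleftrightarrow> (\<forall>\<^sub>F y in nhds x. g y = F (of_real y))" for F :: "complex \<Rightarrow> complex"
    by (rule eventually_subst) (use assms in eventually_elim, simp)
  then show ?thesis unfolding real_analytic_at_iff by simp
qed

lemma eventually_at_of_real:
  assumes "eventually P (nhds (complex_of_real x))"
  shows "\<forall>\<^sub>F y in nhds x. P (of_real y)"
proof -
  have "filterlim complex_of_real (nhds (of_real x)) (nhds x)"
    by (intro tendsto_of_real filterlim_ident)
  with assms show ?thesis by (rule eventually_compose_filterlim)
qed

lemma analytic_germ_real_analytic_near: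
  assumes "analytic_germ f x"
  shows "\<forall>\<^sub>F y in at x. real_analytic_at f y"
proof -
  obtain F where F: "F analytic_on {of_real x}" and e: "\<forall>\<^sub>F y in at x. f y = F (of_real y)"
    using assms by (auto simp: analytic_germ_def)
  obtain d where d: "d > 0" "F holomorphic_on ball (of_real x) d"
    using F by (auto simp: analytic_at_ball)
  have "\<forall>\<^sub>F y in nhds x. of_real y \<in> ball (complex_of_real x) d"
    using d by (intro eventually_at_of_real eventually_nhds_in_open) auto
  then have "\<forall>\<^sub>F y in at x. of_real y \<in> ball (complex_of_real x) d"
    unfolding eventually_at_filter by (rule eventually_mono) simp
  \<comment> \<open>Equality on a punctured neighbourhood of x gives equality on a full
    neighbourhood of each nearby y other than x, which analyticity at y requires.\<close>
  moreover have "\<forall>\<^sub>F y in at x. \<forall>\<^sub>F z in nhds y. z \<noteq> x \<longrightarrow> f z = F (of_real z)"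
  proof -
    have "\<forall>\<^sub>F y in nhds x. y \<noteq> x \<longrightarrow> f y = F (of_real y)"
      using e by (simp add: eventually_at_filter)
    then have "\<forall>\<^sub>F y in nhds x. \<forall>\<^sub>F z in nhds y. z \<noteq> x \<longrightarrow> f z = F (of_real z)"
      by (simp add: eventually_eventually)
    then show ?thesis unfolding eventually_at_filter by (rule eventually_mono) simp
  qed
  moreover have "\<forall>\<^sub>F y in at x. y \<noteq> x" by (simp add: eventually_at_filter)
  ultimately show ?thesis
  proof eventually_elim
    case (elim y)
    have "F analytic_on {of_real y}"
      using elim d by (auto simp: analytic_at intro!: exI[of _ "ball (complex_of_real x) d"])
    moreover have "\<forall>\<^sub>F z in nhds y. z \<noteq> x" using elim by (intro t1_space_nhds)
    then have "\<forall>\<^sub>F z in nhds y. f z = F (of_real z)"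
      using elim(2) by eventually_elim simp
    ultimately show ?case by (auto simp: real_analytic_at_iff)
  qed
qed

lemma analytic_germ_tendsto:
  assumes "F analytic_on {of_real x}" "\<forall>\<^sub>F y in at x. f y = F (of_real y)"
  shows "(f \<longlongrightarrow> F (of_real x)) (at x)"
proof -
  have "isCont F (of_real x)" using assms(1) by (rule analytic_at_imp_isCont)
  then have "((\<lambda>y. F (of_real y)) \<longlongrightarrow> F (of_real x)) (at x)"
    by (rule isCont_tendsto_compose) (intro tendsto_of_real tendsto_ident_at)
  then show ?thesis using assms(2) by (subst tendsto_cong)
qed

lemma Lim_eq_of_real_analytic:
  assumes "real_analytic_at f x"
  shows "Lim (at x) f = f x"
  using real_analytic_at_imp_isCont[OF assms] by (intro tendsto_Lim) (auto simp: isCont_def)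

text \<open>Taking limits repairs all removable defects at once: near x but off x the function f is
  already analytic and equals its limit, and at x the limit is the value of the holomorphic
  extension.\<close>

lemma analytic_germ_regularize:
  assumes "analytic_germ f x"
  shows "real_analytic_at (\<lambda>y. Lim (at y) f) x" "\<forall>\<^sub>F y in at x. Lim (at y) f = f y"
proof -
  obtain F where F: "F analytic_on {of_real x}" and e: "\<forall>\<^sub>F y in at x. f y = F (of_real y)"
    using assms by (auto simp: analytic_germ_def)
  show *: "\<forall>\<^sub>F y in at x. Lim (at y) f = f y"
    using analytic_germ_real_analytic_near[OF assms]
    by eventually_elim (rule Lim_eq_of_real_analytic)
  have "\<forall>\<^sub>F y in at x. Lim (at y) f = F (of_real y)"
    using * e by eventually_elim simp
  moreover have "Lim (at x) f = F (of_real x)"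
    using analytic_germ_tendsto[OF F e] by (intro tendsto_Lim) auto
  ultimately have "\<forall>\<^sub>F y in nhds x. Lim (at y) f = F (of_real y)"
    by (simp add: eventually_nhds_conv_at)
  then show "real_analytic_at (\<lambda>y. Lim (at y) f) x"
    using F by (auto simp: real_analytic_at_iff)
qed

lemma analytic_germ_add:
  "analytic_germ f x \<Longrightarrow> analytic_germ g x \<Longrightarrow> analytic_germ (\<lambda>y. f y + g y) x"
  unfolding analytic_germ_def
  by (elim exE conjE, rule_tac x="\<lambda>z. F z + Fa z" in exI)
     (auto intro!: analytic_intros elim: eventually_elim2)

lemma analytic_germ_uminus: "analytic_germ f x \<Longrightarrow> analytic_germ (\<lambda>y. - f y) x"
  unfolding analytic_germ_def
  by (elim exE conjE, rule_tac x="\<lambda>z. - F z" in exI)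
     (auto intro!: analytic_intros elim: eventually_mono)

lemma real_analytic_at_add:
  "real_analytic_at f x \<Longrightarrow> real_analytic_at g x \<Longrightarrow> real_analytic_at (\<lambda>y. f y + g y) x"
  unfolding real_analytic_at_iff
  by (elim exE conjE, rule_tac x="\<lambda>z. F z + Fa z" in exI)
     (auto intro!: analytic_intros elim: eventually_elim2)

lemma real_analytic_at_uminus: "real_analytic_at f x \<Longrightarrow> real_analytic_at (\<lambda>y. - f y) x"
  unfolding real_analytic_at_iff
  by (elim exE conjE, rule_tac x="\<lambda>z. - F z" in exI)
     (auto intro!: analytic_intros elim: eventually_mono)

lemma real_analytic_at_const: "real_analytic_at (\<lambda>_. c) x"
  unfolding real_analytic_at_iff by (rule exI[of _ "\<lambda>_. c"]) auto

text \<open>The absolute value has no holomorphic extension, but cy + d keeps its sign near x.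
  Multiplying by this sign replaces |cy + d| by a positive linear function, on which
  \<open>powr\<close> is analytic.\<close>

lemma mat_slash_holomorphic_form:
  fixes A :: "real^2^2"
  assumes "A$2$1 * x + A$2$2 \<noteq> 0"
  shows "\<exists>J. J analytic_on {of_real x} \<and>
    (\<forall>f. \<forall>\<^sub>F y in nhds x. mat_slash s f A y =
       J (of_real y) * f ((A$1$1 * y + A$1$2) / (A$2$1 * y + A$2$2)))"
proof -
  define u where "u = (\<lambda>y. sgn (A$2$1 * x + A$2$2) * (A$2$1 * y + A$2$2))"
  define J where "J = (\<lambda>z. of_real \<bar>det A\<bar> powr s *
     (of_real (sgn (A$2$1 * x + A$2$2)) * (of_real (A$2$1) * z + of_real (A$2$2))) powr (- 2 * s))"
  have ux: "u x > 0" using assms by (auto simp: u_def sgn_if)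
  have "J analytic_on {of_real x}"
  proof -
    have "of_real (sgn (A$2$1 * x + A$2$2)) * (of_real (A$2$1) * of_real x + of_real (A$2$2)) = complex_of_real (u x)"
      by (simp add: u_def)
    then show ?thesis unfolding J_def
      using ux by (intro analytic_intros) auto
  qed
  moreover have "\<forall>\<^sub>F y in nhds x. mat_slash s f A y =
       J (of_real y) * f ((A$1$1 * y + A$1$2) / (A$2$1 * y + A$2$2))" for f
  proof -
    have "\<forall>\<^sub>F y in nhds x. u y > 0"
    proof -
      have "(u \<longlongrightarrow> u x) (nhds x)" unfolding u_def by (intro tendsto_intros filterlim_ident)
      then show ?thesis using ux by (rule order_tendstoD)
    qed
    then show ?thesis
    proof eventually_elim
      case (elim y)
      have "\<bar>sgn (A$2$1 * x + A$2$2)\<bar> = 1" using assms by (auto simp: sgn_if)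
      then have "\<bar>u y\<bar> = \<bar>A$2$1 * y + A$2$2\<bar>" by (simp add: u_def abs_mult)
      then have "u y = \<bar>A$2$1 * y + A$2$2\<bar>" using elim by simp
      then have "of_real \<bar>A$2$1 * y + A$2$2\<bar> = complex_of_real (u y)" by simp
      then show ?case by (simp add: mat_slash_def J_def u_def)
    qed
  qed
  ultimately show ?thesis by blast
qed

lemma analytic_on_mat:
  fixes A :: "real^2^2"
  assumes "A$2$1 * x + A$2$2 \<noteq> 0"
    and F: "F analytic_on {complex_of_real ((A$1$1 * x + A$1$2) / (A$2$1 * x + A$2$2))}"
  shows "(\<lambda>z. F ((of_real (A$1$1) * z + of_real (A$1$2)) / (of_real (A$2$1) * z + of_real (A$2$2))))
          analytic_on {of_real x}"
proof -
  have nz: "complex_of_real (A$2$1) * of_real x + of_real (A$2$2) \<noteq> 0"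
    using assms(1) by (metis of_real_add of_real_eq_0_iff of_real_mult)
  have "F \<circ> (\<lambda>z. (of_real (A$1$1) * z + of_real (A$1$2)) / (of_real (A$2$1) * z + of_real (A$2$2)))
          analytic_on {of_real x}"
    by (rule analytic_on_compose_gen[OF _ F]) (use nz in \<open>auto intro!: analytic_intros\<close>)
  then show ?thesis by (simp add: o_def)
qed

lemma tendsto_mat:
  fixes A :: "real^2^2"
  assumes "A$2$1 * x + A$2$2 \<noteq> 0"
  shows "((\<lambda>y. (A$1$1 * y + A$1$2) / (A$2$1 * y + A$2$2)) \<longlongrightarrow>
          (A$1$1 * x + A$1$2) / (A$2$1 * x + A$2$2)) (nhds x)"
  by (intro tendsto_intros filterlim_ident) fact

lemma mat_inj:
  fixes a b c d x y :: real
  assumes "a * d - b * c \<noteq> 0" "c * x + d \<noteq> 0" "c * y + d \<noteq> 0"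
    "(a * x + b) / (c * x + d) = (a * y + b) / (c * y + d)"
  shows "x = y"
proof -
  have "(a * x + b) * (c * y + d) = (a * y + b) * (c * x + d)"
    using assms by (simp add: frac_eq_eq)
  then have "(a * d - b * c) * (x - y) = 0" by algebra
  with assms(1) show "x = y" by simp
qed

lemma filterlim_mat_at:
  fixes A :: "real^2^2"
  assumes nz: "A$2$1 * x + A$2$2 \<noteq> 0" and det: "det A \<noteq> 0"
  shows "filterlim (\<lambda>y. (A$1$1 * y + A$1$2) / (A$2$1 * y + A$2$2))
          (at ((A$1$1 * x + A$1$2) / (A$2$1 * x + A$2$2))) (at x)"
proof (rule filterlim_atI)
  show "((\<lambda>y. (A$1$1 * y + A$1$2) / (A$2$1 * y + A$2$2)) \<longlongrightarrow>
          (A$1$1 * x + A$1$2) / (A$2$1 * x + A$2$2)) (at x)"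
    using tendsto_mat[OF nz] by (rule filterlim_mono) (auto simp: at_within_le_nhds)
  have "((\<lambda>y. A$2$1 * y + A$2$2) \<longlongrightarrow> A$2$1 * x + A$2$2) (at x)" by (intro tendsto_intros)
  then have "\<forall>\<^sub>F y in at x. A$2$1 * y + A$2$2 \<noteq> 0" using nz by (rule tendsto_imp_eventually_ne)
  moreover have "\<forall>\<^sub>F y in at x. y \<noteq> x" by (simp add: eventually_at_filter)
  ultimately show "\<forall>\<^sub>F y in at x. (A$1$1 * y + A$1$2) / (A$2$1 * y + A$2$2) \<noteq>
      (A$1$1 * x + A$1$2) / (A$2$1 * x + A$2$2)"
  proof eventually_elim
    case (elim y)
    then show ?case using mat_inj[of "A$1$1" "A$2$2" "A$1$2" "A$2$1" y x] nz det
      by (auto simp: det_2)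
  qed
qed

lemma real_analytic_at_mat_slash:
  fixes A :: "real^2^2"
  assumes nz: "A$2$1 * x + A$2$2 \<noteq> 0"
    and f: "real_analytic_at f ((A$1$1 * x + A$1$2) / (A$2$1 * x + A$2$2))"
  shows "real_analytic_at (mat_slash s f A) x"
proof -
  obtain J where J: "J analytic_on {of_real x}"
    and J_eq: "\<And>f. \<forall>\<^sub>F y in nhds x. mat_slash s f A y =
       J (of_real y) * f ((A$1$1 * y + A$1$2) / (A$2$1 * y + A$2$2))"
    using mat_slash_holomorphic_form[OF nz, of s] by (elim exE conjE) (rule that, auto)
  note eq = J_eq[of f]
  obtain F where F: "F analytic_on {of_real ((A$1$1 * x + A$1$2) / (A$2$1 * x + A$2$2))}"
    and e: "\<forall>\<^sub>F y in nhds ((A$1$1 * x + A$1$2) / (A$2$1 * x + A$2$2)). f y = F (of_real y)"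
    using f by (auto simp: real_analytic_at_iff)
  have "\<forall>\<^sub>F y in nhds x. f ((A$1$1 * y + A$1$2) / (A$2$1 * y + A$2$2)) =
      F (of_real ((A$1$1 * y + A$1$2) / (A$2$1 * y + A$2$2)))"
    by (rule eventually_compose_filterlim[OF e tendsto_mat[OF nz]])
  with eq have "\<forall>\<^sub>F y in nhds x. mat_slash s f A y = J (of_real y) *
     F ((of_real (A$1$1) * of_real y + of_real (A$1$2)) / (of_real (A$2$1) * of_real y + of_real (A$2$2)))"
    by eventually_elim simp
  then show ?thesis unfolding real_analytic_at_iff
    by (intro exI[of _ "\<lambda>z. J z * F ((of_real (A$1$1) * z + of_real (A$1$2)) / (of_real (A$2$1) * z + of_real (A$2$2)))"]
        conjI analytic_intros J analytic_on_mat[OF nz F])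
qed

lemma analytic_germ_mat_slash:
  fixes A :: "real^2^2"
  assumes nz: "A$2$1 * x + A$2$2 \<noteq> 0" and det: "det A \<noteq> 0"
    and f: "analytic_germ f ((A$1$1 * x + A$1$2) / (A$2$1 * x + A$2$2))"
  shows "analytic_germ (mat_slash s f A) x"
proof -
  let ?M = "\<lambda>y. (A$1$1 * y + A$1$2) / (A$2$1 * y + A$2$2)"
  have "\<forall>\<^sub>F y in at x. Lim (at (?M y)) f = f (?M y)"
    by (rule eventually_compose_filterlim[OF analytic_germ_regularize(2)[OF f] filterlim_mat_at[OF nz det]])
  then have "\<forall>\<^sub>F y in at x. mat_slash s (\<lambda>y. Lim (at y) f) A y = mat_slash s f A y"
    by eventually_elim (simp add: mat_slash_def)
  moreover have "analytic_germ (mat_slash s (\<lambda>y. Lim (at y) f) A) x"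
    by (intro real_analytic_at_imp_germ real_analytic_at_mat_slash nz analytic_germ_regularize f)
  ultimately show ?thesis using analytic_germ_cong by blast
qed

section \<open>The action of real matrices on germs and on the projective line\<close>

lemma to_fgerm_eq_iff: "to_fgerm f = to_fgerm g \<longleftrightarrow> finite {x. f x \<noteq> g x}"
  by (rule fgerm.abs_eq_iff)

lemma to_fgerm_rep_fgerm [simp]: "to_fgerm (rep_fgerm v) = v"
  by (rule Quotient3_abs_rep[OF Quotient3_fgerm])

lemma finite_rep_to_fgerm: "finite {x. rep_fgerm (to_fgerm f) x \<noteq> f x}"
  by (simp flip: to_fgerm_eq_iff)

lemma eventually_at_eq_of_finite:
  fixes f g :: "real \<Rightarrow> complex"
  assumes X: "open X" "x \<in> X" and fin: "finite {y \<in> X. f y \<noteq> g y}"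
  shows "\<forall>\<^sub>F y in at x. f y = g y"
proof -
  have "open (X - ({y \<in> X. f y \<noteq> g y} - {x}))" using X fin by (intro open_Diff finite_imp_closed) auto
  then have "\<forall>\<^sub>F y in at x. y \<in> X - ({y \<in> X. f y \<noteq> g y} - {x})"
    using X by (intro eventually_at_in_open') auto
  moreover have "\<forall>\<^sub>F y in at x. y \<noteq> x" by (simp add: eventually_at_filter)
  ultimately show ?thesis by eventually_elim auto
qed

lemmas eventually_at_finite_diff = eventually_at_eq_of_finite[OF open_UNIV UNIV_I, simplified]

lemma analytic_germ_rep_to_fgerm:
  "analytic_germ (rep_fgerm (to_fgerm f)) x \<longleftrightarrow> analytic_germ f x"
  by (intro analytic_germ_cong eventually_at_finite_diff finite_rep_to_fgerm)

lemma plus_to_fgerm: "to_fgerm f + to_fgerm g = to_fgerm (\<lambda>x. f x + g x)"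
  by (rule plus_fgerm.abs_eq)

lemma uminus_to_fgerm: "- to_fgerm f = to_fgerm (\<lambda>x. - f x)"
  by (rule uminus_fgerm.abs_eq)

lemma minus_to_fgerm: "to_fgerm f - to_fgerm g = to_fgerm (\<lambda>x. f x - g x)"
  by (rule minus_fgerm.abs_eq)

text \<open>The action of all invertible real matrices is used because the matrix
  \<open>fix_mat\<close> that diagonalises \<open>TST^2\<close> is not in the modular group; its
  determinant is the square root of 5.\<close>

definition gact :: "complex \<Rightarrow> fgerm \<Rightarrow> real^2^2 \<Rightarrow> fgerm" where
  "gact s v A = to_fgerm (mat_slash s (rep_fgerm v) A)"

lemma gact_to_fgerm: "det A \<noteq> 0 \<Longrightarrow> gact s (to_fgerm f) A = to_fgerm (mat_slash s f A)"
  unfolding gact_def to_fgerm_eq_iff by (intro finite_mat_slash finite_rep_to_fgerm)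

lemma mat_slash_add: "mat_slash s (\<lambda>x. f x + g x) A = (\<lambda>x. mat_slash s f A x + mat_slash s g A x)"
  by (simp add: fun_eq_iff mat_slash_def algebra_simps)

lemma mat_slash_zero: "mat_slash s (\<lambda>_. 0) A = (\<lambda>_. 0)"
  by (simp add: fun_eq_iff mat_slash_def)

lemma mat_slash_one: "mat_slash s f (mat 1) = f"
  by (simp add: fun_eq_iff mat_slash_def mat_def det_2)

lemma gact_add: "det A \<noteq> 0 \<Longrightarrow> gact s (u + v) A = gact s u A + gact s v A"
  by (subst (1 2) to_fgerm_rep_fgerm[symmetric], subst plus_to_fgerm, subst gact_to_fgerm)
     (simp_all add: gact_def plus_to_fgerm mat_slash_add)

lemma finite_linear_zero:
  fixes c d :: real
  assumes "c \<noteq> 0 \<or> d \<noteq> 0"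
  shows "finite {x. c * x + d = 0}"
proof (cases "c = 0")
  case True with assms show ?thesis by simp
next
  case False
  then have "{x. c * x + d = 0} \<subseteq> {- d / c}" by (auto simp: field_simps add_eq_0_iff)
  then show ?thesis by (rule finite_subset) simp
qed

text \<open>The slash action composes except possibly at the pole of B, which is at most one point
  and invisible to germs.\<close>

lemma gact_mult:
  assumes "det A \<noteq> 0" "det B \<noteq> 0"
  shows "gact s (gact s v A) B = gact s v (A ** B)"
proof -
  have "gact s (gact s v A) B = to_fgerm (mat_slash s (mat_slash s (rep_fgerm v) A) B)"
    using assms by (simp add: gact_def[of s v A] gact_to_fgerm)
  also have "\<dots> = gact s v (A ** B)"
    unfolding gact_def to_fgerm_eq_iff
  proof (rule finite_subset)
    show "finite {x. B$2$1 * x + B$2$2 = 0}"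
      using assms by (intro finite_linear_zero) (auto simp: det_2)
  qed (use mat_slash_mult in blast)
  finally show ?thesis .
qed

lemma gact_one: "gact s v (mat 1) = v"
  by (simp add: gact_def mat_slash_one)

section \<open>Moebius maps in homogeneous coordinates\<close>

definition homog :: "real option \<Rightarrow> real \<times> real" where
  "homog p = (case p of None \<Rightarrow> (1, 0) | Some x \<Rightarrow> (x, 1))"

definition dehomog :: "real \<Rightarrow> real \<Rightarrow> real option" where
  "dehomog u w = (if w = 0 then None else Some (u / w))"

lemma mat_moebius_homog:
  "mat_moebius A p = dehomog (A$1$1 * fst (homog p) + A$1$2 * snd (homog p))
                             (A$2$1 * fst (homog p) + A$2$2 * snd (homog p))"
  by (auto simp: mat_moebius_def homog_def dehomog_def split: option.splits)

lemma dehomog_scale: "k \<noteq> 0 \<Longrightarrow> dehomog (k * u) (k * w) = dehomog u w"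
  by (simp add: dehomog_def)

lemma homog_dehomog:
  assumes "u \<noteq> 0 \<or> w \<noteq> 0"
  obtains k where "k \<noteq> 0" "u = k * fst (homog (dehomog u w))" "w = k * snd (homog (dehomog u w))"
proof (cases "w = 0")
  case True with assms that[of u] show ?thesis by (simp add: homog_def dehomog_def)
next
  case False with that[of w] show ?thesis by (simp add: homog_def dehomog_def)
qed

text \<open>On homogeneous coordinates the maps are linear and injective, so composition is matrix
  multiplication; \<open>k\<close> is the scalar lost when a vector is normalised to a point. No
  case distinction over the poles of A and B arises.\<close>

lemma mat_moebius_mult:
  assumes "det B \<noteq> 0"
  shows "mat_moebius (A ** B) p = mat_moebius A (mat_moebius B p)"
proof -
  define x y where "x = fst (homog p)" and "y = snd (homog p)"
  define u w where "u = B$1$1 * x + B$1$2 * y" and "w = B$2$1 * x + B$2$2 * y"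
  have "x \<noteq> 0 \<or> y \<noteq> 0" by (auto simp: x_def y_def homog_def split: option.splits)
  moreover have "det B * x = B$2$2 * u - B$1$2 * w" "det B * y = B$1$1 * w - B$2$1 * u"
    by (simp_all add: det_2 u_def w_def algebra_simps)
  ultimately have "u \<noteq> 0 \<or> w \<noteq> 0" using assms by auto
  then obtain k where k: "k \<noteq> 0" "u = k * fst (homog (dehomog u w))" "w = k * snd (homog (dehomog u w))"
    by (rule homog_dehomog)
  define a b where "a = fst (homog (dehomog u w))" and "b = snd (homog (dehomog u w))"
  have ka: "u = k * a" "w = k * b" using k by (simp_all add: a_def b_def)
  have "mat_moebius (A ** B) p = dehomog (A$1$1 * u + A$1$2 * w) (A$2$1 * u + A$2$2 * w)"
    by (simp add: mat_moebius_homog x_def y_def u_def w_def matrix_matrix_mult_def sum_2 algebra_simps)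
  also have "\<dots> = dehomog (k * (A$1$1 * a + A$1$2 * b)) (k * (A$2$1 * a + A$2$2 * b))"
    by (simp add: ka algebra_simps)
  also have "\<dots> = mat_moebius A (dehomog u w)"
    by (simp only: dehomog_scale[OF k(1)] mat_moebius_homog a_def b_def)
  also have "dehomog u w = mat_moebius B p" by (simp add: mat_moebius_homog u_def w_def x_def y_def)
  finally show ?thesis .
qed

lemma mat_moebius_one: "mat_moebius (mat 1) p = p"
  by (auto simp: mat_moebius_def mat_def split: option.splits)

lemma det_nz_inverse:
  fixes A :: "real^2^2"
  assumes "det A \<noteq> 0"
  obtains B where "det B \<noteq> 0" "A ** B = mat 1" "B ** A = mat 1"
proof -
  have "invertible A" using assms by (simp add: invertible_det_nz)
  then obtain B where B: "A ** B = mat 1" "B ** A = mat 1" by (auto simp: invertible_def)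
  have "det A * det B = 1" using B by (metis det_I det_mul)
  then have "det B \<noteq> 0" by auto
  with B that show ?thesis by blast
qed

(* Quantifying over all A with A x = p treats the point at infinity like any other and makes
   the notion equivariant by construction. *)
definition regular_at :: "complex \<Rightarrow> fgerm \<Rightarrow> real option \<Rightarrow> bool" where
  "regular_at s v p \<longleftrightarrow> (\<forall>A x. det A \<noteq> 0 \<longrightarrow> mat_moebius A (Some x) = p \<longrightarrow>
                    analytic_germ (rep_fgerm (gact s v A)) x)"

lemma regular_at_gact:
  assumes A: "det A \<noteq> 0"
  shows "regular_at s (gact s v A) p \<longleftrightarrow> regular_at s v (mat_moebius A p)"
proof
  assume L: "regular_at s (gact s v A) p"
  obtain A' where A': "det A' \<noteq> 0" "A ** A' = mat 1" "A' ** A = mat 1" using A by (rule det_nz_inverse)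
  show "regular_at s v (mat_moebius A p)" unfolding regular_at_def
  proof (intro allI impI)
    fix B x assume B: "det B \<noteq> 0" "mat_moebius B (Some x) = mat_moebius A p"
    have "mat_moebius (A' ** B) (Some x) = p"
      using A A' B by (simp add: mat_moebius_mult) (simp add: mat_moebius_one flip: mat_moebius_mult)
    with L have "analytic_germ (rep_fgerm (gact s (gact s v A) (A' ** B))) x"
      using A' B by (simp add: regular_at_def det_mul)
    moreover have "gact s (gact s v A) (A' ** B) = gact s v B"
      using A A' B by (simp add: gact_mult det_mul matrix_mul_assoc)
    ultimately show "analytic_germ (rep_fgerm (gact s v B)) x" by simp
  qed
next
  assume R: "regular_at s v (mat_moebius A p)"
  show "regular_at s (gact s v A) p" unfolding regular_at_def
  proof (intro allI impI)
    fix B x assume B: "det B \<noteq> 0" "mat_moebius B (Some x) = p"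
    with R A show "analytic_germ (rep_fgerm (gact s (gact s v A) B)) x"
      by (auto simp: regular_at_def gact_mult det_mul mat_moebius_mult)
  qed
qed

lemma regular_at_Some: "regular_at s v (Some x) \<longleftrightarrow> analytic_germ (rep_fgerm v) x"
proof
  assume "regular_at s v (Some x)"
  then have "det (mat 1 :: real^2^2) \<noteq> 0 \<longrightarrow> mat_moebius (mat 1) (Some x) = Some x \<longrightarrow>
      analytic_germ (rep_fgerm (gact s v (mat 1))) x" unfolding regular_at_def by blast
  then show "analytic_germ (rep_fgerm v) x" by (simp add: gact_one mat_moebius_one)
next
  assume R: "analytic_germ (rep_fgerm v) x"
  show "regular_at s v (Some x)" unfolding regular_at_def
  proof (intro allI impI)
    fix A y assume A: "det A \<noteq> 0" "mat_moebius A (Some y) = Some x"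
    then have "A$2$1 * y + A$2$2 \<noteq> 0" "x = (A$1$1 * y + A$1$2) / (A$2$1 * y + A$2$2)"
      by (auto simp: mat_moebius_def split: if_splits)
    then show "analytic_germ (rep_fgerm (gact s v A)) y"
      using A R by (simp add: gact_def analytic_germ_rep_to_fgerm analytic_germ_mat_slash)
  qed
qed

lemma regular_at_None: "regular_at s v None \<longleftrightarrow> analytic_germ (mat_slash s (rep_fgerm v) (mat2 0 (-1) 1 0)) 0"
proof -
  have "regular_at s v None \<longleftrightarrow> regular_at s v (mat_moebius (mat2 0 (-1) 1 0) (Some 0))"
    by (simp add: mat_moebius_def)
  also have "\<dots> \<longleftrightarrow> regular_at s (gact s v (mat2 0 (-1) 1 0)) (Some 0)"
    by (subst regular_at_gact) (simp_all add: det_2)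
  finally show ?thesis by (simp add: regular_at_Some gact_def analytic_germ_rep_to_fgerm)
qed

lemma regular_at_add: "regular_at s u p \<Longrightarrow> regular_at s v p \<Longrightarrow> regular_at s (u + v) p"
  unfolding regular_at_def
proof (intro allI impI)
  fix A x assume "\<forall>A x. det A \<noteq> 0 \<longrightarrow> mat_moebius A (Some x) = p \<longrightarrow> analytic_germ (rep_fgerm (gact s u A)) x"
    "\<forall>A x. det A \<noteq> 0 \<longrightarrow> mat_moebius A (Some x) = p \<longrightarrow> analytic_germ (rep_fgerm (gact s v A)) x"
    and A: "det A \<noteq> 0" "mat_moebius A (Some x) = p"
  then have "analytic_germ (rep_fgerm (gact s u A)) x" "analytic_germ (rep_fgerm (gact s v A)) x" by auto
  then have "analytic_germ (\<lambda>y. rep_fgerm (gact s u A) y + rep_fgerm (gact s v A) y) x"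
    by (rule analytic_germ_add)
  moreover have "gact s (u + v) A = to_fgerm (\<lambda>y. rep_fgerm (gact s u A) y + rep_fgerm (gact s v A) y)"
    using A by (simp add: gact_add flip: plus_to_fgerm)
  ultimately show "analytic_germ (rep_fgerm (gact s (u + v) A)) x"
    by (simp add: analytic_germ_rep_to_fgerm)
qed

lemma to_fgerm_zero: "to_fgerm (\<lambda>_. 0) = 0"
  by (rule zero_fgerm.abs_eq[symmetric])

lemma gact_zero: "det A \<noteq> 0 \<Longrightarrow> gact s 0 A = 0"
  by (subst to_fgerm_zero[symmetric], subst gact_to_fgerm)
     (simp_all add: mat_slash_zero to_fgerm_zero)

lemma gact_uminus: "det A \<noteq> 0 \<Longrightarrow> gact s (- v) A = - gact s v A"
  using gact_add[of A s v "- v"] by (simp add: gact_zero minus_unique)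

lemma regular_at_uminus: "regular_at s v p \<Longrightarrow> regular_at s (- v) p"
  unfolding regular_at_def
proof (intro allI impI)
  fix A x assume "\<forall>A x. det A \<noteq> 0 \<longrightarrow> mat_moebius A (Some x) = p \<longrightarrow> analytic_germ (rep_fgerm (gact s v A)) x"
    and A: "det A \<noteq> 0" "mat_moebius A (Some x) = p"
  then have "analytic_germ (rep_fgerm (gact s v A)) x" by auto
  then have "analytic_germ (\<lambda>y. - rep_fgerm (gact s v A) y) x" by (rule analytic_germ_uminus)
  moreover have "gact s (- v) A = to_fgerm (\<lambda>y. - rep_fgerm (gact s v A) y)"
    using A by (simp add: gact_uminus flip: uminus_to_fgerm)
  ultimately show "analytic_germ (rep_fgerm (gact s (- v) A)) x"
    by (simp add: analytic_germ_rep_to_fgerm)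
qed

lemma regular_at_diff: "regular_at s u p \<Longrightarrow> regular_at s v p \<Longrightarrow> regular_at s (u - v) p"
  using regular_at_add[of s u p "- v"] regular_at_uminus by simp

lemma det_rep_psl2z: "det (rep_psl2z \<gamma>) = 1"
  using Quotient3_rep_reflp[OF Quotient3_psl2z, of \<gamma>] by (simp add: psl_rel_def)

lemma slash_eq_mat_slash: "slash s f \<gamma> = mat_slash s f (real_mat (rep_psl2z \<gamma>))"
  by (simp add: slash_def)

lemma act_eq_gact: "act s v \<gamma> = gact s v (real_mat (rep_psl2z \<gamma>))"
  by (simp add: act_def gact_def slash_eq_mat_slash)

lemma moebius_eq_mat_moebius: "moebius \<gamma> = mat_moebius (real_mat (rep_psl2z \<gamma>))"
  by (simp add: moebius_def)

lemma act_to_fgerm: "act s (to_fgerm f) \<gamma> = to_fgerm (slash s f \<gamma>)"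
  by (rule act.abs_eq)

lemma act_add: "act s (u + v) \<gamma> = act s u \<gamma> + act s v \<gamma>"
  by (simp add: act_eq_gact gact_add det_real_mat det_rep_psl2z)

lemma act_zero: "act s 0 \<gamma> = 0"
  by (simp add: act_eq_gact gact_zero det_real_mat det_rep_psl2z)

lemma act_uminus: "act s (- v) \<gamma> = - act s v \<gamma>"
  by (simp add: act_eq_gact gact_uminus det_real_mat det_rep_psl2z)

lemma act_diff: "act s (u - v) \<gamma> = act s u \<gamma> - act s v \<gamma>"
  using act_add[of s u "- v" \<gamma>] by (simp add: act_uminus)

lemma regular_at_act: "regular_at s (act s v \<gamma>) p \<longleftrightarrow> regular_at s v (moebius \<gamma> p)"
  by (simp add: act_eq_gact moebius_eq_mat_moebius regular_at_gact det_real_mat det_rep_psl2z)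

lemma real_mat_mult: "real_mat (A ** B) = real_mat A ** real_mat B"
  by (simp add: vec_eq_iff matrix_matrix_mult_def)

lemma moebius_abs_psl2z:
  assumes "det A = 1"
  shows "moebius (abs_psl2z A) = mat_moebius (real_mat A)"
  using assms by (intro moebius.abs_eq) (simp add: psl_rel_def)

lemma slash_abs_psl2z:
  assumes "det A = 1"
  shows "slash s f (abs_psl2z A) = mat_slash s f (real_mat A)"
  using assms by (intro slash.abs_eq) (simp add: psl_rel_def)

lemma abs_psl2z_rep_psl2z: "abs_psl2z (rep_psl2z \<gamma>) = \<gamma>"
  by (rule Quotient3_abs_rep[OF Quotient3_psl2z])

lemma abs_psl2z_mult:
  assumes "det A = 1" "det B = 1"
  shows "abs_psl2z A * abs_psl2z B = abs_psl2z (A ** B)"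
  using assms by (intro times_psl2z.abs_eq) (simp_all add: psl_rel_def)

lemma moebius_mult: "moebius (\<gamma> * \<delta>) p = moebius \<gamma> (moebius \<delta> p)"
proof -
  have "\<gamma> * \<delta> = abs_psl2z (rep_psl2z \<gamma> ** rep_psl2z \<delta>)"
    using abs_psl2z_mult[OF det_rep_psl2z det_rep_psl2z, of \<gamma> \<delta>] by (simp add: abs_psl2z_rep_psl2z)
  then show ?thesis
    by (simp add: moebius_abs_psl2z det_mul det_rep_psl2z real_mat_mult mat_moebius_mult
        det_real_mat flip: moebius_eq_mat_moebius)
qed

lemma moebius_one: "moebius 1 p = p"
proof -
  have "(1 :: psl2z) = abs_psl2z (mat 1)" by (rule one_psl2z.abs_eq)
  moreover have "real_mat (mat 1) = mat 1" by (simp add: vec_eq_iff mat_def)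
  ultimately show ?thesis
    by (metis moebius_abs_psl2z mat_moebius_one det_I)
qed

section \<open>The spaces \<open>V\<^sup>f\<^sup>s\<close> and \<open>V\<^sup>\<omega>\<close>\<close>

text \<open>The exceptional set may always be enlarged by infinity, so the condition there drops
  out.\<close>

lemma V_fs_altdef: "V_fs s = {to_fgerm h | h. finite {x. \<not> real_analytic_at h x}}"
proof (intro equalityI subsetI)
  fix v assume "v \<in> V_fs s"
  then obtain h E where h: "v = to_fgerm h" "finite E" "h \<in> V_omega_on s (- E)" by (auto simp: V_fs_def)
  have "{x. \<not> real_analytic_at h x} \<subseteq> Some -` E" using h(3) by (auto simp: V_omega_on_def)
  moreover have "finite (Some -` E)" using h(2) by (intro finite_vimageI) auto
  ultimately show "v \<in> {to_fgerm h | h. finite {x. \<not> real_analytic_at h x}}"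
    using h(1) finite_subset by blast
next
  fix v assume "v \<in> {to_fgerm h | h. finite {x. \<not> real_analytic_at h x}}"
  then obtain h where h: "v = to_fgerm h" "finite {x. \<not> real_analytic_at h x}" by blast
  define E where "E = insert None (Some ` {x. \<not> real_analytic_at h x})"
  have "finite E" "h \<in> V_omega_on s (- E)" using h(2) by (auto simp: E_def V_omega_on_def)
  then show "v \<in> V_fs s" unfolding V_fs_def using h(1) by blast
qed

lemma V_fsI: "finite {x. \<not> real_analytic_at h x} \<Longrightarrow> to_fgerm h \<in> V_fs s"
  unfolding V_fs_altdef by blast

lemma V_fsE:
  assumes "v \<in> V_fs s"
  obtains h where "v = to_fgerm h" "finite {x. \<not> real_analytic_at h x}"
  using assms unfolding V_fs_altdef by blast

lemma V_fs_add:
  assumes "u \<in> V_fs s" "v \<in> V_fs s"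
  shows "u + v \<in> V_fs s"
proof -
  obtain f where f: "u = to_fgerm f" "finite {x. \<not> real_analytic_at f x}"
    using assms(1) by (rule V_fsE)
  obtain g where g: "v = to_fgerm g" "finite {x. \<not> real_analytic_at g x}"
    using assms(2) by (rule V_fsE)
  have "finite {x. \<not> real_analytic_at (\<lambda>y. f y + g y) x}"
    by (rule finite_subset[OF _ finite_UnI[OF f(2) g(2)]]) (auto intro: real_analytic_at_add)
  then show ?thesis unfolding f(1) g(1) plus_to_fgerm by (rule V_fsI)
qed

lemma V_fs_uminus:
  assumes "u \<in> V_fs s"
  shows "- u \<in> V_fs s"
proof -
  obtain f where f: "u = to_fgerm f" "finite {x. \<not> real_analytic_at f x}"
    using assms by (rule V_fsE)
  have "finite {x. \<not> real_analytic_at (\<lambda>y. - f y) x}"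
    by (rule finite_subset[OF _ f(2)]) (auto intro: real_analytic_at_uminus)
  then show ?thesis unfolding f(1) uminus_to_fgerm by (rule V_fsI)
qed

lemma V_fs_diff: "u \<in> V_fs s \<Longrightarrow> v \<in> V_fs s \<Longrightarrow> u - v \<in> V_fs s"
  using V_fs_add[of u s "- v"] V_fs_uminus by simp

lemma V_fs_zero: "0 \<in> V_fs s"
  unfolding to_fgerm_zero[symmetric] by (rule V_fsI) (simp add: real_analytic_at_const)

lemma V_fs_gact:
  assumes "det A \<noteq> 0" "u \<in> V_fs s"
  shows "gact s u A \<in> V_fs s"
proof -
  obtain f where f: "u = to_fgerm f" "finite {x. \<not> real_analytic_at f x}"
    using assms(2) by (rule V_fsE)
  have 1: "finite {x. (A$1$1 * x + A$1$2) / (A$2$1 * x + A$2$2) \<in> {x. \<not> real_analytic_at f x}}"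
    using assms(1) by (intro finite_moebius_vimage f) (simp add: det_2)
  have 2: "finite {x. A$2$1 * x + A$2$2 = 0}"
    using assms by (intro finite_linear_zero) (auto simp: det_2)
  have "finite {x. \<not> real_analytic_at (mat_slash s f A) x}"
    by (rule finite_subset[OF _ finite_UnI[OF 1 2]]) (auto intro: real_analytic_at_mat_slash)
  then show ?thesis unfolding f(1) gact_to_fgerm[OF assms(1)] by (rule V_fsI)
qed

lemma V_fs_act: "u \<in> V_fs s \<Longrightarrow> act s u \<gamma> \<in> V_fs s"
  by (simp add: act_eq_gact V_fs_gact det_real_mat det_rep_psl2z)

lemma V_fs_finite_singularities:
  assumes "v \<in> V_fs s"
  shows "finite {p. \<not> regular_at s v p}"
proof -
  obtain f where f: "v = to_fgerm f" "finite {x. \<not> real_analytic_at f x}"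
    using assms by (rule V_fsE)
  have "{p. \<not> regular_at s v p} \<subseteq> insert None (Some ` {x. \<not> real_analytic_at f x})"
  proof
    fix p assume "p \<in> {p. \<not> regular_at s v p}"
    then show "p \<in> insert None (Some ` {x. \<not> real_analytic_at f x})"
      by (cases p) (auto simp: regular_at_Some f(1) analytic_germ_rep_to_fgerm intro: real_analytic_at_imp_germ)
  qed
  then show ?thesis using f(2) by (auto intro: finite_subset)
qed

lemma V_omega_altdef: "V_omega s = {v. \<forall>p. regular_at s v p}"
proof (intro equalityI subsetI CollectI allI)
  fix v p assume "v \<in> V_omega s"
  then obtain h where h: "v = to_fgerm h" "\<And>x. real_analytic_at h x"
    and "\<exists>F. real_analytic_at F 0 \<and> (\<forall>\<^sub>F x in at 0. F x = of_real \<bar>x\<bar> powr (- 2 * s) * h (- 1 / x))"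
    by (auto simp: V_omega_def V_omega_on_def)
  then obtain F where F: "real_analytic_at F 0"
    "\<forall>\<^sub>F x in at 0. F x = of_real \<bar>x\<bar> powr (- 2 * s) * h (- 1 / x)" by blast
  show "regular_at s v p"
  proof (cases p)
    case None
    have eq: "\<forall>\<^sub>F x in at 0. mat_slash s (rep_fgerm v) (mat2 0 (-1) 1 0) x = mat_slash s h (mat2 0 (-1) 1 0) x"
      unfolding h(1)
      by (intro eventually_at_finite_diff finite_mat_slash finite_rep_to_fgerm) (simp add: det_2)
    have "\<forall>\<^sub>F x in at 0. F x = mat_slash s (rep_fgerm v) (mat2 0 (-1) 1 0) x"
      using eq F(2) by eventually_elim (auto simp: mat_slash_def det_2)
    then show ?thesis using F(1) analytic_germ_cong unfolding None regular_at_None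
      by (blast dest: real_analytic_at_imp_germ)
  next
    case (Some x)
    then show ?thesis using h by (simp add: regular_at_Some analytic_germ_rep_to_fgerm real_analytic_at_imp_germ)
  qed
next
  fix v assume "v \<in> {v. \<forall>p. regular_at s v p}"
  then have v: "regular_at s v p" for p by blast
  define f where "f = rep_fgerm v"
  define h where "h = (\<lambda>x. Lim (at x) f)"
  have f: "analytic_germ f x" for x using v[of "Some x"] by (simp add: regular_at_Some f_def)
  have h: "real_analytic_at h x" for x using analytic_germ_regularize(1)[OF f] by (simp add: h_def)
  have hf: "\<forall>\<^sub>F y in at x. h y = f y" for x
    using analytic_germ_regularize(2)[OF f] by (simp add: h_def)
  obtain G where G: "G analytic_on {0}"
    "\<forall>\<^sub>F x in at 0. mat_slash s f (mat2 0 (-1) 1 0) x = G (of_real x)"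
    using v[of None] by (auto simp: regular_at_None analytic_germ_def f_def)
  define B where "B = {x. h x \<noteq> f x}"
  \<comment> \<open>Regularity at infinity, pulled back by the involution x -> -1/x, makes f itself
    analytic at all real points of large modulus; hence \<open>B\<close> is bounded.\<close>
  have inf: "\<forall>\<^sub>F x in at 0. real_analytic_at f (- 1 / x)"
  proof -
    have "analytic_germ (mat_slash s f (mat2 0 (-1) 1 0)) 0"
      using v[of None] by (simp add: regular_at_None f_def)
    then have "\<forall>\<^sub>F x in at 0. real_analytic_at (mat_slash s f (mat2 0 (-1) 1 0)) x"
      by (rule analytic_germ_real_analytic_near)
    moreover have "\<forall>\<^sub>F x :: real in at 0. x \<noteq> 0" by (simp add: eventually_at_filter)
    ultimately show ?thesis
    proof eventually_elim
      case (elim x)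
      have "real_analytic_at (mat_slash s (mat_slash s f (mat2 0 (-1) 1 0)) (mat2 0 (-1) 1 0)) (- 1 / x)"
        by (rule real_analytic_at_mat_slash) (use elim in simp_all)
      moreover have "\<forall>\<^sub>F y in nhds (- 1 / x). mat_slash s (mat_slash s f (mat2 0 (-1) 1 0)) (mat2 0 (-1) 1 0) y = f y"
      proof -
        have "\<forall>\<^sub>F y in nhds (- 1 / x). y \<noteq> 0" using elim by (intro t1_space_nhds) auto
        then show ?thesis
        proof eventually_elim
          case (elim y)
          have "mat2 0 (-1) 1 0 ** mat2 0 (-1) 1 0 = (- mat 1 :: real^2^2)"
            by (simp add: vec_eq_iff forall_2 matrix_matrix_mult_def sum_2 mat_def)
          then show ?case using elim
            by (simp add: mat_slash_mult) (simp add: mat_slash_def mat_def det_2)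
        qed
      qed
      ultimately show ?case using real_analytic_at_cong by blast
    qed
  qed
  then obtain d where d: "d > 0" "\<And>x. x \<noteq> 0 \<Longrightarrow> \<bar>x\<bar> < d \<Longrightarrow> real_analytic_at f (- 1 / x)"
    by (auto simp: eventually_at dist_real_def)
  have "B \<subseteq> {- (1 / d)..1 / d}"
  proof
    fix y assume "y \<in> B"
    then have "\<not> real_analytic_at f y"
      using Lim_eq_of_real_analytic by (auto simp: B_def h_def)
    then have "\<not> (y \<noteq> 0 \<and> \<bar>- 1 / y\<bar> < d)" using d(2)[of "- 1 / y"] by auto
    then have "y = 0 \<or> d \<le> 1 / \<bar>y\<bar>" by auto
    then have "y = 0 \<or> 1 / d \<ge> \<bar>y\<bar>" using d(1)
      by (cases "y = 0") (auto simp: pos_le_divide_eq mult.commute)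
    then show "y \<in> {- (1 / d)..1 / d}" using d(1) by auto
  qed
  \<comment> \<open>f and h agree on a punctured neighbourhood of every real point, so the bounded
    set \<open>B\<close> has no accumulation point and is finite. Thus h represents v.\<close>
  moreover have "\<not> x islimpt B" for x
    using hf[of x] by (auto simp: islimpt_iff_eventually B_def)
  ultimately have "finite B"
    using compact_eq_Bolzano_Weierstrass[of "{- (1 / d)..1 / d}"] by (metis compact_Icc)
  then have "to_fgerm h = v" unfolding B_def by (simp add: f_def flip: to_fgerm_eq_iff)
  moreover have "h \<in> V_omega_on s UNIV"
    unfolding V_omega_on_def
  proof (intro CollectI conjI allI impI h)
    have "\<forall>\<^sub>F x in at 0. mat_slash s h (mat2 0 (-1) 1 0) x = mat_slash s f (mat2 0 (-1) 1 0) x"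
      using \<open>finite B\<close> unfolding B_def
      by (intro eventually_at_finite_diff finite_mat_slash) (simp_all add: det_2)
    with G(2) have "\<forall>\<^sub>F x in at 0. G (of_real x) = of_real \<bar>x\<bar> powr (- 2 * s) * h (- 1 / x)"
      by eventually_elim (simp add: mat_slash_def det_2)
    moreover have "real_analytic_at (\<lambda>x. G (of_real x)) 0"
      using G(1) by (auto simp: real_analytic_at_iff intro!: exI[of _ G])
    ultimately show "\<exists>F. real_analytic_at F 0 \<and>
        (\<forall>\<^sub>F x in at 0. F x = of_real \<bar>x\<bar> powr (- 2 * s) * h (- 1 / x))" by blast
  qed
  ultimately show "v \<in> V_omega s" unfolding V_omega_def by blast
qed

lemma V_omega_add: "u \<in> V_omega s \<Longrightarrow> v \<in> V_omega s \<Longrightarrow> u + v \<in> V_omega s"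
  by (auto simp: V_omega_altdef regular_at_add)

lemma V_omega_uminus: "u \<in> V_omega s \<Longrightarrow> - u \<in> V_omega s"
  by (auto simp: V_omega_altdef regular_at_uminus)

lemma V_omega_zero: "0 \<in> V_omega s"
proof -
  have "regular_at s 0 p" for p unfolding regular_at_def
  proof (intro allI impI)
    fix A x assume "det (A :: real^2^2) \<noteq> 0"
    then have "gact s 0 A = to_fgerm (\<lambda>_. 0)" by (simp add: gact_zero to_fgerm_zero)
    then show "analytic_germ (rep_fgerm (gact s 0 A)) x"
      by (simp add: analytic_germ_rep_to_fgerm real_analytic_at_const real_analytic_at_imp_germ)
  qed
  then show ?thesis by (auto simp: V_omega_altdef)
qed

lemma V_omega_act: "u \<in> V_omega s \<Longrightarrow> act s u \<gamma> \<in> V_omega s"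
  by (auto simp: V_omega_altdef regular_at_act)

section \<open>Presentation of the modular group\<close>

definition psl_U :: psl2z where
  "psl_U = inverse psl_T * psl_S"

lemma psl_S_abs: "psl_S = abs_psl2z (mat2 0 (-1) 1 0)"
  by (simp add: psl_S_def)

lemma psl_T_abs: "psl_T = abs_psl2z (mat2 1 1 0 1)"
  by (simp add: psl_T_def)

lemma mat2_mult:
  "mat2 a b c d ** mat2 a' b' c' d' =
     (mat2 (a * a' + b * c') (a * b' + b * d') (c * a' + d * c') (c * b' + d * d') :: 'a::comm_ring_1^2^2)"
  by (simp add: vec_eq_iff forall_2 matrix_matrix_mult_def sum_2)

lemma mat2_eta: "mat2 (A$1$1) (A$1$2) (A$2$1) (A$2$2) = A"
  by (simp add: vec_eq_iff forall_2)

lemma det_mat2: "det (mat2 a b c d :: 'a::comm_ring_1^2^2) = a * d - b * c"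
  by (simp add: det_2)

lemma abs_psl2z_mat2_mult:
  assumes "a * d - b * c = 1" "a' * d' - b' * c' = 1"
  shows "abs_psl2z (mat2 a b c d) * abs_psl2z (mat2 a' b' c' d') =
    abs_psl2z (mat2 (a * a' + b * c') (a * b' + b * d') (c * a' + d * c') (c * b' + d * d'))"
  using assms by (simp add: abs_psl2z_mult det_mat2 mat2_mult)

lemma abs_psl2z_uminus:
  assumes "a * d - b * c = 1"
  shows "abs_psl2z (mat2 (- a) (- b) (- c) (- d)) = abs_psl2z (mat2 a b c d)"
proof -
  have "mat2 (- a) (- b) (- c) (- d) = - mat2 a b c d" by (simp add: vec_eq_iff forall_2)
  then have "psl_rel (mat2 (- a) (- b) (- c) (- d)) (mat2 a b c d)"
    using assms by (simp add: psl_rel_def det_mat2 det_uminus_2)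
  then show ?thesis using Quotient3_rel_abs[OF Quotient3_psl2z] by blast
qed

lemma one_psl2z_abs: "1 = abs_psl2z (mat2 1 0 0 1)"
proof -
  have "(mat 1 :: int^2^2) = mat2 1 0 0 1" by (simp add: vec_eq_iff forall_2 mat_def)
  then show ?thesis by (simp add: one_psl2z_def)
qed

lemma psl_SS [simp]: "psl_S * psl_S = 1"
  by (simp add: psl_S_abs one_psl2z_abs abs_psl2z_mat2_mult abs_psl2z_uminus[of 1 1 0 0, simplified])

lemma psl_SS' [simp]: "psl_S * (psl_S * \<gamma>) = \<gamma>"
  by (simp flip: mult.assoc)

lemma inverse_psl_T: "inverse psl_T = psl_U * psl_S"
  by (simp add: psl_U_def mult.assoc)

lemma psl_U_abs: "psl_U = abs_psl2z (mat2 (-1) (-1) 1 0)"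
proof -
  have "psl_T * abs_psl2z (mat2 (-1) (-1) 1 0) = psl_S"
    by (simp add: psl_S_abs psl_T_abs abs_psl2z_mat2_mult)
  then have "inverse psl_T * psl_T * abs_psl2z (mat2 (-1) (-1) 1 0) = psl_U"
    by (simp add: psl_U_def mult.assoc)
  then show ?thesis by (simp add: psl2z_left_inverse)
qed

lemma psl_UU_abs: "psl_U * psl_U = abs_psl2z (mat2 0 1 (-1) (-1))"
  by (simp add: psl_U_abs abs_psl2z_mat2_mult)

lemma psl_UUU [simp]: "psl_U * (psl_U * psl_U) = 1"
  by (simp only: psl_UU_abs) (simp add: psl_U_abs one_psl2z_abs abs_psl2z_mat2_mult)

lemma psl_UUU' [simp]: "psl_U * (psl_U * (psl_U * \<gamma>)) = \<gamma>"
  by (metis mult.assoc psl_UUU mult_1)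

lemma psl_T_eq: "psl_T = psl_S * (psl_U * psl_U)"
proof -
  have "psl_T * (inverse psl_T * (psl_S * (psl_U * psl_U))) = psl_T"
    by (simp add: inverse_psl_T mult.assoc)
  then show ?thesis
    by (simp add: psl2z_right_inverse flip: mult.assoc)
qed

text \<open>Euclidean algorithm on the first column (a, c): a power of T replaces a by a mod c and S
  exchanges the rows, so |c| decreases until c = 0, where the matrix is a power of T up to
  sign.\<close>

lemma psl_SU_induct [case_names one S U]:
  assumes one: "P 1" and S: "\<And>\<gamma>. P \<gamma> \<Longrightarrow> P (psl_S * \<gamma>)" and U: "\<And>\<gamma>. P \<gamma> \<Longrightarrow> P (psl_U * \<gamma>)"
  shows "P \<gamma>"
proof -
  have T1: "P (psl_T * \<gamma>)" if "P \<gamma>" for \<gamma>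
    using S U that by (simp add: psl_T_eq mult.assoc)
  have T2: "P (inverse psl_T * \<gamma>)" if "P \<gamma>" for \<gamma>
    using S U that by (simp add: inverse_psl_T mult.assoc)
  have Tm: "psl_T * abs_psl2z (mat2 a b c d) = abs_psl2z (mat2 (a + c) (b + d) c d)"
    if "a * d - b * c = 1" for a b c d
    using that by (simp add: psl_T_abs abs_psl2z_mat2_mult)
  have Tn: "inverse psl_T * abs_psl2z (mat2 a b c d) = abs_psl2z (mat2 (a - c) (b - d) c d)"
    if "a * d - b * c = 1" for a b c d
  proof -
    have "psl_T * abs_psl2z (mat2 (a - c) (b - d) c d) = abs_psl2z (mat2 a b c d)"
      using that by (subst Tm) (auto simp: algebra_simps)
    then have "inverse psl_T * (psl_T * abs_psl2z (mat2 (a - c) (b - d) c d)) =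
      inverse psl_T * abs_psl2z (mat2 a b c d)" by simp
    then show ?thesis by (simp add: psl2z_left_inverse flip: mult.assoc)
  qed
  have shift_nat: "P (abs_psl2z (mat2 (a + int k * c) (b + int k * d) c d)) \<and>
      P (abs_psl2z (mat2 (a - int k * c) (b - int k * d) c d))"
    if "P (abs_psl2z (mat2 a b c d))" "a * d - b * c = 1" for a b c d k
  proof (induction k)
    case 0
    with that show ?case by simp
  next
    case (Suc k)
    have "(a + int k * c) * d - (b + int k * d) * c = 1" "(a - int k * c) * d - (b - int k * d) * c = 1"
      using that(2) by (simp_all add: algebra_simps)
    from Tm[OF this(1)] Tn[OF this(2)] T1[OF Suc.IH[THEN conjunct1]] T2[OF Suc.IH[THEN conjunct2]]
    show ?case by (simp add: algebra_simps)
  qed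
  have shift: "P (abs_psl2z (mat2 (a + k * c) (b + k * d) c d))"
    if "P (abs_psl2z (mat2 a b c d))" "a * d - b * c = 1" for a b c d k
    using shift_nat[OF that, of "nat \<bar>k\<bar>"] by (cases "k \<ge> 0") simp_all
  have "a * d - b * c = 1 \<Longrightarrow> P (abs_psl2z (mat2 a b c d))" for a b c d
  proof (induction "nat \<bar>c\<bar>" arbitrary: a b c d rule: less_induct)
    case less
    show ?case
    proof (cases "c = 0")
      case True
      then have ad: "a * d = 1" using less.prems by simp
      have unip: "P (abs_psl2z (mat2 1 k 0 1))" for k
        using shift[of 1 0 0 1 k] one by (simp add: one_psl2z_abs)
      from ad consider "a = 1" "d = 1" | "a = -1" "d = -1"
        by (auto simp: zmult_eq_1_iff)
      then show ?thesis
      proof cases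
        case 1 with True unip show ?thesis by simp
      next
        case 2
        have "abs_psl2z (mat2 (- 1) (- (- b)) (- 0) (- 1)) = abs_psl2z (mat2 1 (- b) 0 1)"
          by (rule abs_psl2z_uminus) simp
        with 2 True unip[of "- b"] show ?thesis by simp
      qed
    next
      case False
      define q where "q = a div c"
      define a' where "a' = a - q * c"
      define b' where "b' = b - q * d"
      have det': "a' * d - b' * c = 1" using less.prems by (simp add: a'_def b'_def algebra_simps)
      have "a' = a mod c" by (simp add: a'_def q_def minus_div_mult_eq_mod)
      then have "nat \<bar>a'\<bar> < nat \<bar>c\<bar>" using False abs_mod_less[of c a] by simp
      then have "P (abs_psl2z (mat2 (- c) (- d) a' b'))"
        by (rule less.hyps) (use det' in \<open>simp add: algebra_simps\<close>)
      then have "P (psl_S * abs_psl2z (mat2 (- c) (- d) a' b'))" by (rule S)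
      moreover have "psl_S * abs_psl2z (mat2 (- c) (- d) a' b') = abs_psl2z (mat2 a' b' c d)"
        using det' by (simp add: psl_S_abs abs_psl2z_mat2_mult abs_psl2z_uminus algebra_simps)
      ultimately have "P (abs_psl2z (mat2 (a' + q * c) (b' + q * d) c d))"
        using shift[OF _ det'] by simp
      then show ?thesis by (simp add: a'_def b'_def)
    qed
  qed
  from this[of "rep_psl2z \<gamma> $ 1 $ 1" "rep_psl2z \<gamma> $ 2 $ 2" "rep_psl2z \<gamma> $ 1 $ 2" "rep_psl2z \<gamma> $ 2 $ 1"]
  show ?thesis using det_rep_psl2z[of \<gamma>] by (simp add: mat2_eta abs_psl2z_rep_psl2z det_2)
qed

lemma moebius_psl_S: "moebius psl_S p = (case p of None \<Rightarrow> Some 0 | Some x \<Rightarrow> if x = 0 then None else Some (- 1 / x))"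
  by (simp add: psl_S_abs moebius_abs_psl2z det_mat2 mat_moebius_def split: option.splits)

lemma moebius_psl_U: "moebius psl_U p = (case p of None \<Rightarrow> Some (- 1) | Some x \<Rightarrow> if x = 0 then None else Some (- 1 - 1 / x))"
  by (auto simp: psl_U_abs moebius_abs_psl2z det_mat2 mat_moebius_def field_simps split: option.splits)

section \<open>Words in S (\<open>False\<close>) and U (\<open>True\<close>), and why they satisfy
  only the relations of the free product\<close>

primrec run :: "('x \<Rightarrow> 'x) \<Rightarrow> ('x \<Rightarrow> 'x) \<Rightarrow> bool list \<Rightarrow> 'x \<Rightarrow> 'x" where
  "run f g [] x = x"
| "run f g (b # w) x = (if b then g else f) (run f g w x)"

text \<open>Products of blocks SU and SU^(-1); since g is meant to have order 3,
  \<open>g \<circ> g\<close> stands for its inverse.\<close>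

primrec alt_run :: "('x \<Rightarrow> 'x) \<Rightarrow> ('x \<Rightarrow> 'x) \<Rightarrow> bool list \<Rightarrow> 'x \<Rightarrow> 'x" where
  "alt_run f g [] x = x"
| "alt_run f g (b # w) x = f ((if b then g else g \<circ> g) (alt_run f g w x))"

(* Normal forms in the free product of Z/2 and Z/3. *)
definition nf_run :: "('x \<Rightarrow> 'x) \<Rightarrow> ('x \<Rightarrow> 'x) \<Rightarrow> nat \<Rightarrow> bool list \<Rightarrow> bool \<Rightarrow> 'x \<Rightarrow> 'x" where
  "nf_run f g e bs j x = (g ^^ e) (alt_run f g bs (if j then f x else x))"

lemma run_append: "run f g (u @ w) x = run f g u (run f g w x)"
  by (induction u) auto

text \<open>A new letter U only changes the leading exponent modulo 3. A new letter S opens a block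
  if that exponent is nonzero; otherwise it cancels the S of the first block or, if there is no
  block, toggles the trailing S.\<close>

lemma run_normal_form:
  assumes f: "\<And>x. f (f x) = x" and g: "\<And>x. g (g (g x)) = x"
  shows "\<exists>e bs j. e < 3 \<and> (\<forall>x. run f g w x = nf_run f g e bs j x)"
proof (induction w)
  case Nil
  show ?case by (intro exI[of _ 0] exI[of _ "[]"] exI[of _ False]) (simp add: nf_run_def)
next
  case (Cons b w)
  then obtain e bs j where e: "e < 3" and w: "\<And>x. run f g w x = nf_run f g e bs j x" by blast
  consider "e = 0" | "e = 1" | "e = 2" using e by linarith
  note cases_e = this
  show ?case
  proof (cases b)
    case True
    have "run f g (b # w) x = nf_run f g ((e + 1) mod 3) bs j x" for x
      by (rule cases_e) (use True in \<open>simp_all add: w nf_run_def g numeral_2_eq_2\<close>)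
    then show ?thesis by (metis mod_less_divisor zero_less_numeral)
  next
    case False
    from cases_e show ?thesis
    proof cases
      case 1
      show ?thesis
      proof (cases bs)
        case Nil
        have "run f g (b # w) x = nf_run f g 0 [] (\<not> j) x" for x
          using False 1 Nil by (simp add: w nf_run_def f)
        then show ?thesis by (metis zero_less_numeral)
      next
        case (Cons c cs)
        have "run f g (b # w) x = nf_run f g (if c then 1 else 2) cs j x" for x
          using False 1 Cons by (simp add: w nf_run_def f numeral_2_eq_2)
        moreover have "(if c then 1 else 2 :: nat) < 3" by simp
        ultimately show ?thesis by metis
      qed
    next
      case 2
      have "run f g (b # w) x = nf_run f g 0 (True # bs) j x" for x
        using False 2 by (simp add: w nf_run_def)
      then show ?thesis by (metis zero_less_numeral)
    next
      case 3
      have "run f g (b # w) x = nf_run f g 0 (False # bs) j x" for x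
        using False 3 by (simp add: w nf_run_def numeral_2_eq_2)
      then show ?thesis by (metis zero_less_numeral)
    qed
  qed
qed

text \<open>On positive reals the two blocks are y / (y + 1), which is below 1, and y + 1, which is
  above 1: they preserve positivity and never produce 1.\<close>

lemma alt_run_moebius_pos:
  assumes "x > 0"
  shows "\<exists>y>0. alt_run (moebius psl_S) (moebius psl_U) bs (Some x) = Some y \<and> (bs \<noteq> [] \<longrightarrow> y \<noteq> 1)"
proof (induction bs)
  case Nil
  with assms show ?case by simp
next
  case (Cons b bs)
  then obtain y where y: "y > 0" "alt_run (moebius psl_S) (moebius psl_U) bs (Some x) = Some y" by blast
  have 1: "moebius psl_S (moebius psl_U (Some y)) = Some (y / (y + 1))"
    using y(1) by (auto simp: moebius_psl_S moebius_psl_U field_simps)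
  have 2: "moebius psl_S (moebius psl_U (moebius psl_U (Some y))) = Some (y + 1)"
    using y(1) by (auto simp: moebius_psl_S moebius_psl_U field_simps)
  show ?case
  proof (cases b)
    case True
    then show ?thesis using y 1 by (intro exI[of _ "y / (y + 1)"]) simp
  next
    case False
    then show ?thesis using y 2 by (intro exI[of _ "y + 1"]) simp
  qed
qed

lemma moebius_ping_pong:
  assumes id: "\<And>p. nf_run (moebius psl_S) (moebius psl_U) e bs j p = p" and e: "e < 3"
  shows "e = 0" "bs = []" "\<not> j"
proof -
  let ?R = "alt_run (moebius psl_S) (moebius psl_U) bs"
  have U: "moebius psl_U (Some y) = Some (- 1 - 1 / y)"
    "moebius psl_U (moebius psl_U (Some y)) = Some (- 1 / (y + 1))" if "y > 0" for y
    using that by (auto simp: moebius_psl_U field_simps)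
  have e_cases: "e = 0 \<or> e = 1 \<or> e = 2" using e by linarith
  have "\<not> j \<and> e = 0 \<and> bs = []"
  proof (cases j)
    case True
    \<comment> \<open>S makes a negative x positive and the blocks keep it positive, so every x < 0
      must be U^e of some y > 0. But U^e maps the positive half line into positive numbers, numbers
      below -1, or (-1, 0), for e = 0, 1, 2; the test points -1, -1/2, -2 are missed.\<close>
    have *: "\<exists>y>0. (moebius psl_U ^^ e) (Some y) = Some x" if "x < 0" for x
    proof -
      have "moebius psl_S (Some x) = Some (- 1 / x)" "- 1 / x > 0"
        using that by (auto simp: moebius_psl_S divide_neg_neg)
      moreover obtain y where "y > 0" "?R (Some (- 1 / x)) = Some y"
        using alt_run_moebius_pos[OF calculation(2)] by blast
      ultimately show ?thesis using id[of "Some x"] True by (auto simp: nf_run_def)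
    qed
    from e_cases show ?thesis
    proof (elim disjE)
      assume "e = 0"
      then show ?thesis using *[of "-1"] by auto
    next
      assume "e = 1"
      moreover obtain y where "y > 0" "(moebius psl_U ^^ e) (Some y) = Some (- 1 / 2)"
        using *[of "- 1 / 2"] by auto
      moreover have "1 / y > 0" using \<open>y > 0\<close> by simp
      ultimately show ?thesis using U(1)[of y] by auto
    next
      assume "e = 2"
      moreover obtain y where "y > 0" "(moebius psl_U ^^ e) (Some y) = Some (- 2)"
        using *[of "- 2"] by auto
      ultimately show ?thesis using U(2)[of y] by (auto simp: numeral_2_eq_2 field_simps)
    qed
  next
    case False
    \<comment> \<open>Without a trailing S the point 1 is followed. U and U^2 make positive numbers
      negative, so its return to 1 forces e = 0, and then no block can have been applied.\<close>
    obtain y where y: "y > 0" "?R (Some 1) = Some y" "bs \<noteq> [] \<longrightarrow> y \<noteq> 1"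
      using alt_run_moebius_pos[of 1 bs] by auto
    then have *: "(moebius psl_U ^^ e) (Some y) = Some 1"
      using id[of "Some 1"] False by (auto simp: nf_run_def)
    have "- 1 - 1 / y \<noteq> 1" "- 1 / (y + 1) \<noteq> 1" using y(1) by (simp_all add: field_simps)
    then have "e = 0" using * e_cases U[OF y(1)] by (auto simp: numeral_2_eq_2)
    with * y(3) False show ?thesis by auto
  qed
  then show "e = 0" "bs = []" "\<not> j" by auto
qed

definition word_val :: "bool list \<Rightarrow> psl2z" where
  "word_val w = run ((*) psl_S) ((*) psl_U) w 1"

lemma word_val_simps [simp]:
  "word_val [] = 1" "word_val (b # w) = (if b then psl_U else psl_S) * word_val w"
  by (simp_all add: word_val_def)

lemma word_val_append: "word_val (u @ w) = word_val u * word_val w"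
  by (induction u) (simp_all add: mult.assoc)

lemma run_moebius: "run (moebius psl_S) (moebius psl_U) w p = moebius (word_val w) p"
  by (induction w) (simp_all add: moebius_one moebius_mult)

lemma word_exists: "\<exists>w. word_val w = \<gamma>"
proof (induction \<gamma> rule: psl_SU_induct)
  case one
  show ?case by (rule exI[of _ "[]"]) simp
next
  case (S \<gamma>)
  then obtain w where "word_val w = \<gamma>" by blast
  then show ?case by (intro exI[of _ "False # w"]) simp
next
  case (U \<gamma>)
  then obtain w where "word_val w = \<gamma>" by blast
  then show ?case by (intro exI[of _ "True # w"]) simp
qed

text \<open>The normal form of a word depends a priori on the maps. For the product of the Moebius
  action with (f, g) one normal form serves both factors; ping-pong in the first shows that it is
  empty, so the second is the identity too.\<close>

lemma run_relation:
  fixes f g :: "'x \<Rightarrow> 'x"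
  assumes f: "\<And>x. f (f x) = x" and g: "\<And>x. g (g (g x)) = x" and w: "word_val w = 1"
  shows "run f g w x = x"
proof -
  define F where "F = (\<lambda>(p, x :: 'x). (moebius psl_S p, f x))"
  define G where "G = (\<lambda>(p, x :: 'x). (moebius psl_U p, g x))"
  have "moebius psl_U (moebius psl_U (moebius psl_U p)) = p" for p
    by (simp add: mult.assoc moebius_one flip: moebius_mult)
  moreover have "moebius psl_S (moebius psl_S p) = p" for p
    by (simp add: moebius_one flip: moebius_mult)
  ultimately have F: "F (F z) = z" and G: "G (G (G z)) = z" for z
    using f g by (auto simp: F_def G_def split: prod.splits)
  have run: "run F G u (p, x) = (run (moebius psl_S) (moebius psl_U) u p, run f g u x)" for u p x
    by (induction u) (auto simp: F_def G_def)
  have alt: "alt_run F G u (p, x) = (alt_run (moebius psl_S) (moebius psl_U) u p, alt_run f g u x)" for u p x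
    by (induction u) (auto simp: F_def G_def)
  have pw: "(G ^^ n) (p, x) = ((moebius psl_U ^^ n) p, (g ^^ n) x)" for n p x
    by (induction n) (auto simp: G_def)
  have nf: "nf_run F G e bs j (p, x) = (nf_run (moebius psl_S) (moebius psl_U) e bs j p, nf_run f g e bs j x)"
    for e bs j p x
  proof -
    have "F (p, x) = (moebius psl_S p, f x)" by (simp add: F_def)
    then show ?thesis by (simp add: nf_run_def alt pw)
  qed
  obtain e bs j where e: "e < 3" "\<And>z. run F G w z = nf_run F G e bs j z"
    using run_normal_form[of F G w] F G by blast
  have "nf_run (moebius psl_S) (moebius psl_U) e bs j p = p" for p
    using e(2)[of "(p, x)"] w by (simp add: run nf run_moebius moebius_one)
  then have "e = 0" "bs = []" "\<not> j" using moebius_ping_pong[OF _ e(1)] by blast+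
  with e(2)[of "(None, x)"] show ?thesis by (simp add: run nf) (simp add: nf_run_def)
qed

lemma run_eqI:
  fixes f g :: "'x \<Rightarrow> 'x"
  assumes f: "\<And>x. f (f x) = x" and g: "\<And>x. g (g (g x)) = x" and w: "word_val w = word_val w'"
  shows "run f g w x = run f g w' x"
proof -
  obtain u where u: "word_val u = inverse (word_val w)" using word_exists by blast
  have "run f g w x = run f g (w' @ u) (run f g w x)"
    using f g by (intro run_relation[symmetric]) (simp_all add: word_val_append u psl2z_right_inverse flip: w)
  also have "\<dots> = run f g w' (run f g (u @ w) x)" by (simp add: run_append)
  also have "run f g (u @ w) x = x"
    using f g by (intro run_relation) (simp_all add: word_val_append u psl2z_left_inverse)
  finally show ?thesis .
qed

section \<open>Cocycles\<close>

lemma Z1_mult: "\<psi> \<in> Z1 ac V \<Longrightarrow> \<psi> (\<gamma> * \<delta>) = ac (\<psi> \<gamma>) \<delta> + \<psi> \<delta>"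
  by (simp add: Z1_def)

lemma Z1_one: "\<psi> \<in> Z1 (act s) V \<Longrightarrow> \<psi> 1 = 0"
  using Z1_mult[of \<psi> "act s" V 1 1] by (simp add: act_one)

lemma Z1_eqI:
  assumes "\<psi> \<in> Z1 (act s) V" "\<psi>' \<in> Z1 (act s) V'" "\<psi> psl_S = \<psi>' psl_S" "\<psi> psl_U = \<psi>' psl_U"
  shows "\<psi> = \<psi>'"
proof
  fix \<gamma> show "\<psi> \<gamma> = \<psi>' \<gamma>"
    by (induction \<gamma> rule: psl_SU_induct)
       (use assms in \<open>simp_all add: Z1_one[OF assms(1)] Z1_one[OF assms(2)] Z1_mult[OF assms(1)] Z1_mult[OF assms(2)]\<close>)
qed

lemma Z1_subspace:
  assumes \<psi>: "\<psi> \<in> Z1 (act s) V" and SU: "\<psi> psl_S \<in> W" "\<psi> psl_U \<in> W"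
    and W: "0 \<in> W" "\<And>u v. u \<in> W \<Longrightarrow> v \<in> W \<Longrightarrow> u + v \<in> W" "\<And>u \<gamma>. u \<in> W \<Longrightarrow> act s u \<gamma> \<in> W"
  shows "\<psi> \<in> Z1 (act s) W"
proof -
  have "\<psi> \<gamma> \<in> W" for \<gamma>
    by (induction \<gamma> rule: psl_SU_induct)
       (use SU W in \<open>simp_all add: Z1_one[OF \<psi>] Z1_mult[OF \<psi>]\<close>)
  then show ?thesis using \<psi> by (auto simp: Z1_def)
qed

text \<open>The letters are lifted to a skew product of pairs (group element, accumulated value).
  The hypotheses say that the lifts satisfy f^2 = id and g^3 = id, so by freeness the result of
  running a word from (1, 0) depends only on its value in the group; the second component is the
  cocycle.\<close>

lemma cocycle_exists:
  assumes S: "b1 + act s b1 psl_S = 0"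
    and U: "b2 + act s b2 psl_U + act s b2 (psl_U * psl_U) = 0"
  shows "\<exists>\<psi>. \<psi> \<in> Z1 (act s) UNIV \<and> \<psi> psl_S = b1 \<and> \<psi> psl_U = b2"
proof -
  define f where "f = (\<lambda>(\<gamma>, v). (psl_S * \<gamma>, act s b1 \<gamma> + v))"
  define g where "g = (\<lambda>(\<gamma>, v). (psl_U * \<gamma>, act s b2 \<gamma> + v))"
  have f: "f (f z) = z" for z
  proof -
    have "act s (b1 + act s b1 psl_S) (fst z) = 0" by (simp add: S act_zero)
    then show ?thesis
      by (auto simp: f_def act_add act_mult split: prod.splits)
         (simp add: add.assoc[symmetric] add.commute)
  qed
  have g: "g (g (g z)) = z" for z
  proof -
    obtain \<gamma> v where z: "z = (\<gamma>, v)" by (cases z)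
    have "act s (b2 + act s b2 psl_U + act s b2 (psl_U * psl_U)) \<gamma> = 0" by (simp add: U act_zero)
    then have "act s b2 \<gamma> + act s b2 (psl_U * \<gamma>) + act s b2 (psl_U * (psl_U * \<gamma>)) = 0"
      by (simp only: act_add act_mult[symmetric] mult.assoc)
    moreover have "g (g (g z)) =
        (\<gamma>, (act s b2 \<gamma> + act s b2 (psl_U * \<gamma>) + act s b2 (psl_U * (psl_U * \<gamma>))) + v)"
      by (simp add: z g_def ac_simps)
    ultimately show ?thesis by (simp add: z)
  qed
  define word where "word = (\<lambda>\<gamma>. SOME w. word_val w = \<gamma>)"
  have word: "word_val (word \<gamma>) = \<gamma>" for \<gamma>
    unfolding word_def using word_exists by (rule someI_ex)
  define \<psi> where "\<psi> = (\<lambda>\<gamma>. snd (run f g (word \<gamma>) (1, 0)))"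
  have \<psi>: "\<psi> (word_val w) = snd (run f g w (1, 0))" for w
    unfolding \<psi>_def using f g by (intro arg_cong[of _ _ snd] run_eqI) (simp_all add: word)
  have fst: "fst (run f g w (1, 0)) = word_val w" for w
    by (induction w) (auto simp: f_def g_def split: prod.splits)
  have "\<psi> (word_val (False # w)) = act s b1 (word_val w) + \<psi> (word_val w)"
    "\<psi> (word_val (True # w)) = act s b2 (word_val w) + \<psi> (word_val w)" for w
    using fst[of w] by (simp_all only: \<psi>) (auto simp: f_def g_def split: prod.splits)
  from this[of "word _"] have step: "\<psi> (psl_S * \<gamma>) = act s b1 \<gamma> + \<psi> \<gamma>" "\<psi> (psl_U * \<gamma>) = act s b2 \<gamma> + \<psi> \<gamma>" for \<gamma>
    by (simp_all add: word)
  have one: "\<psi> 1 = 0" using \<psi>[of "[]"] by simp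
  have "\<psi> (\<gamma> * \<delta>) = act s (\<psi> \<gamma>) \<delta> + \<psi> \<delta>" for \<gamma> \<delta>
    by (induction \<gamma> rule: psl_SU_induct)
       (simp_all add: one act_zero mult.assoc step act_add add.assoc act_mult)
  then have "\<psi> \<in> Z1 (act s) UNIV" by (simp add: Z1_def)
  moreover have "\<psi> psl_S = b1" "\<psi> psl_U = b2"
    using step[of 1] one by (simp_all add: act_one)
  ultimately show ?thesis by blast
qed

section \<open>Germs on intervals\<close>

definition eqon :: "real set \<Rightarrow> fgerm \<Rightarrow> fgerm \<Rightarrow> bool" where
  "eqon J u v \<longleftrightarrow> finite {x \<in> J. rep_fgerm u x \<noteq> rep_fgerm v x}"

text \<open>Restriction extended by zero. It is additive, so via \<open>eqon_iff_res\<close>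
  equalities on an interval become equations in an abelian group.\<close>

definition res :: "real set \<Rightarrow> fgerm \<Rightarrow> fgerm" where
  "res J v = to_fgerm (\<lambda>x. if x \<in> J then rep_fgerm v x else 0)"

lemma eqon_iff_res: "eqon J u v \<longleftrightarrow> res J u = res J v"
proof -
  have "{x. (if x \<in> J then rep_fgerm u x else 0) \<noteq> (if x \<in> J then rep_fgerm v x else 0)} =
      {x \<in> J. rep_fgerm u x \<noteq> rep_fgerm v x}" by auto
  then show ?thesis by (simp add: eqon_def res_def to_fgerm_eq_iff)
qed

lemma res_to_fgerm: "res J (to_fgerm f) = to_fgerm (\<lambda>x. if x \<in> J then f x else 0)"
  unfolding res_def to_fgerm_eq_iff
  by (rule finite_subset[OF _ finite_rep_to_fgerm[of f]]) auto

lemma res_add: "res J (u + v) = res J u + res J v"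
proof -
  have "u + v = to_fgerm (\<lambda>x. rep_fgerm u x + rep_fgerm v x)" by (simp flip: plus_to_fgerm)
  then have "res J (u + v) = to_fgerm (\<lambda>x. if x \<in> J then rep_fgerm u x + rep_fgerm v x else 0)"
    by (simp add: res_to_fgerm)
  also have "\<dots> = res J u + res J v"
    unfolding res_def plus_to_fgerm by (rule arg_cong[of _ _ to_fgerm]) auto
  finally show ?thesis .
qed

lemma res_zero: "res J 0 = 0"
  using res_add[of J 0 0] by simp

lemma res_uminus: "res J (- v) = - res J v"
  using res_add[of J v "- v"] by (simp add: res_zero minus_unique)

lemma res_diff: "res J (u - v) = res J u - res J v"
  using res_add[of J u "- v"] by (simp add: res_uminus)

lemmas res_simps = res_add res_uminus res_diff res_zero

lemma eqon_to_fgerm: "eqon J (to_fgerm f) (to_fgerm g) \<longleftrightarrow> finite {x \<in> J. f x \<noteq> g x}"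
proof -
  have "{x. (if x \<in> J then f x else 0) \<noteq> (if x \<in> J then g x else 0)} = {x \<in> J. f x \<noteq> g x}" by auto
  then show ?thesis by (simp add: eqon_iff_res res_to_fgerm to_fgerm_eq_iff)
qed

lemma eqon_subset: "eqon J u v \<Longrightarrow> J' \<subseteq> J \<Longrightarrow> eqon J' u v"
  unfolding eqon_def by (erule rev_finite_subset) auto

lemma eqon_Un: "eqon J u v \<Longrightarrow> eqon J' u v \<Longrightarrow> eqon (J \<union> J') u v"
  unfolding eqon_def by (rule rev_finite_subset, erule (1) finite_UnI) auto

lemma eqon_insert: "eqon J u v \<Longrightarrow> eqon (insert x J) u v"
  unfolding eqon_def by (rule finite_subset[of _ "insert x {x \<in> J. rep_fgerm u x \<noteq> rep_fgerm v x}"]) auto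

lemma eqon_UNIV: "eqon UNIV u v \<longleftrightarrow> u = v"
proof -
  have "eqon UNIV u v \<longleftrightarrow> to_fgerm (rep_fgerm u) = to_fgerm (rep_fgerm v)"
    unfolding to_fgerm_eq_iff by (simp add: eqon_def)
  then show ?thesis by simp
qed

lemma eqon_act:
  assumes e: "eqon J u v" and J': "\<And>x y. x \<in> J' \<Longrightarrow> moebius \<gamma> (Some x) = Some y \<Longrightarrow> y \<in> J"
  shows "eqon J' (act s u \<gamma>) (act s v \<gamma>)"
proof -
  define A where "A = real_mat (rep_psl2z \<gamma>)"
  have det: "det A = 1" by (simp add: A_def det_real_mat det_rep_psl2z)
  let ?B = "{x \<in> J. rep_fgerm u x \<noteq> rep_fgerm v x}"
  have 1: "finite {x. A$2$1 * x + A$2$2 = 0}"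
    using det by (intro finite_linear_zero) (auto simp: det_2)
  have 2: "finite {x. (A$1$1 * x + A$1$2) / (A$2$1 * x + A$2$2) \<in> ?B}"
    using e det by (intro finite_moebius_vimage) (simp_all add: eqon_def det_2)
  have "{x \<in> J'. mat_slash s (rep_fgerm u) A x \<noteq> mat_slash s (rep_fgerm v) A x}
      \<subseteq> {x. A$2$1 * x + A$2$2 = 0} \<union> {x. (A$1$1 * x + A$1$2) / (A$2$1 * x + A$2$2) \<in> ?B}"
  proof
    fix x assume x: "x \<in> {x \<in> J'. mat_slash s (rep_fgerm u) A x \<noteq> mat_slash s (rep_fgerm v) A x}"
    show "x \<in> {x. A$2$1 * x + A$2$2 = 0} \<union> {x. (A$1$1 * x + A$1$2) / (A$2$1 * x + A$2$2) \<in> ?B}"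
    proof (cases "A$2$1 * x + A$2$2 = 0")
      case False
      then have "moebius \<gamma> (Some x) = Some ((A$1$1 * x + A$1$2) / (A$2$1 * x + A$2$2))"
        by (simp add: moebius_eq_mat_moebius A_def mat_moebius_def)
      with x J' have "(A$1$1 * x + A$1$2) / (A$2$1 * x + A$2$2) \<in> J" by blast
      with x show ?thesis by (auto simp: mat_slash_def)
    qed simp
  qed
  then have "finite {x \<in> J'. mat_slash s (rep_fgerm u) A x \<noteq> mat_slash s (rep_fgerm v) A x}"
    using 1 2 by (meson finite_UnI finite_subset)
  then show ?thesis by (simp add: act_eq_gact gact_def eqon_to_fgerm flip: A_def)
qed

lemma eqon_regular_at:
  assumes "eqon J u v" "open J" "x \<in> J"
  shows "regular_at s u (Some x) \<longleftrightarrow> regular_at s v (Some x)"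
proof -
  have "\<forall>\<^sub>F y in at x. rep_fgerm u y = rep_fgerm v y"
    using assms unfolding eqon_def by (intro eventually_at_eq_of_finite[of J])
  then show ?thesis unfolding regular_at_Some by (rule analytic_germ_cong)
qed

section \<open>The golden ratio and the relevant Moebius transformations\<close>

lemma phi_sq: "phi * phi = phi + 1"
  by (simp add: phi_def field_simps)

lemma phi_bounds: "phi > 8 / 5" "phi < 5 / 3"
proof -
  have "sqrt 5 > 11 / 5" by (rule real_less_rsqrt) (simp add: power2_eq_square)
  then show "phi > 8 / 5" by (simp add: phi_def)
  have "sqrt 5 < 7 / 3" by (rule real_less_lsqrt) (simp_all add: power2_eq_square)
  then show "phi < 5 / 3" by (simp add: phi_def)
qed

lemma inverse_phi: "inverse phi = phi - 1"
  by (rule inverse_unique) (simp add: algebra_simps phi_sq)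

lemma phi_power2: "phi ^ 2 = phi + 1"
  by (simp add: power2_eq_square phi_sq)

lemma neg_inverse_cmp:
  fixes y e e' :: real
  assumes "e * e' = 1" "e > 0"
  shows "y > 0 \<Longrightarrow> - 1 / y < - e \<longleftrightarrow> y < e'" "y > 0 \<Longrightarrow> - e < - 1 / y \<longleftrightarrow> e' < y"
    "y < 0 \<Longrightarrow> - 1 / y < e \<longleftrightarrow> y < - e'" "y < 0 \<Longrightarrow> e < - 1 / y \<longleftrightarrow> - e' < y"
proof -
  have e': "e' = 1 / e" using assms by (simp add: field_simps)
  show "y > 0 \<Longrightarrow> - 1 / y < - e \<longleftrightarrow> y < e'" "y > 0 \<Longrightarrow> - e < - 1 / y \<longleftrightarrow> e' < y"
    "y < 0 \<Longrightarrow> - 1 / y < e \<longleftrightarrow> y < - e'" "y < 0 \<Longrightarrow> e < - 1 / y \<longleftrightarrow> - e' < y"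
    using assms(2) by (auto simp: e' field_simps)
qed

text \<open>The reciprocal pairs are \<open>phi\<close>, \<open>phi - 1\<close> and
  \<open>phi + 1\<close>, \<open>2 - phi\<close>, that is \<phi>^2 and \<phi>^(-2). Each comparison
  of -1/y with a relevant end point becomes one of y, which leaves only linear arithmetic in
  \<open>interval_maps\<close>.\<close>

lemma neg_inverse_phi:
  assumes "z = - 1 / y"
  shows "y > 0 \<Longrightarrow> z < 0 \<and>
    (z < - phi \<longleftrightarrow> y < phi - 1) \<and> (- phi < z \<longleftrightarrow> phi - 1 < y) \<and>
    (z < - (phi - 1) \<longleftrightarrow> y < phi) \<and> (- (phi - 1) < z \<longleftrightarrow> phi < y) \<and>
    (z < - (phi + 1) \<longleftrightarrow> y < 2 - phi) \<and> (- (phi + 1) < z \<longleftrightarrow> 2 - phi < y) \<and>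
    (z < - (2 - phi) \<longleftrightarrow> y < phi + 1) \<and> (- (2 - phi) < z \<longleftrightarrow> phi + 1 < y)"
    and "y < 0 \<Longrightarrow> 0 < z \<and>
    (z < phi \<longleftrightarrow> y < - (phi - 1)) \<and> (phi < z \<longleftrightarrow> - (phi - 1) < y) \<and>
    (z < phi - 1 \<longleftrightarrow> y < - phi) \<and> (phi - 1 < z \<longleftrightarrow> - phi < y) \<and>
    (z < phi + 1 \<longleftrightarrow> y < - (2 - phi)) \<and> (phi + 1 < z \<longleftrightarrow> - (2 - phi) < y) \<and>
    (z < 2 - phi \<longleftrightarrow> y < - (phi + 1)) \<and> (2 - phi < z \<longleftrightarrow> - (phi + 1) < y)"
  unfolding assms using phi_bounds
    neg_inverse_cmp[of phi "phi - 1" y] neg_inverse_cmp[of "phi - 1" phi y]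
    neg_inverse_cmp[of "phi + 1" "2 - phi" y] neg_inverse_cmp[of "2 - phi" "phi + 1" y]
  by (simp_all add: algebra_simps phi_sq divide_neg_neg)

(* S T^2 and T^(-1) S T^(-2), written in the generators S and U. *)
abbreviation psl_ST2 :: psl2z where
  "psl_ST2 \<equiv> psl_U * (psl_U * (psl_S * (psl_U * psl_U)))"

abbreviation psl_TiSTi2 :: psl2z where
  "psl_TiSTi2 \<equiv> psl_U * (psl_U * (psl_S * (psl_U * psl_S)))"

lemma moebius_words:
  "moebius psl_S (Some x) = Some y \<Longrightarrow> x \<noteq> 0 \<and> y = - 1 / x"
  "moebius psl_U (Some x) = Some y \<Longrightarrow> x \<noteq> 0 \<and> y = - 1 / x - 1"
  "moebius (psl_U * psl_U) (Some x) = Some y \<Longrightarrow> x + 1 \<noteq> 0 \<and> y = - 1 / (x + 1)"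
  "moebius (psl_S * psl_U) (Some x) = Some y \<Longrightarrow> x + 1 \<noteq> 0 \<and> y = - 1 / (x + 1) + 1"
  "moebius (psl_U * psl_S) (Some x) = Some y \<Longrightarrow> y = x - 1"
  "moebius (psl_U * (psl_U * psl_S)) (Some x) = Some y \<Longrightarrow> x - 1 \<noteq> 0 \<and> y = - 1 / (x - 1) - 1"
  "moebius psl_ST2 (Some x) = Some y \<Longrightarrow> x + 2 \<noteq> 0 \<and> y = - 1 / (x + 2)"
  "moebius psl_TiSTi2 (Some x) = Some y \<Longrightarrow> x - 2 \<noteq> 0 \<and> y = - 1 / (x - 2) - 1"
  by (auto simp: psl_S_abs psl_U_abs abs_psl2z_mat2_mult moebius_abs_psl2z det_mat2 mat_moebius_def
      divide_simps split: if_splits) (auto simp: algebra_simps)?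

text \<open>The generators permute the end points that occur. In particular S exchanges the two
  sides of -\<phi>, 1/\<phi>, and U rotates the three intervals cut out by -\<phi>, -1/\<phi>^2,
  \<phi>.\<close>

lemma interval_maps:
  "moebius psl_S (Some x) = Some y \<Longrightarrow> - phi < x \<Longrightarrow> x < phi - 1 \<Longrightarrow> y < - phi \<or> phi - 1 < y"
  "moebius psl_S (Some x) = Some y \<Longrightarrow> x < - phi \<or> phi - 1 < x \<Longrightarrow> - phi < y \<and> y < phi - 1"
  "moebius psl_S (Some x) = Some y \<Longrightarrow> - (phi - 1) < x \<Longrightarrow> x < phi - 1 \<Longrightarrow> y < - phi \<or> phi < y"
  "moebius psl_S (Some x) = Some y \<Longrightarrow> phi - 1 < x \<Longrightarrow> x < phi \<Longrightarrow> - phi < y \<and> y < - (phi - 1)"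
  "moebius psl_S (Some x) = Some y \<Longrightarrow> - phi < x \<Longrightarrow> x < - (phi - 1) \<Longrightarrow> phi - 1 < y \<and> y < phi"
  "moebius psl_S (Some x) = Some y \<Longrightarrow> x < - phi \<or> phi < x \<Longrightarrow> - (phi - 1) < y \<and> y < phi - 1"
  "moebius psl_U (Some x) = Some y \<Longrightarrow> - (phi - 1) < x \<Longrightarrow> x < phi - 1 \<Longrightarrow> y < - phi \<or> phi - 1 < y"
  "moebius psl_U (Some x) = Some y \<Longrightarrow> phi - 1 < x \<Longrightarrow> x < phi \<Longrightarrow> y < - phi"
  "moebius psl_U (Some x) = Some y \<Longrightarrow> - phi < x \<Longrightarrow> x < - (phi - 1) \<Longrightarrow> - (2 - phi) < y \<and> y < phi - 1"
  "moebius psl_U (Some x) = Some y \<Longrightarrow> x < - phi \<or> phi < x \<Longrightarrow> - phi < y \<and> y < - (2 - phi)"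
  "moebius psl_U (Some x) = Some y \<Longrightarrow> - phi < x \<Longrightarrow> x < - (2 - phi) \<Longrightarrow> - (2 - phi) < y \<and> y < phi"
  "moebius psl_U (Some x) = Some y \<Longrightarrow> - (2 - phi) < x \<Longrightarrow> x < phi \<Longrightarrow> y < - phi \<or> phi < y"
  "moebius (psl_U * psl_U) (Some x) = Some y \<Longrightarrow> - phi < x \<Longrightarrow> x < - (2 - phi) \<Longrightarrow> y < - phi \<or> phi < y"
  "moebius (psl_U * psl_U) (Some x) = Some y \<Longrightarrow> - (2 - phi) < x \<Longrightarrow> x < phi \<Longrightarrow> - phi < y \<and> y < - (2 - phi)"
  "moebius (psl_U * psl_U) (Some x) = Some y \<Longrightarrow> x < - phi \<or> phi < x \<Longrightarrow> - (2 - phi) < y \<and> y < phi"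
  "moebius (psl_S * psl_U) (Some x) = Some y \<Longrightarrow> - (phi - 1) < x \<Longrightarrow> x < phi \<Longrightarrow> - phi < y \<and> y < phi - 1"
  "moebius (psl_S * psl_U) (Some x) = Some y \<Longrightarrow> - (phi + 1) < x \<Longrightarrow> x < - (phi - 1) \<Longrightarrow> y < - phi \<or> phi < y"
  "moebius (psl_U * psl_S) (Some x) = Some y \<Longrightarrow> - phi < x \<Longrightarrow> x < phi \<Longrightarrow> - (phi + 1) < y \<and> y < phi"
  "moebius (psl_U * (psl_U * psl_S)) (Some x) = Some y \<Longrightarrow> - phi < x \<Longrightarrow> x < phi - 1 \<Longrightarrow> - (phi - 1) < y \<and> y < phi"
  "moebius psl_ST2 (Some x) = Some y \<Longrightarrow> - phi < x \<Longrightarrow> x < phi \<Longrightarrow> - (phi + 1) < y \<and> y < phi"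
  "moebius psl_TiSTi2 (Some x) = Some y \<Longrightarrow> - phi < x \<Longrightarrow> x < phi \<Longrightarrow> - (phi + 1) < y \<and> y < phi"
proof goal_cases
  case 1
  from moebius_words(1)[OF 1(1)] 1(2-) phi_bounds neg_inverse_phi[OF refl, of "x"]
  show ?case by (smt (verit) | argo | smt (z3))
next
  case 2
  from moebius_words(1)[OF 2(1)] 2(2-) phi_bounds neg_inverse_phi[OF refl, of "x"]
  show ?case by (smt (verit) | argo | smt (z3))
next
  case 3
  from moebius_words(1)[OF 3(1)] 3(2-) phi_bounds neg_inverse_phi[OF refl, of "x"]
  show ?case by (smt (verit) | argo | smt (z3))
next
  case 4
  from moebius_words(1)[OF 4(1)] 4(2-) phi_bounds neg_inverse_phi[OF refl, of "x"]
  show ?case by (smt (verit) | argo | smt (z3))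
next
  case 5
  from moebius_words(1)[OF 5(1)] 5(2-) phi_bounds neg_inverse_phi[OF refl, of "x"]
  show ?case by (smt (verit) | argo | smt (z3))
next
  case 6
  from moebius_words(1)[OF 6(1)] 6(2-) phi_bounds neg_inverse_phi[OF refl, of "x"]
  show ?case by (smt (verit) | argo | smt (z3))
next
  case 7
  from moebius_words(2)[OF 7(1)] 7(2-) phi_bounds neg_inverse_phi[OF refl, of "x"]
  show ?case by (smt (verit) | argo | smt (z3))
next
  case 8
  from moebius_words(2)[OF 8(1)] 8(2-) phi_bounds neg_inverse_phi[OF refl, of "x"]
  show ?case by (smt (verit) | argo | smt (z3))
next
  case 9
  from moebius_words(2)[OF 9(1)] 9(2-) phi_bounds neg_inverse_phi[OF refl, of "x"]
  show ?case by (smt (verit) | argo | smt (z3))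
next
  case 10
  from moebius_words(2)[OF 10(1)] 10(2-) phi_bounds neg_inverse_phi[OF refl, of "x"]
  show ?case by (smt (verit) | argo | smt (z3))
next
  case 11
  from moebius_words(2)[OF 11(1)] 11(2-) phi_bounds neg_inverse_phi[OF refl, of "x"]
  show ?case by (smt (verit) | argo | smt (z3))
next
  case 12
  from moebius_words(2)[OF 12(1)] 12(2-) phi_bounds neg_inverse_phi[OF refl, of "x"]
  show ?case by (smt (verit) | argo | smt (z3))
next
  case 13
  from moebius_words(3)[OF 13(1)] 13(2-) phi_bounds neg_inverse_phi[OF refl, of "x + 1"]
  show ?case by (smt (verit) | argo | smt (z3))
next
  case 14
  from moebius_words(3)[OF 14(1)] 14(2-) phi_bounds neg_inverse_phi[OF refl, of "x + 1"]
  show ?case by (smt (verit) | argo | smt (z3))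
next
  case 15
  from moebius_words(3)[OF 15(1)] 15(2-) phi_bounds neg_inverse_phi[OF refl, of "x + 1"]
  show ?case by (smt (verit) | argo | smt (z3))
next
  case 16
  from moebius_words(4)[OF 16(1)] 16(2-) phi_bounds neg_inverse_phi[OF refl, of "x + 1"]
  show ?case by (smt (verit) | argo | smt (z3))
next
  case 17
  from moebius_words(4)[OF 17(1)] 17(2-) phi_bounds neg_inverse_phi[OF refl, of "x + 1"]
  show ?case by (smt (verit) | argo | smt (z3))
next
  case 18
  with moebius_words(5)[OF 18(1)] show ?case using phi_bounds by linarith
next
  case 19
  from moebius_words(6)[OF 19(1)] 19(2-) phi_bounds neg_inverse_phi[OF refl, of "x - 1"]
  show ?case by (smt (verit) | argo | smt (z3))
next
  case 20
  from moebius_words(7)[OF 20(1)] 20(2-) phi_bounds neg_inverse_phi[OF refl, of "x + 2"]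
  show ?case by (smt (verit) | argo | smt (z3))
next
  case 21
  from moebius_words(8)[OF 21(1)] 21(2-) phi_bounds neg_inverse_phi[OF refl, of "x - 2"]
  show ?case by (smt (verit) | argo | smt (z3))
qed

section \<open>The cocycle relations for the pieces of \<open>\<theta>\<close>\<close>

lemma eqon_cover: "eqon J u v \<Longrightarrow> finite (- J) \<Longrightarrow> u = v"
  unfolding eqon_UNIV[symmetric] eqon_def
  by (rule finite_subset[of _ "{x \<in> J. rep_fgerm u x \<noteq> rep_fgerm v x} \<union> - J"]) auto

lemma eqon_sym: "eqon J u v \<Longrightarrow> eqon J v u"
  by (simp add: eqon_iff_res)

lemma eqon_trans: "eqon J u v \<Longrightarrow> eqon J v w \<Longrightarrow> eqon J u w"
  by (simp add: eqon_iff_res)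

lemma eqon_add: "eqon J u v \<Longrightarrow> eqon J u' v' \<Longrightarrow> eqon J (u + u') (v + v')"
  by (simp add: eqon_iff_res res_simps)

lemma eqon_uminus: "eqon J u v \<Longrightarrow> eqon J (- u) (- v)"
  by (simp add: eqon_iff_res res_simps)

lemmas interval_mem = greaterThanLessThan_iff Un_iff lessThan_iff greaterThan_iff

text \<open>The construction of \<theta> on the level of germs: G, H, K are the germs of g, h, k,
  rewritten with T^(-1) = US, STS = U^2 S, ST = U^2 and 1/\<phi> = \<open>phi - 1\<close>.\<close>

locale theta_data =
  fixes s :: complex and G H K c1 c2 :: fgerm
  assumes H: "H = G + act s G psl_ST2"
    and K: "K = act s G (psl_U * psl_S) + act s H (psl_U * (psl_U * psl_S))"
    and c1_in: "eqon {- phi<..<phi - 1} c1 K"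
    and c1_out: "eqon ({..<- phi} \<union> {phi - 1<..}) c1 (- act s K psl_S)"
    and c2_in: "eqon {- phi<..<phi} c2 H"
    and c2_out: "eqon ({..<- phi} \<union> {phi<..}) c2 (- (act s H psl_U + act s H (psl_U * psl_U)))"
begin

lemmas expand = H K act_add act_diff act_uminus act_one mult.assoc res_simps act_mult[symmetric]

text \<open>S exchanges the two intervals, so on each of them c1 and c1|S are given by opposite
  branches, and K cancels.\<close>

lemma c1_S: "c1 + act s c1 psl_S = 0"
proof -
  let ?I = "{- phi<..<phi - 1}" and ?O = "{..<- phi} \<union> {phi - 1<..}"
  have "eqon ?I (act s c1 psl_S) (act s (- act s K psl_S) psl_S)"
    by (rule eqon_act[OF c1_out]) (unfold interval_mem, blast dest: interval_maps)
  then have 1: "eqon ?I (c1 + act s c1 psl_S) 0"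
    using c1_in by (simp add: eqon_iff_res expand del: H K)
  have "eqon ?O (act s c1 psl_S) (act s K psl_S)"
    by (rule eqon_act[OF c1_in]) (unfold interval_mem, blast dest: interval_maps)
  then have 2: "eqon ?O (c1 + act s c1 psl_S) 0"
    using c1_out by (simp add: eqon_iff_res expand del: H K)
  show ?thesis
    by (rule eqon_cover[OF eqon_Un[OF 1 2]], rule finite_subset[of _ "{- phi, phi - 1}"]) auto
qed

text \<open>The cut points form one U-orbit and U carries \<open>?A\<close> to \<open>?B\<close> to
  \<open>?C\<close> to \<open>?A\<close>. On each interval exactly one of the three terms therefore
  falls into the outer branch, which is minus the sum of the other two.\<close>

lemma c2_U: "c2 + act s c2 psl_U + act s c2 (psl_U * psl_U) = 0"
proof -
  let ?A = "{- phi<..<- (2 - phi)}" and ?B = "{- (2 - phi)<..<phi}" and ?C = "{..<- phi} \<union> {phi<..}"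
  have in': "eqon ?A c2 H" "eqon ?B c2 H"
    using phi_bounds by (auto intro!: eqon_subset[OF c2_in])
  have "eqon ?A (act s c2 psl_U) (act s H psl_U)"
    by (rule eqon_act[OF in'(2)]) (unfold interval_mem, blast dest: interval_maps)
  moreover have "eqon ?A (act s c2 (psl_U * psl_U)) (act s (- (act s H psl_U + act s H (psl_U * psl_U))) (psl_U * psl_U))"
    by (rule eqon_act[OF c2_out]) (unfold interval_mem, blast dest: interval_maps)
  ultimately have 1: "eqon ?A (c2 + act s c2 psl_U + act s c2 (psl_U * psl_U)) 0"
    using in'(1) by (simp add: eqon_iff_res expand del: H K)
  have "eqon ?B (act s c2 psl_U) (act s (- (act s H psl_U + act s H (psl_U * psl_U))) psl_U)"
    by (rule eqon_act[OF c2_out]) (unfold interval_mem, blast dest: interval_maps)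
  moreover have "eqon ?B (act s c2 (psl_U * psl_U)) (act s H (psl_U * psl_U))"
    by (rule eqon_act[OF in'(1)]) (unfold interval_mem, blast dest: interval_maps)
  ultimately have 2: "eqon ?B (c2 + act s c2 psl_U + act s c2 (psl_U * psl_U)) 0"
    using in'(2) by (simp add: eqon_iff_res expand del: H K)
  have "eqon ?C (act s c2 psl_U) (act s H psl_U)"
    by (rule eqon_act[OF in'(1)]) (unfold interval_mem, blast dest: interval_maps)
  moreover have "eqon ?C (act s c2 (psl_U * psl_U)) (act s H (psl_U * psl_U))"
    by (rule eqon_act[OF in'(2)]) (unfold interval_mem, blast dest: interval_maps)
  ultimately have 3: "eqon ?C (c2 + act s c2 psl_U + act s c2 (psl_U * psl_U)) 0"
    using c2_out by (simp add: eqon_iff_res expand del: H K)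
  show ?thesis
    by (rule eqon_cover[OF eqon_Un[OF eqon_Un[OF 1 2] 3]],
        rule finite_subset[of _ "{- phi, - (2 - phi), phi}"]) auto
qed

end

locale theta_data_FE = theta_data +
  assumes FE: "eqon {- phi<..<phi} (G + act s G psl_ST2)
    (act s G (psl_U * psl_S) + act s G psl_TiSTi2)"
begin

lemma FE': "eqon {- phi<..<phi} G (act s G (psl_U * psl_S)
    + act s G psl_TiSTi2 - act s G psl_ST2)"
  using FE by (simp add: eqon_iff_res expand del: H K) (simp add: algebra_simps)

text \<open>The four terms are cut only at -\<phi>, -1/\<phi>, 1/\<phi>, \<phi>. On the middle
  interval the branches cancel identically; on the other three they cancel modulo the four-term
  equation and its translates by S and U.\<close>

lemma c1_U_c2_S: "c1 - act s c1 psl_U = c2 - act s c2 psl_S"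
proof -
  let ?FE = "act s G (psl_U * psl_S) + act s G psl_TiSTi2
    - act s G psl_ST2"
  let ?A = "{- (phi - 1)<..<phi - 1}" and ?B = "{phi - 1<..<phi}"
    and ?C = "{..<- phi} \<union> {phi<..}" and ?D = "{- phi<..<- (phi - 1)}"
  have A: "eqon ?A (c1 - act s c1 psl_U) (c2 - act s c2 psl_S)"
  proof -
    have "eqon ?A c1 K" "eqon ?A c2 H"
      using phi_bounds by (auto intro!: eqon_subset[OF c1_in] eqon_subset[OF c2_in])
    moreover have "eqon ?A (act s c1 psl_U) (act s (- act s K psl_S) psl_U)"
      by (rule eqon_act[OF c1_out]) (unfold interval_mem, blast dest: interval_maps)
    moreover have "eqon ?A (act s c2 psl_S) (act s (- (act s H psl_U + act s H (psl_U * psl_U))) psl_S)"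
      by (rule eqon_act[OF c2_out]) (unfold interval_mem, blast dest: interval_maps)
    ultimately show ?thesis by (simp add: eqon_iff_res expand)
  qed
  have B: "eqon ?B (c1 - act s c1 psl_U) (c2 - act s c2 psl_S)"
  proof -
    have "eqon ?B c1 (- act s K psl_S)" "eqon ?B c2 H"
      using phi_bounds by (auto intro!: eqon_subset[OF c1_out] eqon_subset[OF c2_in])
    moreover have "eqon ?B (act s c1 psl_U) (act s (- act s K psl_S) psl_U)"
      by (rule eqon_act[OF c1_out]) (unfold interval_mem, blast dest: interval_maps)
    moreover have "eqon ?B (act s c2 psl_S) (act s H psl_S)"
      by (rule eqon_act[OF c2_in]) (use interval_maps(4) phi_bounds in \<open>fastforce simp: interval_mem\<close>)
    moreover have "eqon ?B (act s G psl_S) (act s ?FE psl_S)"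
      by (rule eqon_act[OF FE']) (use interval_maps(4) phi_bounds in \<open>fastforce simp: interval_mem\<close>)
    ultimately show ?thesis by (simp add: eqon_iff_res expand)
  qed
  have D: "eqon ?D (c1 - act s c1 psl_U) (c2 - act s c2 psl_S)"
  proof -
    have "eqon ?D c1 K" "eqon ?D c2 H"
      using phi_bounds by (auto intro!: eqon_subset[OF c1_in] eqon_subset[OF c2_in])
    moreover have "eqon ?D (act s c1 psl_U) (act s K psl_U)"
      by (rule eqon_act[OF c1_in], unfold interval_mem, elim conjE, drule (2) interval_maps)
         (use phi_bounds in linarith)
    moreover have "eqon ?D (act s c2 psl_S) (act s H psl_S)"
      by (rule eqon_act[OF c2_in]) (unfold interval_mem, smt (verit) interval_maps phi_bounds)
    moreover have "eqon ?D (act s G psl_S) (act s ?FE psl_S)"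
      by (rule eqon_act[OF FE']) (use interval_maps(5) phi_bounds in \<open>fastforce simp: interval_mem\<close>)
    moreover have "eqon ?D (act s G psl_U) (act s ?FE psl_U)"
      by (rule eqon_act[OF FE']) (use interval_maps(9) phi_bounds in \<open>fastforce simp: interval_mem\<close>)
    moreover have "eqon ?D G ?FE" using phi_bounds by (auto intro!: eqon_subset[OF FE'])
    ultimately show ?thesis by (simp add: eqon_iff_res expand)
  qed
  have C: "eqon ?C (c1 - act s c1 psl_U) (c2 - act s c2 psl_S)"
  proof -
    have "eqon ?C c1 (- act s K psl_S)"
      using phi_bounds by (auto intro!: eqon_subset[OF c1_out])
    moreover note c2_out
    moreover have "eqon ?C (act s c1 psl_U) (act s K psl_U)"
      by (rule eqon_act[OF c1_in]) (unfold interval_mem, smt (verit) interval_maps phi_bounds)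
    moreover have "eqon ?C (act s c2 psl_S) (act s H psl_S)"
      by (rule eqon_act[OF c2_in]) (unfold interval_mem, smt (verit) interval_maps phi_bounds)
    moreover have "eqon ?C (act s G psl_S) (act s ?FE psl_S)"
      by (rule eqon_act[OF FE']) (use interval_maps(6) phi_bounds in \<open>fastforce simp: interval_mem\<close>)
    moreover have "eqon ?C (act s G psl_U) (act s ?FE psl_U)"
      by (rule eqon_act[OF FE']) (use interval_maps(10) phi_bounds in \<open>fastforce simp: interval_mem\<close>)
    ultimately show ?thesis by (simp add: eqon_iff_res expand)
  qed
  show ?thesis
    by (rule eqon_cover[OF eqon_Un[OF eqon_Un[OF A B] eqon_Un[OF C D]]],
        rule finite_subset[of _ "{- phi, - (phi - 1), phi - 1, phi}"]) auto
qed

text \<open>Recovers g from c1 - c2. The cut -1/\<phi> is the preimage of -\<phi> under SU: to its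
  right SU lands in (-\<phi>, 1/\<phi>), to its left outside [-\<phi>, \<phi>], so c1 and c2 each
  have a single branch on either part.\<close>

lemma G_eq: "eqon {- (phi + 1)<..<phi} G (act s (c1 - c2) (psl_S * psl_U))"
proof -
  let ?FE = "act s G (psl_U * psl_S) + act s G psl_TiSTi2
    - act s G psl_ST2"
  let ?A = "{- (phi - 1)<..<phi}" and ?B = "{- (phi + 1)<..<- (phi - 1)}"
  have A: "eqon ?A G (act s (c1 - c2) (psl_S * psl_U))"
  proof -
    have "eqon ?A (act s c1 (psl_S * psl_U)) (act s K (psl_S * psl_U))"
      by (rule eqon_act[OF c1_in]) (unfold interval_mem, blast dest: interval_maps)
    moreover have "eqon ?A (act s c2 (psl_S * psl_U)) (act s H (psl_S * psl_U))"
      by (rule eqon_act[OF c2_in]) (unfold interval_mem, smt (verit) interval_maps phi_bounds)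
    moreover have "eqon ?A (act s G (psl_S * psl_U)) (act s ?FE (psl_S * psl_U))"
      by (rule eqon_act[OF FE']) (use interval_maps(16) phi_bounds in \<open>fastforce simp: interval_mem\<close>)
    ultimately show ?thesis by (simp add: eqon_iff_res expand)
  qed
  have B: "eqon ?B G (act s (c1 - c2) (psl_S * psl_U))"
  proof -
    have "eqon ({..<- phi} \<union> {phi<..}) c1 (- act s K psl_S)"
      using phi_bounds by (auto intro!: eqon_subset[OF c1_out])
    then have "eqon ?B (act s c1 (psl_S * psl_U)) (act s (- act s K psl_S) (psl_S * psl_U))"
      by (rule eqon_act) (unfold interval_mem, blast dest: interval_maps)
    moreover have "eqon ?B (act s c2 (psl_S * psl_U))
        (act s (- (act s H psl_U + act s H (psl_U * psl_U))) (psl_S * psl_U))"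
      by (rule eqon_act[OF c2_out]) (unfold interval_mem, blast dest: interval_maps)
    ultimately show ?thesis by (simp add: eqon_iff_res expand)
  qed
  have "{- (phi + 1)<..<phi} \<subseteq> insert (- (phi - 1)) (?A \<union> ?B)" by auto
  with eqon_insert[OF eqon_Un[OF A B]] show ?thesis by (rule eqon_subset)
qed

end

text \<open>The converse: a cocycle with \<open>\<psi>\<^bsub>TST\<^sup>2\<^esub> = 0\<close> is determined by \<open>G\<close>.\<close>

lemma four_term_of_commuting:
  fixes s :: complex and c1 c2 :: fgerm
  defines "G \<equiv> act s (c1 - c2) (psl_S * psl_U)"
  assumes S: "c1 + act s c1 psl_S = 0"
    and U: "c2 + act s c2 psl_U + act s c2 (psl_U * psl_U) = 0"
    and SU: "c1 - act s c1 psl_U = c2 - act s c2 psl_S"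
  shows "G + act s G psl_ST2 = c2"
    and "act s G (psl_U * psl_S) + act s c2 (psl_U * (psl_U * psl_S)) = c1"
    and "act s G (psl_U * psl_S) + act s G psl_TiSTi2 = c2"
proof -
  note expand = act_add act_diff act_uminus act_one mult.assoc act_mult[symmetric]
  have S: "act s c1 psl_S = - c1" using S by (simp add: add_eq_0_iff)
  have Sw: "act s c1 (psl_S * w) = - act s c1 w" for w
    using arg_cong[OF S, of "\<lambda>v. act s v w"] by (simp add: expand)
  have U: "c2 = - act s c2 psl_U - act s c2 (psl_U * psl_U)"
  proof -
    have "c2 = (c2 + act s c2 psl_U + act s c2 (psl_U * psl_U)) - act s c2 psl_U - act s c2 (psl_U * psl_U)"
      by (simp add: algebra_simps)
    then show ?thesis by (simp only: U) simp
  qed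
  have Uw: "act s c2 (psl_U * (psl_U * w)) = - act s c2 w - act s c2 (psl_U * w)" for w
  proof -
    have "act s c2 w = - act s c2 (psl_U * w) - act s c2 (psl_U * (psl_U * w))"
      using arg_cong[OF U, of "\<lambda>v. act s v w"] by (simp add: expand)
    then show ?thesis by simp
  qed
  have UU: "act s c2 (psl_U * psl_U) = - c2 - act s c2 psl_U"
    using Uw[of 1] by (simp add: act_one)
  have c1U: "act s c1 psl_U = c1 - c2 + act s c2 psl_S" using SU by (simp add: algebra_simps)
  have c1Uw: "act s c1 (psl_U * w) = act s c1 w - act s c2 w + act s c2 (psl_S * w)" for w
    using arg_cong[OF c1U, of "\<lambda>v. act s v w"] by (simp add: expand)
  \<comment> \<open>Applying 1 + U + U^2 to c1|(1 - U) = c2|(1 - S) kills the left side and c2|(1 +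
    U + U^2), hence also c2|S(1 + U + U^2). With this consequence the rewriting rules reduce all
    three claims to identities.\<close>
  have SUUw: "act s c2 (psl_S * (psl_U * (psl_U * w))) = - act s c2 (psl_S * w) - act s c2 (psl_S * (psl_U * w))" for w
  proof -
    have "act s c1 w = act s c1 (psl_U * (psl_U * (psl_U * w)))" by simp
    also have "\<dots> = act s c1 w - (act s c2 w + act s c2 (psl_U * w) + act s c2 (psl_U * (psl_U * w)))
        + (act s c2 (psl_S * w) + act s c2 (psl_S * (psl_U * w)) + act s c2 (psl_S * (psl_U * (psl_U * w))))"
      by (simp only: c1Uw) (simp add: algebra_simps)
    also have "act s c2 w + act s c2 (psl_U * w) + act s c2 (psl_U * (psl_U * w)) = 0"
      by (simp only: Uw) simp
    finally have "act s c2 (psl_S * w) + act s c2 (psl_S * (psl_U * w)) + act s c2 (psl_S * (psl_U * (psl_U * w))) = 0"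
      by simp
    then show ?thesis by (simp add: add_eq_0_iff algebra_simps)
  qed
  have SUU: "act s c2 (psl_S * (psl_U * psl_U)) = - act s c2 psl_S - act s c2 (psl_S * psl_U)"
    using SUUw[of 1] by simp
  show "G + act s G psl_ST2 = c2"
    unfolding G_def by (simp add: expand S Sw UU Uw SUU SUUw c1U c1Uw)
  show "act s G (psl_U * psl_S) + act s c2 (psl_U * (psl_U * psl_S)) = c1"
    unfolding G_def by (simp add: expand S Sw UU Uw SUU SUUw c1U c1Uw)
  show "act s G (psl_U * psl_S) + act s G psl_TiSTi2 = c2"
    unfolding G_def by (simp add: expand S Sw UU Uw SUU SUUw c1U c1Uw)
qed

section \<open>The hyperbolic element \<open>TST\<^sup>2\<close>\<close>

text \<open>f is the sum of \<kappa>^n w(l^n x). Only around 0 is there a disc that z -> lz maps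
  into itself, on which the holomorphic extensions converge uniformly. From there analyticity
  spreads to the whole line by f(x) = w(x) + \<kappa> f(lx), since l^n x tends to 0.\<close>

lemma contraction_series:
  fixes \<kappa> :: complex and l :: real and w :: "real \<Rightarrow> complex"
  assumes \<kappa>: "norm \<kappa> < 1" and l: "0 < l" "l < 1" and w: "\<And>x. real_analytic_at w x"
  shows "\<exists>f. (\<forall>x. real_analytic_at f x) \<and> (\<forall>x. f x = w x + \<kappa> * f (l * x))"
proof -
  define f where "f = (\<lambda>x. \<Sum>n. \<kappa> ^ n * w (l ^ n * x))"
  have pow_le: "l ^ n \<le> 1" for n using l by (simp add: power_le_one)
  have summable: "summable (\<lambda>n. \<kappa> ^ n * w (l ^ n * x))" for x
  proof -
    have "continuous_on (cball 0 \<bar>x\<bar>) w"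
      using w real_analytic_at_imp_isCont by (blast intro: continuous_at_imp_continuous_on)
    then have "bounded (w ` cball 0 \<bar>x\<bar>)"
      by (intro compact_imp_bounded compact_continuous_image) auto
    then obtain B where "\<forall>y\<in>cball 0 \<bar>x\<bar>. norm (w y) \<le> B"
      by (auto simp: bounded_iff)
    then have B: "norm (w y) \<le> B" if "\<bar>y\<bar> \<le> \<bar>x\<bar>" for y using that by simp
    have bound: "norm (\<kappa> ^ n * w (l ^ n * x)) \<le> norm \<kappa> ^ n * B" for n
    proof -
      have "\<bar>l ^ n * x\<bar> \<le> \<bar>x\<bar>" using pow_le[of n] l by (simp add: abs_mult mult_left_le_one_le)
      then show ?thesis by (simp add: norm_mult norm_power mult_left_mono B)
    qed
    have "summable (\<lambda>n. norm \<kappa> ^ n * B)" using \<kappa> by (intro summable_mult2 summable_geometric) simp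
    then show ?thesis by (rule summable_comparison_test'[of _ 0]) (rule bound)
  qed
  have rec: "f x = w x + \<kappa> * f (l * x)" for x
  proof -
    have "f x = w x + (\<Sum>n. \<kappa> ^ Suc n * w (l ^ Suc n * x))"
      unfolding f_def using suminf_split_head[OF summable[of x]] by simp
    also have "(\<Sum>n. \<kappa> ^ Suc n * w (l ^ Suc n * x)) = (\<Sum>n. \<kappa> * (\<kappa> ^ n * w (l ^ n * (l * x))))"
      by (simp add: mult_ac)
    also have "\<dots> = \<kappa> * f (l * x)"
      unfolding f_def by (rule suminf_mult[OF summable])
    finally show ?thesis .
  qed
  obtain \<rho> where \<rho>: "\<rho> > 0" "\<And>x. \<bar>x\<bar> < \<rho> \<Longrightarrow> real_analytic_at f x"
  proof -
    obtain W where W: "W analytic_on {0}" "\<forall>\<^sub>F y in nhds 0. w y = W (of_real y)"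
      using w[of 0] by (auto simp: real_analytic_at_iff)
    obtain R where R: "R > 0" "W holomorphic_on ball 0 R"
      using W(1) by (auto simp: analytic_at_ball)
    obtain d where d: "d > 0" "\<And>y. \<bar>y\<bar> < d \<Longrightarrow> w y = W (of_real y)"
      using W(2) by (auto simp: eventually_nhds_metric dist_real_def)
    define \<rho> where "\<rho> = min (R / 2) d"
    have \<rho>: "\<rho> > 0" "\<rho> < R" "\<rho> \<le> d" using R d by (auto simp: \<rho>_def)
    have sub: "cball 0 \<rho> \<subseteq> ball (0 :: complex) R" using \<rho> by auto
    have "continuous_on (cball 0 \<rho>) W"
      using holomorphic_on_imp_continuous_on[OF R(2)] sub by (rule continuous_on_subset)
    then have "bounded (W ` cball 0 \<rho>)"
      by (intro compact_imp_bounded compact_continuous_image) auto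
    then obtain B where "\<forall>z\<in>cball 0 \<rho>. norm (W z) \<le> B"
      by (auto simp: bounded_iff)
    then have B: "norm (W z) \<le> B" if "norm z \<le> \<rho>" for z using that by simp
    have in_ball: "norm (of_real l ^ n * z) \<le> norm z" for n and z :: complex
      using pow_le[of n] l by (simp add: norm_mult norm_power mult_left_le_one_le)
    define G where "G = (\<lambda>z. \<Sum>n. \<kappa> ^ n * W (of_real l ^ n * z))"
    have lim: "uniform_limit (cball 0 \<rho>) (\<lambda>n z. \<Sum>i<n. \<kappa> ^ i * W (of_real l ^ i * z)) G sequentially"
      unfolding G_def
    proof (rule Weierstrass_m_test)
      show "norm (\<kappa> ^ n * W (of_real l ^ n * z)) \<le> norm \<kappa> ^ n * B" if "z \<in> cball 0 \<rho>" for n z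
      proof -
        have "norm (W (of_real l ^ n * z)) \<le> B"
          using that in_ball[of n z] by (intro B) simp
        then show ?thesis by (simp add: norm_mult norm_power mult_left_mono)
      qed
      show "summable (\<lambda>n. norm \<kappa> ^ n * B)" using \<kappa> by (intro summable_mult2 summable_geometric) simp
    qed
    have "(\<lambda>z. \<Sum>i<n. \<kappa> ^ i * W (of_real l ^ i * z)) holomorphic_on ball 0 R" for n
    proof (intro holomorphic_intros)
      fix i
      have "W \<circ> (\<lambda>z. of_real l ^ i * z) holomorphic_on ball 0 R"
      proof (rule holomorphic_on_compose_gen[OF _ R(2)])
        show "(\<lambda>z. of_real l ^ i * z) ` ball 0 R \<subseteq> ball (0 :: complex) R"
          using le_less_trans[OF in_ball[of i]] by auto
      qed (intro holomorphic_intros)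
      then show "(\<lambda>z. W (of_real l ^ i * z)) holomorphic_on ball 0 R" by (simp add: o_def)
    qed
    then have hol: "(\<lambda>z. \<Sum>i<n. \<kappa> ^ i * W (of_real l ^ i * z)) holomorphic_on cball 0 \<rho>" for n
      using sub holomorphic_on_subset by blast
    have "\<forall>\<^sub>F n in sequentially. continuous_on (cball 0 \<rho>) (\<lambda>z. \<Sum>i<n. \<kappa> ^ i * W (of_real l ^ i * z)) \<and>
        (\<lambda>z. \<Sum>i<n. \<kappa> ^ i * W (of_real l ^ i * z)) holomorphic_on ball 0 \<rho>"
      by (intro always_eventually allI conjI holomorphic_on_imp_continuous_on[OF hol]
          holomorphic_on_subset[OF hol ball_subset_cball])
    then have G: "G holomorphic_on ball 0 \<rho>"
      using lim by (rule holomorphic_uniform_limit) simp_all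
    have fG: "f x = G (of_real x)" if "\<bar>x\<bar> < \<rho>" for x
    proof -
      have "w (l ^ n * x) = W (of_real l ^ n * of_real x)" for n
      proof -
        have "\<bar>l ^ n * x\<bar> \<le> \<bar>x\<bar>" using pow_le[of n] l by (simp add: abs_mult mult_left_le_one_le)
        then show ?thesis using that \<rho> by (subst d(2)) auto
      qed
      then show ?thesis by (simp add: f_def G_def)
    qed
    show ?thesis
    proof (rule that[OF \<rho>(1)])
      fix x :: real assume x: "\<bar>x\<bar> < \<rho>"
      have "G analytic_on {of_real x}"
        using G x by (auto simp: analytic_at intro!: exI[of _ "ball (0 :: complex) \<rho>"])
      moreover have "\<forall>\<^sub>F y in nhds x. y \<in> ball 0 \<rho>" using x by (intro eventually_nhds_in_open) auto
      then have "\<forall>\<^sub>F y in nhds x. f y = G (of_real y)"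
        by eventually_elim (simp add: fG)
      ultimately show "real_analytic_at f x" by (auto simp: real_analytic_at_iff)
    qed
  qed
  have step: "real_analytic_at f x" if "real_analytic_at f (l * x)" for x
  proof -
    have "real_analytic_at (mat_slash 0 f (mat2 l 0 0 1)) x"
      by (rule real_analytic_at_mat_slash) (use that in simp_all)
    then have "real_analytic_at (\<lambda>y. f (l * y)) x"
      using l by (simp add: mat_slash_def[abs_def] det_mat2)
    then obtain F where F: "F analytic_on {of_real x}" "\<forall>\<^sub>F y in nhds x. f (l * y) = F (of_real y)"
      by (auto simp: real_analytic_at_iff)
    have "real_analytic_at (\<lambda>y. \<kappa> * f (l * y)) x"
      unfolding real_analytic_at_iff
    proof (intro exI conjI)
      show "(\<lambda>z. \<kappa> * F z) analytic_on {of_real x}" using F(1) by (intro analytic_intros)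
      show "\<forall>\<^sub>F y in nhds x. \<kappa> * f (l * y) = \<kappa> * F (of_real y)" using F(2) by eventually_elim simp
    qed
    from real_analytic_at_add[OF w this] have "real_analytic_at (\<lambda>y. w y + \<kappa> * f (l * y)) x" .
    moreover have "(\<lambda>y. w y + \<kappa> * f (l * y)) = f" by (rule ext) (rule rec[symmetric])
    ultimately show ?thesis by simp
  qed
  have "real_analytic_at f x" for x
  proof -
    have "real_analytic_at f (l ^ n * y) \<Longrightarrow> real_analytic_at f y" for n y
    proof (induction n)
      case (Suc n)
      then show ?case using step[of "l ^ n * y"] by (simp add: mult.assoc)
    qed simp
    moreover have "(\<lambda>n. l ^ n * x) \<longlonglongrightarrow> 0"
      using l by (intro tendsto_mult_left_zero LIMSEQ_power_zero) simp
    then have "\<forall>\<^sub>F n in sequentially. dist (l ^ n * x) 0 < \<rho>" using \<rho>(1) by (rule tendstoD)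
    then obtain n where "\<bar>l ^ n * x\<bar> < \<rho>" by (auto simp: eventually_sequentially)
    ultimately show ?thesis using \<rho>(2) by blast
  qed
  with rec show ?thesis by blast
qed

text \<open>Where the equation can be iterated, h(y) = \<kappa>^n h(l^n y) tends to 0 times the
  limit of h at 0. This covers all but countably many y, and no interval is countable, so h vanishes
  wherever it is analytic.\<close>

lemma contraction_invariant:
  fixes \<kappa> :: complex and l :: real and h :: "real \<Rightarrow> complex"
  assumes \<kappa>: "norm \<kappa> < 1" and l: "0 < l" "l < 1"
    and h: "finite {x. \<not> real_analytic_at h x}" "analytic_germ h 0"
    and inv: "finite {x. h x \<noteq> \<kappa> * h (l * x)}"
  shows "to_fgerm h = 0"
proof -
  let ?B = "{x. h x \<noteq> \<kappa> * h (l * x)}"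
  \<comment> \<open>All points whose forward orbit meets a finite exceptional set; 0 is added
    because the limit of h at 0 says nothing about the value there.\<close>
  define N where "N = insert 0 (\<Union>n. {y. l ^ n * y \<in> ?B})"
  have "{y. l ^ n * y \<in> ?B} \<subseteq> (\<lambda>b. b / l ^ n) ` ?B" for n
    using l by (auto simp: image_iff field_simps intro!: exI[of _ "l ^ n * _"])
  then have "countable {y. l ^ n * y \<in> ?B}" for n
    using inv by (meson countable_finite countable_subset finite_imageI)
  then have N: "countable N" by (simp add: N_def)
  have zero: "h y = 0" if y: "y \<notin> N" for y
  proof -
    have *: "h y = \<kappa> ^ n * h (l ^ n * y)" for n
    proof (induction n)
      case (Suc n)
      have "h (l ^ n * y) = \<kappa> * h (l * (l ^ n * y))" using y by (auto simp: N_def)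
      with Suc show ?case by (simp add: mult_ac)
    qed simp
    obtain L where L: "(h \<longlongrightarrow> L) (at 0)"
      using h(2) analytic_germ_tendsto[of _ 0 h] by (auto simp: analytic_germ_def)
    have "filterlim (\<lambda>n. l ^ n * y) (at 0) sequentially"
    proof (rule filterlim_atI)
      show "(\<lambda>n. l ^ n * y) \<longlonglongrightarrow> 0"
        using l by (intro tendsto_mult_left_zero LIMSEQ_power_zero) simp
      have "y \<noteq> 0" using y by (auto simp: N_def)
      then show "\<forall>\<^sub>F n in sequentially. l ^ n * y \<noteq> 0" using l by simp
    qed
    from filterlim_compose[OF L this] have "(\<lambda>n. h (l ^ n * y)) \<longlonglongrightarrow> L" .
    moreover have "(\<lambda>n. \<kappa> ^ n) \<longlonglongrightarrow> 0" using \<kappa> by (rule LIMSEQ_power_zero)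
    ultimately have "(\<lambda>n. \<kappa> ^ n * h (l ^ n * y)) \<longlonglongrightarrow> 0 * L" by (intro tendsto_mult)
    then have "(\<lambda>n. h y) \<longlonglongrightarrow> 0" by (simp flip: *)
    then show ?thesis by (simp add: LIMSEQ_const_iff)
  qed
  have "h x = 0" if x: "real_analytic_at h x" for x
  proof (rule ccontr)
    assume "h x \<noteq> 0"
    have "(h \<longlongrightarrow> h x) (at x)" using real_analytic_at_imp_isCont[OF x] by (simp add: isCont_def)
    then have "\<forall>\<^sub>F y in at x. h y \<noteq> 0" using \<open>h x \<noteq> 0\<close> by (rule tendsto_imp_eventually_ne)
    then obtain d where d: "d > 0" "\<And>y. y \<noteq> x \<Longrightarrow> \<bar>y - x\<bar> < d \<Longrightarrow> h y \<noteq> 0"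
      by (auto simp: eventually_at dist_real_def)
    have "{x<..<x + d} \<subseteq> N"
    proof
      fix y assume "y \<in> {x<..<x + d}"
      then have "h y \<noteq> 0" by (intro d(2)) auto
      then show "y \<in> N" using zero by blast
    qed
    then have "countable {x<..<x + d}" using N countable_subset by blast
    moreover have "uncountable {x<..<x + d}" using d(1) by (simp add: uncountable_open_interval)
    ultimately show False by blast
  qed
  then have "finite {x. h x \<noteq> 0}" by (intro finite_subset[OF _ h(1)]) auto
  then show ?thesis by (simp add: to_fgerm_eq_iff flip: to_fgerm_zero)
qed

definition eta :: psl2z where
  "eta = psl_T * psl_S * psl_T ^ 2"

lemma eta_word: "eta = psl_S * (psl_U * (psl_S * (psl_U * psl_U)))"
  by (simp add: eta_def psl_T_eq power2_eq_square mult.assoc)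

lemma eta_abs: "eta = abs_psl2z (mat2 1 1 1 2)"
  by (simp add: eta_def psl_T_abs psl_S_abs power2_eq_square abs_psl2z_mat2_mult)

lemma act_abs_psl2z:
  assumes "det A = 1"
  shows "act s v (abs_psl2z A) = gact s v (real_mat A)"
proof -
  have "act s (to_fgerm (rep_fgerm v)) (abs_psl2z A) = to_fgerm (slash s (rep_fgerm v) (abs_psl2z A))"
    by (rule act_to_fgerm)
  then show ?thesis using assms by (simp add: slash_abs_psl2z gact_def)
qed

lemma real_mat_mat2: "real_mat (mat2 a b c d) = mat2 (of_int a) (of_int b) (of_int c) (of_int d)"
  by (simp add: vec_eq_iff forall_2)

(* t = (x - 1/phi) / (x + phi) turns the action of eta into multiplication by (2 - phi)^2 = phi^(-4). *)
definition fix_mat :: "real^2^2" where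
  "fix_mat = mat2 1 (1 - phi) 1 phi"

text \<open>The eigenvalues of the matrix of \<open>eta\<close>, of trace 3 and determinant 1, are
  \<phi>^(-2) = \<open>2 - phi\<close> and \<phi>^2 = \<open>phi + 1\<close>.\<close>

definition dil_mat :: "real^2^2" where
  "dil_mat = mat2 (2 - phi) 0 0 (phi + 1)"

lemma det_fix_mat: "det fix_mat \<noteq> 0"
  using phi_bounds by (simp add: fix_mat_def det_mat2)

lemma det_dil_mat: "det dil_mat = 1"
  by (simp add: dil_mat_def det_mat2 algebra_simps phi_sq)

lemma fix_mat_eta: "fix_mat ** real_mat (mat2 1 1 1 2) = dil_mat ** fix_mat"
  by (simp add: fix_mat_def dil_mat_def real_mat_mat2 mat2_mult algebra_simps phi_sq)

lemma act_eta_gact: "act s (gact s v fix_mat) eta = gact s (gact s v dil_mat) fix_mat"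
proof -
  have "act s (gact s v fix_mat) eta = gact s (gact s v fix_mat) (real_mat (mat2 1 1 1 2))"
    unfolding eta_abs by (rule act_abs_psl2z) (simp add: det_mat2)
  also have "\<dots> = gact s v (fix_mat ** real_mat (mat2 1 1 1 2))"
    by (rule gact_mult) (simp_all add: det_fix_mat det_real_mat det_mat2)
  also have "\<dots> = gact s (gact s v dil_mat) fix_mat"
    unfolding fix_mat_eta by (rule gact_mult[symmetric]) (simp_all add: det_fix_mat det_dil_mat)
  finally show ?thesis .
qed

lemma gact_fix_mat_inverse:
  obtains C where "det C \<noteq> 0" "\<And>s v. gact s (gact s v C) fix_mat = v" "\<And>s v. gact s (gact s v fix_mat) C = v"
proof -
  obtain C where C: "det C \<noteq> 0" "fix_mat ** C = mat 1" "C ** fix_mat = mat 1"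
    using det_fix_mat by (rule det_nz_inverse)
  show ?thesis
    by (rule that[OF C(1)]) (simp_all add: gact_mult det_fix_mat C gact_one)
qed

lemma mat_moebius_fix_mat:
  "mat_moebius fix_mat (Some (- phi)) = None"
  "x \<noteq> - phi \<Longrightarrow> mat_moebius fix_mat (Some x) = Some ((x - (phi - 1)) / (x + phi))"
  "mat_moebius fix_mat None = Some 1"
  by (auto simp: mat_moebius_def fix_mat_def add_eq_0_iff)

text \<open>This is \<lambda>^s for \<lambda> = \<open>dil_ratio\<close> = \<phi>^(-4):
  \<open>dil_mat\<close> has determinant 1, so its slash action contributes only the factor with
  exponent -2s.\<close>

definition dil_factor :: "complex \<Rightarrow> complex" where
  "dil_factor s = of_real (phi + 1) powr (- 2 * s)"

definition dil_ratio :: real where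
  "dil_ratio = (2 - phi) / (phi + 1)"

lemma dil_ratio: "0 < dil_ratio" "dil_ratio < 1"
  using phi_bounds by (simp_all add: dil_ratio_def)

lemma norm_dil_factor:
  assumes "0 < Re s"
  shows "norm (dil_factor s) < 1"
proof -
  have "norm (dil_factor s) = (phi + 1) powr (- 2 * Re s)"
    using phi_bounds unfolding dil_factor_def by (subst norm_powr_real_powr) auto
  also have "\<dots> < (phi + 1) powr 0"
    using phi_bounds assms by (intro powr_less_mono) auto
  finally show ?thesis using phi_bounds by simp
qed

lemma mat_slash_dil_mat: "mat_slash s f dil_mat = (\<lambda>x. dil_factor s * f (dil_ratio * x))"
proof -
  have "det dil_mat = 1" by (rule det_dil_mat)
  then show ?thesis using phi_bounds
    by (auto simp: mat_slash_def fun_eq_iff dil_mat_def dil_factor_def dil_ratio_def)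
qed

text \<open>In the coordinate t the repelling point -\<phi> lies at infinity, so a solution analytic
  for all real t is regular at every other point of the projective line.\<close>

lemma hyperbolic_solve:
  assumes s: "0 < Re s" and w: "w \<in> V_omega s"
  shows "\<exists>f\<in>V_fs s. w = f - act s f eta \<and> (\<forall>p. p \<noteq> Some (- phi) \<longrightarrow> regular_at s f p)"
proof -
  obtain C where C: "det C \<noteq> 0" "\<And>s v. gact s (gact s v C) fix_mat = v" "\<And>s v. gact s (gact s v fix_mat) C = v"
    by (rule gact_fix_mat_inverse) blast
  have "gact s w C \<in> V_omega s" using w by (auto simp: V_omega_altdef regular_at_gact[OF C(1)])
  then obtain h where h: "gact s w C = to_fgerm h" "\<And>x. real_analytic_at h x"
    by (auto simp: V_omega_def V_omega_on_def)
  obtain f where f: "\<And>x. real_analytic_at f x" "\<And>x. f x = h x + dil_factor s * f (dil_ratio * x)"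
    using contraction_series[OF norm_dil_factor[OF s] dil_ratio h(2)] by blast
  define F where "F = gact s (to_fgerm f) fix_mat"
  have "to_fgerm f \<in> V_fs s" by (rule V_fsI) (simp add: f)
  then have "F \<in> V_fs s" unfolding F_def by (intro V_fs_gact det_fix_mat)
  moreover have "w = F - act s F eta"
  proof -
    have "gact s (to_fgerm f) dil_mat = to_fgerm (\<lambda>x. dil_factor s * f (dil_ratio * x))"
      by (simp add: gact_to_fgerm det_dil_mat mat_slash_dil_mat)
    then have "to_fgerm f = gact s w C + gact s (to_fgerm f) dil_mat"
      using f(2) unfolding h(1) plus_to_fgerm by (metis (no_types, lifting) ext plus_to_fgerm)
    then have "F = gact s (gact s w C + gact s (to_fgerm f) dil_mat) fix_mat"
      by (simp add: F_def)
    also have "\<dots> = w + act s F eta"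
      by (simp add: gact_add det_fix_mat C act_eta_gact F_def)
    finally show ?thesis by (metis add_diff_cancel_right')
  qed
  moreover have "regular_at s F p" if "p \<noteq> Some (- phi)" for p
  proof -
    have "\<exists>t. mat_moebius fix_mat p = Some t"
      using that by (cases p) (auto simp: mat_moebius_fix_mat)
    moreover have "regular_at s (to_fgerm f) (Some t)" for t
      using f(1) by (simp add: regular_at_Some analytic_germ_rep_to_fgerm real_analytic_at_imp_germ)
    ultimately show ?thesis by (auto simp: F_def regular_at_gact det_fix_mat)
  qed
  ultimately show ?thesis by blast
qed

text \<open>A singularity at some t other than 0 would recur at all \<lambda>^n t, but elements of
  \<open>V_fs s\<close> have only finitely many. Regularity at 1/\<phi>, where t = 0, is what
  \<open>contraction_invariant\<close> asks for.\<close>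

lemma hyperbolic_invariant:
  assumes s: "0 < Re s" and v: "v \<in> V_fs s" "act s v eta = v"
  shows "x \<noteq> phi - 1 \<Longrightarrow> x \<noteq> - phi \<Longrightarrow> regular_at s v (Some x)"
    and "regular_at s v (Some (phi - 1)) \<Longrightarrow> v = 0"
proof -
  obtain C where C: "det C \<noteq> 0" "\<And>s v. gact s (gact s v C) fix_mat = v" "\<And>s v. gact s (gact s v fix_mat) C = v"
    by (rule gact_fix_mat_inverse) blast
  define F where "F = gact s v C"
  have vF: "v = gact s F fix_mat" by (simp add: F_def C)
  have F: "F \<in> V_fs s" unfolding F_def by (intro V_fs_gact C v)
  have "gact s (gact s (gact s F dil_mat) fix_mat) C = gact s (gact s F fix_mat) C"
    using v(2) unfolding vF by (simp only: act_eta_gact)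
  then have inv: "gact s F dil_mat = F" by (simp add: C)
  have regular_at_dil: "regular_at s F (Some t) \<longleftrightarrow> regular_at s F (Some (dil_ratio * t))" for t
  proof -
    have "regular_at s F (Some t) \<longleftrightarrow> regular_at s (gact s F dil_mat) (Some t)" by (simp add: inv)
    also have "\<dots> \<longleftrightarrow> regular_at s F (mat_moebius dil_mat (Some t))" by (intro regular_at_gact) (simp add: det_dil_mat)
    also have "mat_moebius dil_mat (Some t) = Some (dil_ratio * t)"
      using phi_bounds by (simp add: mat_moebius_def dil_mat_def dil_ratio_def)
    finally show ?thesis .
  qed
  have regular_at_F: "regular_at s F (Some t)" if "t \<noteq> 0" for t
  proof -
    have pw: "regular_at s F (Some t) \<longleftrightarrow> regular_at s F (Some (dil_ratio ^ n * t))" for n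
      by (induction n) (use regular_at_dil in \<open>simp_all add: mult.assoc\<close>)
    have "inj (\<lambda>n. Some (dil_ratio ^ n * t))"
      using that dil_ratio by (auto intro!: injI simp: power_inject_exp')
    then have "infinite (range (\<lambda>n. Some (dil_ratio ^ n * t)))" by (rule range_inj_infinite)
    then have "\<not> range (\<lambda>n. Some (dil_ratio ^ n * t)) \<subseteq> {p. \<not> regular_at s F p}"
      using V_fs_finite_singularities[OF F] finite_subset by blast
    then show ?thesis using pw by blast
  qed
  show "regular_at s v (Some x)" if "x \<noteq> phi - 1" "x \<noteq> - phi"
    unfolding vF using that
    by (simp add: regular_at_gact det_fix_mat mat_moebius_fix_mat) (rule regular_at_F, simp add: add_eq_0_iff)
  show "v = 0" if "regular_at s v (Some (phi - 1))"
  proof -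
    have "regular_at s F (Some 0)"
      using that phi_bounds unfolding vF by (simp add: regular_at_gact det_fix_mat mat_moebius_fix_mat)
    obtain h where h: "F = to_fgerm h" "finite {x. \<not> real_analytic_at h x}" using F by (rule V_fsE)
    have "finite {x. h x \<noteq> dil_factor s * h (dil_ratio * x)}"
      using inv unfolding h(1) by (simp add: gact_to_fgerm det_dil_mat mat_slash_dil_mat to_fgerm_eq_iff eq_commute)
    then have "F = 0" unfolding h(1)
      using \<open>regular_at s F (Some 0)\<close>
      by (intro contraction_invariant[OF norm_dil_factor[OF s] dil_ratio h(2)])
         (simp_all add: h(1) regular_at_Some analytic_germ_rep_to_fgerm)
    then show ?thesis by (simp add: vF gact_zero det_fix_mat)
  qed
qed

section \<open>Separation of singularities\<close>

lemma integral_kernel_analytic: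
  fixes k k' :: "complex \<Rightarrow> real \<Rightarrow> complex"
  assumes d: "d > 0"
    and deriv: "\<And>z t. z \<in> ball z0 d \<Longrightarrow> t \<in> {a..b} \<Longrightarrow> ((\<lambda>z. k z t) has_field_derivative k' z t) (at z)"
    and cont: "continuous_on (ball z0 d \<times> {a..b}) (\<lambda>(z, t). k' z t)"
    and int: "\<And>z. z \<in> ball z0 d \<Longrightarrow> continuous_on {a..b} (k z)"
  shows "(\<lambda>z. integral {a..b} (k z)) analytic_on {z0}"
proof -
  have "(\<lambda>z. integral (cbox a b) (k z)) field_differentiable at z within ball z0 d" if "z \<in> ball z0 d" for z
  proof (rule leibniz_rule_field_differentiable[where fx = k'])
    show "((\<lambda>z. k z t) has_field_derivative k' z t) (at z within ball z0 d)"
      if "z \<in> ball z0 d" "t \<in> cbox a b" for z t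
      using deriv[of z t] that by (simp add: has_field_derivative_at_within)
    show "k z integrable_on cbox a b" if "z \<in> ball z0 d" for z
      using integrable_continuous_real[OF int[OF that]] by simp
    show "continuous_on (ball z0 d \<times> cbox a b) (\<lambda>(z, t). k' z t)" using cont by simp
  qed (use that in simp_all)
  then have "(\<lambda>z. integral {a..b} (k z)) holomorphic_on ball z0 d"
    by (simp add: holomorphic_on_def)
  then show ?thesis using d by (auto simp: analytic_at_ball)
qed

lemma cauchy_kernel_analytic:
  fixes g \<gamma> :: "real \<Rightarrow> complex"
  assumes g: "continuous_on {a..b} g" and \<gamma>: "continuous_on {a..b} \<gamma>" and z0: "z0 \<notin> \<gamma> ` {a..b}"
  shows "(\<lambda>z. integral {a..b} (\<lambda>t. g t / (\<gamma> t - z))) analytic_on {z0}"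
proof -
  have "closed (\<gamma> ` {a..b})" by (intro compact_imp_closed compact_continuous_image \<gamma>) simp
  then obtain d where d: "d > 0" "ball z0 d \<subseteq> - (\<gamma> ` {a..b})"
    using z0 by (metis ComplI open_Compl open_contains_ball)
  then have nz: "\<gamma> t - z \<noteq> 0" if "z \<in> ball z0 d" "t \<in> {a..b}" for z t using that by auto
  show ?thesis
  proof (rule integral_kernel_analytic[OF d(1), where k' = "\<lambda>z t. g t / (\<gamma> t - z)\<^sup>2"])
    show "((\<lambda>z. g t / (\<gamma> t - z)) has_field_derivative g t / (\<gamma> t - z)\<^sup>2) (at z)"
      if "z \<in> ball z0 d" "t \<in> {a..b}" for z t
      using nz[OF that] by (auto intro!: derivative_eq_intros simp: power2_eq_square)
    show "continuous_on (ball z0 d \<times> {a..b}) (\<lambda>(z, t). g t / (\<gamma> t - z)\<^sup>2)"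
      unfolding case_prod_unfold
      by (intro continuous_intros continuous_on_compose2[OF g] continuous_on_compose2[OF \<gamma>])
         (use nz in auto)
    show "continuous_on {a..b} (\<lambda>t. g t / (\<gamma> t - z))" if "z \<in> ball z0 d" for z
      by (intro continuous_intros g \<gamma>) (use nz that in auto)
  qed
qed

text \<open>This is the Cauchy kernel at -1/z. The curve is bounded, so the denominator has no zero
  for small z.\<close>

lemma cauchy_kernel_analytic_infinity:
  fixes g \<gamma> :: "real \<Rightarrow> complex"
  assumes g: "continuous_on {a..b} g" and \<gamma>: "continuous_on {a..b} \<gamma>"
  shows "(\<lambda>z. integral {a..b} (\<lambda>t. g t * z / (\<gamma> t * z + 1))) analytic_on {0}"
proof -
  have "bounded (\<gamma> ` {a..b})" by (intro compact_imp_bounded compact_continuous_image \<gamma>) simp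
  then obtain B where B: "B > 0" "\<And>t. t \<in> {a..b} \<Longrightarrow> norm (\<gamma> t) \<le> B"
    by (auto simp: bounded_pos)
  have nz: "\<gamma> t * z + 1 \<noteq> 0" if "z \<in> ball 0 (1 / B)" "t \<in> {a..b}" for z t
  proof
    assume "\<gamma> t * z + 1 = 0"
    then have "norm (\<gamma> t) * norm z = 1" by (metis add_eq_0_iff2 norm_minus_cancel norm_mult norm_one)
    moreover have "norm (\<gamma> t) * norm z \<le> B * norm z" using B(2)[OF that(2)] by (intro mult_right_mono) auto
    moreover have "B * norm z < 1" using that(1) B(1) by (simp add: field_simps)
    ultimately show False by simp
  qed
  show ?thesis
  proof (rule integral_kernel_analytic[where d = "1 / B" and k' = "\<lambda>z t. g t / (\<gamma> t * z + 1)\<^sup>2"])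
    show "1 / B > 0" using B by simp
    show "((\<lambda>z. g t * z / (\<gamma> t * z + 1)) has_field_derivative g t / (\<gamma> t * z + 1)\<^sup>2) (at z)"
      if "z \<in> ball 0 (1 / B)" "t \<in> {a..b}" for z t
      using nz[OF that] by (auto intro!: derivative_eq_intros simp: power2_eq_square algebra_simps)
    show "continuous_on (ball 0 (1 / B) \<times> {a..b}) (\<lambda>(z, t). g t / (\<gamma> t * z + 1)\<^sup>2)"
      unfolding case_prod_unfold
      by (intro continuous_intros continuous_on_compose2[OF g] continuous_on_compose2[OF \<gamma>])
         (use nz in auto)
    show "continuous_on {a..b} (\<lambda>t. g t * z / (\<gamma> t * z + 1))" if "z \<in> ball 0 (1 / B)" for z
      by (intro continuous_intros g \<gamma>) (use nz that in auto)
  qed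
qed

text \<open>The cuts at \<pi>/2 and 3\<pi>/2 separate the two real points of the circle; the first
  two arcs together form its right half.\<close>

lemma circle_meets_reals:
  fixes m \<delta> t x :: real
  assumes \<delta>: "\<delta> > 0" and eq: "complex_of_real x = of_real m + of_real \<delta> * cis t"
  shows "0 \<le> t \<Longrightarrow> t \<le> pi / 2 \<Longrightarrow> x = m + \<delta>"
    and "3 * pi / 2 \<le> t \<Longrightarrow> t \<le> 2 * pi \<Longrightarrow> x = m + \<delta>"
    and "pi / 2 \<le> t \<Longrightarrow> t \<le> 3 * pi / 2 \<Longrightarrow> x = m - \<delta>"
    and "\<bar>x - m\<bar> = \<delta>"
proof -
  have re: "x - m = \<delta> * cos t" using arg_cong[OF eq, of Re] by simp
  have "\<delta> * sin t = 0" using arg_cong[OF eq, of Im] by simp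
  then have "sin t = 0" using \<delta> by simp
  then have cos: "cos t = 1 \<or> cos t = - 1"
    using sin_cos_squared_add[of t] by (simp add: power2_eq_1_iff)
  then show "\<bar>x - m\<bar> = \<delta>" using re \<delta> by auto
  have pos: "x = m + \<delta>" if "cos t \<ge> 0" using cos that re by auto
  show "x = m + \<delta>" if "0 \<le> t" "t \<le> pi / 2"
    using that by (intro pos cos_ge_zero) auto
  show "x = m + \<delta>" if "3 * pi / 2 \<le> t" "t \<le> 2 * pi"
  proof (rule pos)
    have "cos (2 * pi - t) \<ge> 0" using that by (intro cos_ge_zero) auto
    then show "cos t \<ge> 0" by (simp add: cos_diff)
  qed
  show "x = m - \<delta>" if "pi / 2 \<le> t" "t \<le> 3 * pi / 2"
  proof -
    have "cos (t - pi) \<ge> 0" using that by (intro cos_ge_zero) auto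
    then have "cos t \<le> 0" by (simp add: cos_diff)
    then show ?thesis using cos re by auto
  qed
qed

(* p - q jumps from 0 to f across the points m - \<delta> and m + \<delta>; P is p in the chart at infinity. *)
definition splits_jump ::
    "real \<Rightarrow> real \<Rightarrow> (real \<Rightarrow> complex) \<Rightarrow> (complex \<Rightarrow> complex) \<Rightarrow> (complex \<Rightarrow> complex) \<Rightarrow> (complex \<Rightarrow> complex) \<Rightarrow> bool" where
  "splits_jump m \<delta> f p q P \<longleftrightarrow>
     (\<forall>x. x \<noteq> m + \<delta> \<longrightarrow> p analytic_on {complex_of_real x}) \<and>
     (\<forall>x. x \<noteq> m - \<delta> \<longrightarrow> q analytic_on {complex_of_real x}) \<and>
     (\<forall>x. \<bar>x - m\<bar> < \<delta> \<longrightarrow> p (of_real x) - q (of_real x) = f x) \<and>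
     (\<forall>x. \<bar>x - m\<bar> > \<delta> \<longrightarrow> p (of_real x) = q (of_real x)) \<and>
     P analytic_on {0} \<and> (\<forall>z. z \<noteq> 0 \<longrightarrow> P z = p (- 1 / z))"

text \<open>Splitting the Cauchy integral over a circle into its right and left halves decouples the two
  sides of \<open>m\<close>.\<close>

lemma analytic_jump:
  fixes f :: "complex \<Rightarrow> complex" and m \<delta> R :: real
  assumes f: "f holomorphic_on ball (of_real m) R" and \<delta>: "0 < \<delta>" "\<delta> < R"
  shows "\<exists>p q P. splits_jump m \<delta> (\<lambda>x. f (of_real x)) p q P"
proof -
  define \<gamma> where "\<gamma> = (\<lambda>t. of_real m + complex_of_real \<delta> * cis t)"
  define g where "g = (\<lambda>t. f (\<gamma> t) * of_real \<delta> * \<i> * cis t / (2 * of_real pi * \<i>))"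
  define I where "I = (\<lambda>a b z. integral {a..b} (\<lambda>t. g t / (\<gamma> t - z)))"
  define J where "J = (\<lambda>a b z. integral {a..b} (\<lambda>t. g t * z / (\<gamma> t * z + 1)))"
  have c\<gamma>: "continuous_on A \<gamma>" for A unfolding \<gamma>_def by (intro continuous_intros)
  have \<gamma>_ball: "\<gamma> t \<in> ball (of_real m) R" for t
    using \<delta> by (simp add: \<gamma>_def dist_norm norm_mult)
  have cg: "continuous_on A g" for A
    unfolding g_def
    by (intro continuous_intros continuous_on_compose2[OF holomorphic_on_imp_continuous_on[OF f] c\<gamma>])
       (use \<gamma>_ball in auto)
  define p where "p = (\<lambda>z. I 0 (pi / 2) z + I (3 * pi / 2) (2 * pi) z)"
  define q where "q = (\<lambda>z. - I (pi / 2) (3 * pi / 2) z)"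
  define P where "P = (\<lambda>z. J 0 (pi / 2) z + J (3 * pi / 2) (2 * pi) z)"
  have "p analytic_on {complex_of_real x}" if "x \<noteq> m + \<delta>" for x
  proof -
    have "complex_of_real x \<notin> \<gamma> ` {0..pi / 2}" "complex_of_real x \<notin> \<gamma> ` {3 * pi / 2..2 * pi}"
      unfolding \<gamma>_def image_iff Bex_def atLeastAtMost_iff
      using that circle_meets_reals(1,2)[OF \<delta>(1), of x m] by blast+
    then show ?thesis unfolding p_def I_def
      by (intro analytic_intros cauchy_kernel_analytic cg c\<gamma>)
  qed
  moreover have "q analytic_on {complex_of_real x}" if "x \<noteq> m - \<delta>" for x
  proof -
    have "complex_of_real x \<notin> \<gamma> ` {pi / 2..3 * pi / 2}"
      unfolding \<gamma>_def image_iff Bex_def atLeastAtMost_iff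
      using that circle_meets_reals(3)[OF \<delta>(1), of x m] by blast
    then show ?thesis unfolding q_def I_def
      by (intro analytic_intros cauchy_kernel_analytic cg c\<gamma>)
  qed
  moreover have "P analytic_on {0}"
    unfolding P_def J_def by (intro analytic_intros cauchy_kernel_analytic_infinity cg c\<gamma>)
  moreover have "P z = p (- 1 / z)" if "z \<noteq> 0" for z
  proof -
    have "g t * z / (\<gamma> t * z + 1) = g t / (\<gamma> t - - 1 / z)" for t
    proof -
      have "\<gamma> t - - 1 / z = (\<gamma> t * z + 1) / z" using that by (simp add: field_simps)
      then show ?thesis by simp
    qed
    then show ?thesis by (simp add: P_def p_def I_def J_def)
  qed
  \<comment> \<open>Adding the halves back gives the full Cauchy integral, which is f inside the
    circle and 0 outside.\<close>
  moreover have pq: "p (of_real x) - q (of_real x) =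
      contour_integral (circlepath (of_real m) \<delta>) (\<lambda>u. f u / (u - of_real x)) / (2 * of_real pi * \<i>)"
    if "\<bar>x - m\<bar> \<noteq> \<delta>" for x
  proof -
    let ?k = "\<lambda>t. g t / (\<gamma> t - of_real x)"
    have "\<gamma> t - of_real x \<noteq> 0" for t
      using circle_meets_reals(4)[OF \<delta>(1), of x m t] that by (auto simp: \<gamma>_def)
    then have "continuous_on {0..2 * pi} ?k" by (intro continuous_intros cg c\<gamma>) auto
    then have int: "?k integrable_on {0..2 * pi}" by (rule integrable_continuous_real)
    then have int': "?k integrable_on {0..3 * pi / 2}" by (rule integrable_subinterval_real) auto
    have "p (of_real x) - q (of_real x) = I 0 (pi / 2) (of_real x) + I (pi / 2) (3 * pi / 2) (of_real x)
        + I (3 * pi / 2) (2 * pi) (of_real x)"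
      by (simp add: p_def q_def)
    also have "I 0 (pi / 2) (of_real x) + I (pi / 2) (3 * pi / 2) (of_real x) = I 0 (3 * pi / 2) (of_real x)"
      unfolding I_def by (rule Henstock_Kurzweil_Integration.integral_combine[OF _ _ int']) auto
    also have "I 0 (3 * pi / 2) (of_real x) + I (3 * pi / 2) (2 * pi) (of_real x) = I 0 (2 * pi) (of_real x)"
      unfolding I_def by (rule Henstock_Kurzweil_Integration.integral_combine[OF _ _ int]) auto
    also have "\<dots> = integral {0..2 * pi} (\<lambda>t. f (of_real m + of_real \<delta> * cis t) /
        (of_real m + of_real \<delta> * cis t - of_real x) * of_real \<delta> * \<i> * cis t / (2 * of_real pi * \<i>))"
      unfolding I_def g_def \<gamma>_def
      by (rule arg_cong[of _ _ "integral _"]) (simp only: divide_inverse mult_ac)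
    also have "\<dots> = integral {0..2 * pi} (\<lambda>t. f (of_real m + of_real \<delta> * cis t) /
        (of_real m + of_real \<delta> * cis t - of_real x) * of_real \<delta> * \<i> * cis t) / (2 * of_real pi * \<i>)"
      by (simp only: integral_divide)
    also have "integral {0..2 * pi} (\<lambda>t. f (of_real m + of_real \<delta> * cis t) /
        (of_real m + of_real \<delta> * cis t - of_real x) * of_real \<delta> * \<i> * cis t) =
        contour_integral (circlepath (of_real m) \<delta>) (\<lambda>u. f u / (u - of_real x))"
      unfolding circlepath_def by (subst contour_integral_part_circlepath_eq) auto
    finally show ?thesis .
  qed
  moreover have "p (of_real x) - q (of_real x) = f (of_real x)" if "\<bar>x - m\<bar> < \<delta>" for x
  proof -
    have "f holomorphic_on cball (of_real m) \<delta>" using f \<delta> by (auto intro: holomorphic_on_subset)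
    then have "((\<lambda>u. f u / (u - of_real x)) has_contour_integral (2 * of_real pi * \<i> * f (of_real x)))
        (circlepath (of_real m) \<delta>)"
      by (rule Cauchy_integral_circlepath_simple) (use that in \<open>simp flip: of_real_diff\<close>)
    then show ?thesis using pq[of x] that by (simp add: contour_integral_unique)
  qed
  moreover have "p (of_real x) = q (of_real x)" if "\<bar>x - m\<bar> > \<delta>" for x
  proof -
    let ?R = "min R \<bar>x - m\<bar>"
    have "((\<lambda>u. f u / (u - of_real x)) has_contour_integral 0) (circlepath (of_real m) \<delta>)"
    proof (rule Cauchy_theorem_disc_simple)
      have "u - complex_of_real x \<noteq> 0" if "u \<in> ball (of_real m) ?R" for u
        using that by (auto simp: dist_norm abs_minus_commute simp flip: of_real_diff)
      then show "(\<lambda>u. f u / (u - of_real x)) holomorphic_on ball (of_real m) ?R"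
        by (intro holomorphic_intros holomorphic_on_subset[OF f]) auto
      show "path_image (circlepath (complex_of_real m) \<delta>) \<subseteq> ball (of_real m) ?R"
        using \<delta> that by (auto simp: dist_norm norm_minus_commute)
    qed auto
    then show ?thesis using pq[of x] that by (simp add: contour_integral_unique)
  qed
  ultimately show ?thesis unfolding splits_jump_def by blast
qed

text \<open>A holomorphic form of (1 + x^2)^s. Multiplication by it absorbs the factor |x|^(-2s) at
  infinity (\<open>circle_weight_inversion\<close>), so functions of weight s become ordinary
  functions on the projective line, to which Cauchy integrals apply in both charts.\<close>

definition circle_weight :: "complex \<Rightarrow> complex \<Rightarrow> complex" where
  "circle_weight s z = (1 + z ^ 2) powr s"

lemma one_plus_square: "1 + complex_of_real x ^ 2 = of_real (1 + x\<^sup>2)"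
  by simp

lemma circle_weight_analytic: "circle_weight s analytic_on {complex_of_real x}"
proof -
  have "1 + complex_of_real x ^ 2 \<notin> \<real>\<^sub>\<le>\<^sub>0"
    unfolding one_plus_square using add_pos_nonneg[of 1 "x\<^sup>2"]
    by (simp add: complex_nonpos_Reals_iff not_le del: of_real_add)
  then show ?thesis unfolding circle_weight_def[abs_def] by (intro analytic_intros) auto
qed

lemma circle_weight_minus: "circle_weight s (of_real x) * circle_weight (- s) (of_real x) = 1"
proof -
  have "1 + complex_of_real x ^ 2 \<noteq> 0"
    unfolding one_plus_square of_real_eq_0_iff using zero_le_power2[of x] by linarith
  then show ?thesis by (simp add: circle_weight_def powr_minus)
qed

lemma circle_weight_inversion:
  assumes "x \<noteq> 0"
  shows "circle_weight (- s) (of_real (- 1 / x)) * of_real \<bar>x\<bar> powr (- 2 * s) = circle_weight (- s) (of_real x)"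
proof -
  have sq: "x\<^sup>2 > 0" using assms by simp
  have "complex_of_real \<bar>x\<bar> powr (- 2 * s) = (of_real \<bar>x\<bar> powr - s) * (of_real \<bar>x\<bar> powr - s)"
    by (simp flip: powr_add)
  also have "\<dots> = (of_real \<bar>x\<bar> * of_real \<bar>x\<bar>) powr (- s)"
    by (rule powr_times_real[symmetric]) auto
  also have "\<dots> = of_real (x\<^sup>2) powr (- s)"
    by (simp add: power2_eq_square flip: of_real_mult abs_mult)
  finally have "circle_weight (- s) (of_real (- 1 / x)) * of_real \<bar>x\<bar> powr (- 2 * s) =
      of_real (1 + (- 1 / x)\<^sup>2) powr (- s) * of_real (x\<^sup>2) powr (- s)"
    by (simp add: circle_weight_def)
  also have "\<dots> = (of_real (1 + (- 1 / x)\<^sup>2) * of_real (x\<^sup>2)) powr (- s)"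
    by (rule powr_times_real[symmetric]) auto
  also have "complex_of_real (1 + (- 1 / x)\<^sup>2) * of_real (x\<^sup>2) = of_real (1 + x\<^sup>2)"
    unfolding of_real_mult[symmetric] of_real_eq_iff using assms by (simp add: field_simps)
  finally show ?thesis by (simp add: circle_weight_def)
qed

lemma weighted_jump:
  assumes h: "real_analytic_at h m" and e: "e > 0"
  shows "\<exists>\<delta> p q P. 0 < \<delta> \<and> \<delta> < e \<and> splits_jump m \<delta> (\<lambda>x. circle_weight s (of_real x) * h x) p q P"
proof -
  obtain H where H: "H analytic_on {complex_of_real m}" "\<forall>\<^sub>F y in nhds m. h y = H (of_real y)"
    using h by (auto simp: real_analytic_at_iff)
  have "(\<lambda>z. circle_weight s z * H z) analytic_on {complex_of_real m}"
    by (intro analytic_intros circle_weight_analytic H)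
  then obtain R where R: "R > 0" "(\<lambda>z. circle_weight s z * H z) holomorphic_on ball (of_real m) R"
    by (auto simp: analytic_at_ball)
  obtain d where d: "d > 0" "\<And>y. \<bar>y - m\<bar> < d \<Longrightarrow> h y = H (of_real y)"
    using H(2) by (auto simp: eventually_nhds_metric dist_real_def)
  define \<delta> where "\<delta> = min (R / 2) (min d (e / 2))"
  have \<delta>: "0 < \<delta>" "\<delta> < R" "\<delta> \<le> d" "\<delta> < e" using R d e by (auto simp: \<delta>_def min_def)
  from analytic_jump[OF R(2) \<delta>(1,2)] obtain p q P where
    "splits_jump m \<delta> (\<lambda>x. circle_weight s (of_real x) * H (of_real x)) p q P" by blast
  then have "splits_jump m \<delta> (\<lambda>x. circle_weight s (of_real x) * h x) p q P"
    using d(2) \<delta>(3) by (simp add: splits_jump_def order.strict_trans2)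
  with \<delta> show ?thesis by blast
qed

text \<open>The line is cut at m1 < r < m2 close to r. Up to the weight, v is c + (q1 - p2) between
  the cuts, where the correction is analytic, while p1 - p2 and q1 - q2 take over outside; the jumps
  p1 - q1 and p2 - q2 are exactly the weighted c near the cuts.\<close>

lemma separate_singularity:
  assumes c: "c \<in> V_fs s"
  shows "\<exists>v\<in>V_fs s. (\<forall>p. p \<noteq> Some r \<longrightarrow> regular_at s v p) \<and> regular_at s (v - c) (Some r)"
proof -
  obtain h where h: "c = to_fgerm h" "finite {x. \<not> real_analytic_at h x}" using c by (rule V_fsE)
  obtain d0 where d0: "d0 > 0" "\<And>x. \<not> real_analytic_at h x \<Longrightarrow> x \<noteq> r \<Longrightarrow> d0 \<le> dist r x"
    using finite_set_avoid[OF h(2), of r] by auto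
  define d where "d = d0 / 2"
  have d: "real_analytic_at h x" if "x \<noteq> r" "\<bar>x - r\<bar> \<le> d" for x
  proof (rule ccontr)
    assume "\<not> real_analytic_at h x"
    then have "d0 \<le> dist r x" using that(1) by (rule d0(2))
    with that(2) d0(1) show False by (simp add: d_def dist_real_def abs_minus_commute)
  qed
  have d_pos: "d > 0" using d0 by (simp add: d_def)
  define m1 m2 where "m1 = r - d" and "m2 = r + d"
  have hm: "real_analytic_at h m1" "real_analytic_at h m2" using d_pos by (auto simp: m1_def m2_def intro!: d)
  from weighted_jump[OF hm(1) d_pos, of s] obtain \<delta>1 p1 q1 P1 where
    \<delta>1: "0 < \<delta>1" "\<delta>1 < d" and p1: "\<And>x. x \<noteq> m1 + \<delta>1 \<Longrightarrow> p1 analytic_on {complex_of_real x}"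
    and q1: "\<And>x. x \<noteq> m1 - \<delta>1 \<Longrightarrow> q1 analytic_on {complex_of_real x}"
    and pq1: "\<And>x. \<bar>x - m1\<bar> < \<delta>1 \<Longrightarrow> p1 (of_real x) - q1 (of_real x) = circle_weight s (of_real x) * h x"
    "\<And>x. \<bar>x - m1\<bar> > \<delta>1 \<Longrightarrow> p1 (of_real x) = q1 (of_real x)"
    and P1: "P1 analytic_on {0}" "\<And>z. z \<noteq> 0 \<Longrightarrow> P1 z = p1 (- 1 / z)" unfolding splits_jump_def by blast
  from weighted_jump[OF hm(2) d_pos, of s] obtain \<delta>2 p2 q2 P2 where
    \<delta>2: "0 < \<delta>2" "\<delta>2 < d" and p2: "\<And>x. x \<noteq> m2 + \<delta>2 \<Longrightarrow> p2 analytic_on {complex_of_real x}"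
    and q2: "\<And>x. x \<noteq> m2 - \<delta>2 \<Longrightarrow> q2 analytic_on {complex_of_real x}"
    and pq2: "\<And>x. \<bar>x - m2\<bar> < \<delta>2 \<Longrightarrow> p2 (of_real x) - q2 (of_real x) = circle_weight s (of_real x) * h x"
    "\<And>x. \<bar>x - m2\<bar> > \<delta>2 \<Longrightarrow> p2 (of_real x) = q2 (of_real x)"
    and P2: "P2 analytic_on {0}" "\<And>z. z \<noteq> 0 \<Longrightarrow> P2 z = p2 (- 1 / z)" unfolding splits_jump_def by blast
  \<comment> \<open>Each function is used only away from its singular point: p1 and p2 to the left
    of m1 and m2, with singular points on the right, and q1 and q2 the other way round. At each cut
    the two formulas agree on a whole neighbourhood.\<close>
  define V where "V = (\<lambda>x. if x < m1 then p1 (of_real x) - p2 (of_real x)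
    else if x < m2 then circle_weight s (of_real x) * h x + q1 (of_real x) - p2 (of_real x)
    else q1 (of_real x) - q2 (of_real x))"
  define k where "k = (\<lambda>x. circle_weight (- s) (of_real x) * V x)"
  have kI: "real_analytic_at k x"
    if "\<Phi> analytic_on {complex_of_real x}" "open A" "x \<in> A" "\<And>y. y \<in> A \<Longrightarrow> V y = \<Phi> (of_real y)" for \<Phi> x A
    unfolding real_analytic_at_iff
  proof (intro exI conjI)
    show "(\<lambda>z. circle_weight (- s) z * \<Phi> z) analytic_on {complex_of_real x}"
      by (intro analytic_intros circle_weight_analytic that)
    have "\<forall>\<^sub>F y in nhds x. y \<in> A" using that by (intro eventually_nhds_in_open)
    then show "\<forall>\<^sub>F y in nhds x. k y = circle_weight (- s) (of_real y) * \<Phi> (of_real y)"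
      by eventually_elim (simp add: k_def that)
  qed
  have k: "real_analytic_at k x" if "x \<noteq> r" for x
  proof -
    consider "x < m1 + \<delta>1" "x \<le> m1" | "m1 < x" "x < m2" | "m2 - \<delta>2 < x" "m2 \<le> x"
      using \<delta>1(1) \<delta>2(1) by linarith
    then show ?thesis
    proof cases
      case 1
      show ?thesis
      proof (rule kI[of "\<lambda>z. p1 z - p2 z" x "{..<m1 + \<delta>1}"])
        show "(\<lambda>z. p1 z - p2 z) analytic_on {complex_of_real x}"
          using 1 \<delta>1 \<delta>2 by (intro analytic_intros p1 p2) (auto simp: m1_def m2_def)
        show "V y = p1 (of_real y) - p2 (of_real y)" if "y \<in> {..<m1 + \<delta>1}" for y
        proof (cases "y < m1")
          case False
          then have "y < m2" "\<bar>y - m1\<bar> < \<delta>1" using that \<delta>1 by (auto simp: m1_def m2_def)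
          then show ?thesis using False pq1(1)[of y] by (simp add: V_def flip: pq1(1))
        qed (simp add: V_def)
      qed (use 1 in auto)
    next
      case 2
      have "real_analytic_at h x" using 2 that by (intro d) (auto simp: m1_def m2_def)
      then obtain H B where H: "H analytic_on {complex_of_real x}"
        and B: "open B" "x \<in> B" "\<And>y. y \<in> B \<Longrightarrow> h y = H (of_real y)"
        unfolding real_analytic_at_iff eventually_nhds by blast
      show ?thesis
      proof (rule kI[of "\<lambda>z. circle_weight s z * H z + q1 z - p2 z" x "{m1<..<m2} \<inter> B"])
        show "(\<lambda>z. circle_weight s z * H z + q1 z - p2 z) analytic_on {complex_of_real x}"
          using 2 \<delta>1 \<delta>2 by (intro analytic_intros q1 p2 H circle_weight_analytic) (auto simp: m1_def m2_def)
      qed (use 2 B in \<open>auto simp: V_def\<close>)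
    next
      case 3
      show ?thesis
      proof (rule kI[of "\<lambda>z. q1 z - q2 z" x "{m2 - \<delta>2<..}"])
        show "(\<lambda>z. q1 z - q2 z) analytic_on {complex_of_real x}"
          using 3 \<delta>1 \<delta>2 by (intro analytic_intros q1 q2) (auto simp: m1_def m2_def)
        show "V y = q1 (of_real y) - q2 (of_real y)" if "y \<in> {m2 - \<delta>2<..}" for y
        proof (cases "y < m2")
          case True
          then have "\<not> y < m1" "\<bar>y - m2\<bar> < \<delta>2" using that \<delta>2 by (auto simp: m1_def m2_def)
          then show ?thesis using True by (simp add: V_def flip: pq2(1))
        next
          case False
          then have "\<not> y < m1" using d_pos by (auto simp: m1_def m2_def)
          then show ?thesis using False by (simp add: V_def)
        qed
      qed (use 3 in auto)
    qed
  qed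
  have "finite {x. \<not> real_analytic_at k x}"
    by (rule finite_subset[of _ "{r}"]) (use k in auto)
  then have v: "to_fgerm k \<in> V_fs s" by (rule V_fsI)
  have inf: "regular_at s (to_fgerm k) None"
  proof -
    define N where "N = \<bar>m1\<bar> + \<bar>m2\<bar> + \<delta>1 + \<delta>2 + 1"
    have N: "N > 0" using \<delta>1 \<delta>2 by (simp add: N_def)
    \<comment> \<open>Far out p1 = q1 and p2 = q2, so the left and right pieces are one function,
      given by P1 - P2 in the chart at infinity.\<close>
    have V: "V y = p1 (of_real y) - p2 (of_real y)" if "\<bar>y\<bar> > N" for y
    proof -
      have "\<bar>y - m1\<bar> > \<delta>1" "\<bar>y - m2\<bar> > \<delta>2" "y < m1 \<or> \<not> y < m2 \<and> \<not> y < m1"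
        using that \<delta>1 \<delta>2 by (auto simp: N_def abs_if m1_def m2_def split: if_splits)
      then show ?thesis using pq1(2)[of y] pq2(2)[of y] by (auto simp: V_def)
    qed
    have "\<forall>\<^sub>F x in at 0. \<bar>x\<bar> < 1 / N" using N unfolding eventually_at
      by (intro exI[of _ "1 / N"]) (auto simp: dist_real_def)
    moreover have "\<forall>\<^sub>F x :: real in at 0. x \<noteq> 0" by (simp add: eventually_at_filter)
    ultimately have ev: "\<forall>\<^sub>F x in at 0. mat_slash s k (mat2 0 (-1) 1 0) x =
        circle_weight (- s) (of_real x) * (P1 (of_real x) - P2 (of_real x))"
    proof eventually_elim
      case (elim x)
      have "\<bar>- 1 / x\<bar> > N" using elim N by (simp add: field_simps)
      then have "V (- 1 / x) = P1 (of_real x) - P2 (of_real x)"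
        using V[of "- 1 / x"] elim by (simp add: P1(2) P2(2))
      then show ?case
        using circle_weight_inversion[OF elim(2), of s]
        by (simp add: mat_slash_def det_mat2 k_def mult.commute mult.left_commute)
    qed
    have "(\<lambda>z. circle_weight (- s) z * (P1 z - P2 z)) analytic_on {complex_of_real 0}"
      using P1 P2 by (intro analytic_intros circle_weight_analytic) simp_all
    then have "analytic_germ (mat_slash s k (mat2 0 (-1) 1 0)) 0"
      using ev unfolding analytic_germ_def by blast
    moreover have "\<forall>\<^sub>F x in at 0. mat_slash s (rep_fgerm (to_fgerm k)) (mat2 0 (-1) 1 0) x =
        mat_slash s k (mat2 0 (-1) 1 0) x"
      by (intro eventually_at_finite_diff finite_mat_slash finite_rep_to_fgerm) (simp add: det_mat2)
    ultimately show ?thesis unfolding regular_at_None using analytic_germ_cong by blast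
  qed
  have "regular_at s (to_fgerm k) p" if "p \<noteq> Some r" for p
    using that inf k by (cases p) (auto simp: regular_at_Some analytic_germ_rep_to_fgerm intro: real_analytic_at_imp_germ)
  moreover have "regular_at s (to_fgerm k - c) (Some r)"
  proof -
    have "\<forall>\<^sub>F y in nhds r. y \<in> {m1<..<m2}"
      using d_pos by (intro eventually_nhds_in_open) (auto simp: m1_def m2_def)
    then have "\<forall>\<^sub>F y in nhds r. k y - h y = circle_weight (- s) (of_real y) * (q1 (of_real y) - p2 (of_real y))"
    proof eventually_elim
      case (elim y)
      have "k y = (circle_weight s (of_real y) * circle_weight (- s) (of_real y)) * h y
          + circle_weight (- s) (of_real y) * (q1 (of_real y) - p2 (of_real y))"
        using elim by (simp add: k_def V_def algebra_simps)
      then show ?case by (simp add: circle_weight_minus)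
    qed
    moreover have "(\<lambda>z. circle_weight (- s) z * (q1 z - p2 z)) analytic_on {complex_of_real r}"
      using \<delta>1 \<delta>2 by (intro analytic_intros circle_weight_analytic q1 p2) (auto simp: m1_def m2_def)
    ultimately have "real_analytic_at (\<lambda>y. k y - h y) r" unfolding real_analytic_at_iff by blast
    then show ?thesis
      by (simp add: h(1) minus_to_fgerm regular_at_Some analytic_germ_rep_to_fgerm real_analytic_at_imp_germ)
  qed
  ultimately show ?thesis using v by blast
qed

section \<open>Cohomology classes\<close>

definition submodule :: "complex \<Rightarrow> fgerm set \<Rightarrow> bool" where
  "submodule s V \<longleftrightarrow> 0 \<in> V \<and> (\<forall>u\<in>V. \<forall>v\<in>V. u + v \<in> V) \<and> (\<forall>u\<in>V. - u \<in> V) \<and>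
     (\<forall>u\<in>V. \<forall>\<gamma>. act s u \<gamma> \<in> V)"

lemma submodule_V_fs: "submodule s (V_fs s)"
  by (simp add: submodule_def V_fs_zero V_fs_add V_fs_uminus V_fs_act)

lemma submodule_V_omega: "submodule s (V_omega s)"
  by (simp add: submodule_def V_omega_zero V_omega_add V_omega_uminus V_omega_act)

lemma submodule_diff: "submodule s V \<Longrightarrow> u \<in> V \<Longrightarrow> v \<in> V \<Longrightarrow> u - v \<in> V"
  unfolding submodule_def by (metis add_uminus_conv_diff)

lemma B1_iff: "\<psi> \<in> B1 (act s) V \<longleftrightarrow> (\<exists>v\<in>V. \<forall>\<gamma>. \<psi> \<gamma> = v - act s v \<gamma>)"
  by (auto simp: B1_def fun_eq_iff)

lemma equiv_cohomologous:
  assumes "submodule s V"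
  shows "equiv (Z1 (act s) V) (cohomologous (act s) V)"
proof (rule equivI)
  have 0: "(\<lambda>\<gamma>. \<psi> \<gamma> - \<psi> \<gamma>) \<in> B1 (act s) V" for \<psi>
    unfolding B1_iff using assms by (intro bexI[of _ 0]) (simp_all add: submodule_def act_zero)
  show "refl_on (Z1 (act s) V) (cohomologous (act s) V)"
    using 0 by (auto simp: refl_on_def cohomologous_def)
  show "cohomologous (act s) V \<subseteq> Z1 (act s) V \<times> Z1 (act s) V"
    by (auto simp: cohomologous_def)
  show "sym (cohomologous (act s) V)"
  proof (rule symI)
    fix \<psi> \<psi>' assume *: "(\<psi>, \<psi>') \<in> cohomologous (act s) V"
    then obtain v where v: "v \<in> V" "\<And>\<gamma>. \<psi> \<gamma> - \<psi>' \<gamma> = v - act s v \<gamma>"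
      by (auto simp: cohomologous_def B1_iff)
    have "- v \<in> V" using assms v by (simp add: submodule_def)
    moreover have "\<psi>' \<gamma> - \<psi> \<gamma> = - v - act s (- v) \<gamma>" for \<gamma>
      using v(2)[of \<gamma>] by (simp add: act_uminus) (metis minus_diff_eq)
    ultimately show "(\<psi>', \<psi>) \<in> cohomologous (act s) V"
      using * unfolding cohomologous_def B1_iff by blast
  qed
  show "trans (cohomologous (act s) V)"
  proof (rule transI)
    fix \<psi> \<psi>' \<psi>'' assume *: "(\<psi>, \<psi>') \<in> cohomologous (act s) V" "(\<psi>', \<psi>'') \<in> cohomologous (act s) V"
    then obtain v v' where v: "v \<in> V" "\<And>\<gamma>. \<psi> \<gamma> - \<psi>' \<gamma> = v - act s v \<gamma>"
      "v' \<in> V" "\<And>\<gamma>. \<psi>' \<gamma> - \<psi>'' \<gamma> = v' - act s v' \<gamma>"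
      by (auto simp: cohomologous_def B1_iff)
    have "v + v' \<in> V" using assms v by (simp add: submodule_def)
    moreover have "\<psi> \<gamma> - \<psi>'' \<gamma> = v + v' - act s (v + v') \<gamma>" for \<gamma>
    proof -
      have "\<psi> \<gamma> - \<psi>'' \<gamma> = (\<psi> \<gamma> - \<psi>' \<gamma>) + (\<psi>' \<gamma> - \<psi>'' \<gamma>)" by simp
      then show ?thesis by (simp only: v act_add) (simp add: algebra_simps)
    qed
    ultimately show "(\<psi>, \<psi>'') \<in> cohomologous (act s) V"
      using * unfolding cohomologous_def B1_iff by blast
  qed
qed

lemma H1_class_eq_iff:
  assumes "submodule s V" "\<psi> \<in> Z1 (act s) V" "\<psi>' \<in> Z1 (act s) V"
  shows "H1_class (act s) V \<psi> = H1_class (act s) V \<psi>' \<longleftrightarrow>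
    (\<exists>v\<in>V. \<forall>\<gamma>. \<psi> \<gamma> - \<psi>' \<gamma> = v - act s v \<gamma>)"
  using eq_equiv_class_iff[OF equiv_cohomologous[OF assms(1)] assms(2,3)] assms(2,3)
  unfolding H1_class_def by (simp add: cohomologous_def B1_iff)

lemma Z1_minus_coboundary:
  assumes V: "submodule s V" and \<psi>: "\<psi> \<in> Z1 (act s) V" and v: "v \<in> V"
  shows "(\<lambda>\<gamma>. \<psi> \<gamma> - (v - act s v \<gamma>)) \<in> Z1 (act s) V"
  unfolding Z1_def
proof (intro CollectI conjI allI)
  fix \<gamma> \<delta>
  show "\<psi> \<gamma> - (v - act s v \<gamma>) \<in> V"
    using assms by (intro submodule_diff[OF V]) (auto simp: Z1_def submodule_def)
  show "\<psi> (\<gamma> * \<delta>) - (v - act s v (\<gamma> * \<delta>)) = act s (\<psi> \<gamma> - (v - act s v \<gamma>)) \<delta> + (\<psi> \<delta> - (v - act s v \<delta>))"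
    by (simp add: Z1_mult[OF \<psi>] act_diff act_mult)
qed

lemma H1_class_minus_coboundary:
  assumes "submodule s V" "\<psi> \<in> Z1 (act s) V" "v \<in> V"
  shows "H1_class (act s) V (\<lambda>\<gamma>. \<psi> \<gamma> - (v - act s v \<gamma>)) = H1_class (act s) V \<psi>"
proof -
  have "- v \<in> V" using assms by (simp add: submodule_def)
  then show ?thesis
    unfolding H1_class_eq_iff[OF assms(1) Z1_minus_coboundary[OF assms] assms(2)]
    by (intro bexI[of _ "- v"]) (auto simp: act_uminus)
qed

lemma Z1_mono: "V \<subseteq> W \<Longrightarrow> Z1 ac V \<subseteq> Z1 ac W"
  by (auto simp: Z1_def)

lemma H1_incl_class:
  assumes V: "submodule s V" and W: "submodule s W" and sub: "V \<subseteq> W" and \<psi>: "\<psi> \<in> Z1 (act s) V"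
  shows "H1_incl (act s) W (H1_class (act s) V \<psi>) = H1_class (act s) W \<psi>"
proof -
  have "H1_class (act s) W \<psi>' = H1_class (act s) W \<psi>" if "\<psi>' \<in> H1_class (act s) V \<psi>" for \<psi>'
  proof -
    have "(\<psi>, \<psi>') \<in> cohomologous (act s) V" using that by (simp add: H1_class_def)
    then have "\<psi>' \<in> Z1 (act s) W" "\<psi> \<in> Z1 (act s) W" "\<exists>v\<in>W. \<forall>\<gamma>. \<psi> \<gamma> - \<psi>' \<gamma> = v - act s v \<gamma>"
      using sub Z1_mono[OF sub] by (auto simp: cohomologous_def B1_iff)
    then show ?thesis using H1_class_eq_iff[OF W] by metis
  qed
  moreover have "\<psi> \<in> H1_class (act s) V \<psi>"
    using equiv_class_self[OF equiv_cohomologous[OF V] \<psi>] by (simp add: H1_class_def)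
  ultimately show ?thesis unfolding H1_incl_def by blast
qed

section \<open>The map \<open>\<theta>\<close>\<close>

lemma word_simps:
  "psl_S * psl_T ^ 2 = psl_ST2"
  "inverse psl_T * psl_S * inverse psl_T ^ 2 = psl_TiSTi2"
  "psl_S * psl_T * psl_S = psl_U * (psl_U * psl_S)"
  "psl_S * psl_T = psl_U * psl_U"
  by (simp_all add: inverse_psl_T power2_eq_square mult.assoc) (simp_all add: psl_T_eq mult.assoc)

lemma to_fgerm_theta_h:
  "to_fgerm (theta_h s g) = to_fgerm g + act s (to_fgerm g) psl_ST2"
  by (simp add: act_to_fgerm plus_to_fgerm theta_h_def[abs_def] word_simps)

lemma to_fgerm_theta_k:
  "to_fgerm (theta_k s g) = act s (to_fgerm g) (psl_U * psl_S)
     + act s (to_fgerm (theta_h s g)) (psl_U * (psl_U * psl_S))"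
  by (simp add: act_to_fgerm plus_to_fgerm theta_k_def[abs_def] word_simps inverse_psl_T mult.assoc)

lemma theta_data_theta:
  "theta_data s (to_fgerm g) (to_fgerm (theta_h s g)) (to_fgerm (theta_k s g)) (theta_c1 s g) (theta_c2 s g)"
proof
  show "to_fgerm (theta_h s g) = to_fgerm g + act s (to_fgerm g) psl_ST2"
    by (rule to_fgerm_theta_h)
  show "to_fgerm (theta_k s g) = act s (to_fgerm g) (psl_U * psl_S)
      + act s (to_fgerm (theta_h s g)) (psl_U * (psl_U * psl_S))"
    by (rule to_fgerm_theta_k)
  show "eqon {- phi<..<phi - 1} (theta_c1 s g) (to_fgerm (theta_k s g))"
    unfolding theta_c1_def eqon_to_fgerm inverse_phi by (rule finite_subset[of _ "{}"]) auto
  show "eqon ({..<- phi} \<union> {phi - 1<..}) (theta_c1 s g) (- act s (to_fgerm (theta_k s g)) psl_S)"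
    unfolding theta_c1_def act_to_fgerm uminus_to_fgerm eqon_to_fgerm inverse_phi
    by (rule finite_subset[of _ "{}"]) auto
  show "eqon {- phi<..<phi} (theta_c2 s g) (to_fgerm (theta_h s g))"
    unfolding theta_c2_def eqon_to_fgerm by (rule finite_subset[of _ "{}"]) auto
  show "eqon ({..<- phi} \<union> {phi<..}) (theta_c2 s g)
     (- (act s (to_fgerm (theta_h s g)) psl_U + act s (to_fgerm (theta_h s g)) (psl_U * psl_U)))"
    unfolding theta_c2_def act_to_fgerm plus_to_fgerm uminus_to_fgerm eqon_to_fgerm word_simps
      psl_U_def[symmetric]
    by (rule finite_subset[of _ "{}"]) auto
qed

lemma moebius_defined:
  "- phi < x \<Longrightarrow> x < phi \<Longrightarrow> \<exists>y. moebius psl_ST2 (Some x) = Some y"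
  "- phi < x \<Longrightarrow> x < phi \<Longrightarrow> \<exists>y. moebius psl_TiSTi2 (Some x) = Some y"
  "moebius (psl_U * psl_S) (Some x) = Some (x - 1)"
  using phi_bounds
  by (auto simp: psl_S_abs psl_U_abs abs_psl2z_mat2_mult moebius_abs_psl2z det_mat2 mat_moebius_def)

lemma moebius_image:
  assumes "\<gamma> * \<delta> = 1" "moebius \<delta> (Some x) = Some y" "y \<in> X"
  shows "Some x \<in> moebius \<gamma> ` Some ` X"
proof -
  have "Some x = moebius \<gamma> (Some y)"
    using assms(1,2) by (metis moebius_mult moebius_one)
  with assms(3) show ?thesis by blast
qed

text \<open>X and TX alone meet in (-\<phi>, \<phi>), and the other two images contain this
  interval.\<close>

lemma FE4_domain:
  "Some x \<in> Some ` {- (phi + 1)<..<phi}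
     \<inter> moebius (inverse psl_T ^ 2 * psl_S) ` Some ` {- (phi + 1)<..<phi}
     \<inter> moebius psl_T ` Some ` {- (phi + 1)<..<phi}
     \<inter> moebius (psl_T^2 * psl_S * psl_T) ` Some ` {- (phi + 1)<..<phi} \<longleftrightarrow> - phi < x \<and> x < phi"
    (is "?L \<longleftrightarrow> ?R")
proof
  let ?X = "{- (phi + 1)<..<phi}"
  assume L: ?L
  then have 1: "x < phi" by auto
  from L obtain y where y: "y \<in> ?X" "Some x = moebius psl_T (Some y)" by blast
  then have "x = y + 1" by (simp add: psl_T_abs moebius_abs_psl2z det_mat2 mat_moebius_def)
  then show ?R using 1 y(1) by auto
next
  let ?X = "{- (phi + 1)<..<phi}"
  assume R: ?R
  have "(inverse psl_T ^ 2 * psl_S) * psl_ST2 = 1"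
    "psl_T * (psl_U * psl_S) = 1"
    "(psl_T^2 * psl_S * psl_T) * psl_TiSTi2 = 1"
    by (simp_all add: inverse_psl_T power2_eq_square mult.assoc) (simp_all add: psl_T_eq mult.assoc)
  note w = this
  obtain y1 where y1: "moebius psl_ST2 (Some x) = Some y1"
    using moebius_defined(1) R by blast
  obtain y2 where y2: "moebius psl_TiSTi2 (Some x) = Some y2"
    using moebius_defined(2) R by blast
  have "y1 \<in> ?X" using interval_maps(20)[OF y1] R by simp
  moreover have "y2 \<in> ?X" using interval_maps(21)[OF y2] R by simp
  moreover have "x - 1 \<in> ?X" "x \<in> ?X" using R phi_bounds by auto
  ultimately show ?L
    using moebius_image[OF w(1) y1] moebius_image[OF w(3) y2] moebius_image[OF w(2) moebius_defined(3)]
    by blast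
qed

lemma FE4_iff:
  "g \<in> FE4 s {- (phi^2)<..<phi} \<longleftrightarrow>
     (\<forall>x\<in>{- (phi + 1)<..<phi}. real_analytic_at g x) \<and> (\<forall>x. x \<notin> {- (phi + 1)<..<phi} \<longrightarrow> g x = 0) \<and>
     (\<forall>x. - phi < x \<longrightarrow> x < phi \<longrightarrow>
        g x + slash s g psl_ST2 x =
        slash s g (psl_U * psl_S) x + slash s g psl_TiSTi2 x)"
  unfolding FE4_def mem_Collect_eq phi_power2 FE4_domain word_simps
  unfolding inverse_psl_T by (simp only: imp_conjL)

lemma theta_data_FE_theta:
  assumes g: "g \<in> FE4 s {- (phi^2)<..<phi}"
  shows "theta_data_FE s (to_fgerm g) (to_fgerm (theta_h s g)) (to_fgerm (theta_k s g)) (theta_c1 s g) (theta_c2 s g)"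
proof -
  have "eqon {- phi<..<phi} (to_fgerm g + act s (to_fgerm g) psl_ST2)
    (act s (to_fgerm g) (psl_U * psl_S) + act s (to_fgerm g) psl_TiSTi2)"
    unfolding act_to_fgerm plus_to_fgerm eqon_to_fgerm
    using g unfolding FE4_iff by (intro finite_subset[OF _ finite.emptyI]) auto
  then show ?thesis
    by (intro theta_data_FE.intro theta_data_theta theta_data_FE_axioms.intro)
qed

lemma V_fs_piecewise:
  assumes "to_fgerm f \<in> V_fs s" "to_fgerm f' \<in> V_fs s"
  shows "to_fgerm (\<lambda>x. if x \<in> {a<..<b} then f x else f' x) \<in> V_fs s"
proof -
  obtain h where h: "to_fgerm f = to_fgerm h" "finite {x. \<not> real_analytic_at h x}"
    using assms(1) by (rule V_fsE)
  obtain h' where h': "to_fgerm f' = to_fgerm h'" "finite {x. \<not> real_analytic_at h' x}"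
    using assms(2) by (rule V_fsE)
  let ?k = "\<lambda>x. if x \<in> {a<..<b} then h x else h' x"
  have fin: "finite {x. f x \<noteq> h x}" "finite {x. f' x \<noteq> h' x}"
    using h(1) h'(1) by (simp_all add: to_fgerm_eq_iff)
  have "to_fgerm (\<lambda>x. if x \<in> {a<..<b} then f x else f' x) = to_fgerm ?k"
    unfolding to_fgerm_eq_iff
    by (rule finite_subset[OF _ finite_UnI[OF fin]]) auto
  moreover have "real_analytic_at ?k x"
    if "real_analytic_at h x" "real_analytic_at h' x" "x \<noteq> a" "x \<noteq> b" for x
  proof (cases "x \<in> {a<..<b}")
    case True
    then have "\<forall>\<^sub>F y in nhds x. y \<in> {a<..<b}" by (intro eventually_nhds_in_open) auto
    then have "\<forall>\<^sub>F y in nhds x. ?k y = h y" by eventually_elim simp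
    then show ?thesis using that(1) real_analytic_at_cong[of ?k h x] by simp
  next
    case False
    then have "\<forall>\<^sub>F y in nhds x. y \<in> - {a..b}" using that(3,4) by (intro eventually_nhds_in_open) auto
    then have "\<forall>\<^sub>F y in nhds x. ?k y = h' y" by eventually_elim auto
    then show ?thesis using that(2) real_analytic_at_cong[of ?k h' x] by simp
  qed
  then have "{x. \<not> real_analytic_at ?k x} \<subseteq> {x. \<not> real_analytic_at h x} \<union> {x. \<not> real_analytic_at h' x} \<union> {a, b}"
    by auto
  then have "finite {x. \<not> real_analytic_at ?k x}"
    using h(2) h'(2) by (elim finite_subset) simp
  ultimately show ?thesis by (simp add: V_fsI)
qed

lemma FE4_V_fs:
  assumes g: "g \<in> FE4 s {- (phi^2)<..<phi}"
  shows "to_fgerm g \<in> V_fs s" "to_fgerm (theta_h s g) \<in> V_fs s" "to_fgerm (theta_k s g) \<in> V_fs s"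
    "theta_c1 s g \<in> V_fs s" "theta_c2 s g \<in> V_fs s"
proof -
  let ?X = "{- (phi + 1)<..<phi}"
  \<comment> \<open>g is extended by 0, so only the end points of \<open>?X\<close> can be
    singular.\<close>
  have "real_analytic_at g x" if "x \<noteq> - (phi + 1)" "x \<noteq> phi" for x
  proof (cases "x \<in> ?X")
    case True
    then show ?thesis using g by (simp add: FE4_iff)
  next
    case False
    then have "\<forall>\<^sub>F y in nhds x. y \<in> - {- (phi + 1)..phi}" using that by (intro eventually_nhds_in_open) auto
    then have "\<forall>\<^sub>F y in nhds x. g y = 0" by eventually_elim (use g in \<open>auto simp: FE4_iff\<close>)
    then show ?thesis by (simp add: real_analytic_at_cong[of g "\<lambda>_. 0"] real_analytic_at_const)
  qed
  then have "finite {x. \<not> real_analytic_at g x}"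
    by (intro finite_subset[OF _ finite.insertI[OF finite.insertI[OF finite.emptyI]], of _ "- (phi + 1)" phi]) auto
  then show G: "to_fgerm g \<in> V_fs s" by (rule V_fsI)
  show H: "to_fgerm (theta_h s g) \<in> V_fs s"
    unfolding to_fgerm_theta_h by (intro V_fs_add V_fs_act G)
  show K: "to_fgerm (theta_k s g) \<in> V_fs s"
    unfolding to_fgerm_theta_k by (intro V_fs_add V_fs_act G H)
  show "theta_c1 s g \<in> V_fs s"
    unfolding theta_c1_def
    by (intro V_fs_piecewise K) (simp add: V_fs_uminus V_fs_act K flip: uminus_to_fgerm act_to_fgerm)
  show "theta_c2 s g \<in> V_fs s"
    unfolding theta_c2_def
    by (intro V_fs_piecewise H, unfold uminus_to_fgerm[symmetric] plus_to_fgerm[symmetric] act_to_fgerm[symmetric])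
       (intro V_fs_uminus V_fs_add V_fs_act H)
qed

lemma theta_cocycle_eqI:
  assumes "\<psi> \<in> Z1 (act s) (V_fs s)" "\<psi> psl_S = - theta_c1 s g" "\<psi> psl_U = - theta_c2 s g"
  shows "theta_cocycle s g = \<psi>"
  unfolding theta_cocycle_def psl_U_def[symmetric]
  by (rule the_equality) (use assms Z1_eqI in \<open>auto intro: Z1_eqI\<close>)

text \<open>\<open>eta\<close> times US is SU, so the value at \<open>eta\<close> measures the
  difference of the values at SU and US; expanding both by the cocycle rule gives the
  equation.\<close>

lemma Z1_eta:
  assumes \<psi>: "\<psi> \<in> Z1 (act s) V"
  shows "\<psi> eta = 0 \<longleftrightarrow> \<psi> psl_S - act s (\<psi> psl_S) psl_U = \<psi> psl_U - act s (\<psi> psl_U) psl_S"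
proof -
  have "eta * (psl_U * psl_S) = psl_S * psl_U" by (simp add: eta_word mult.assoc)
  then have "act s (\<psi> eta) (psl_U * psl_S) = \<psi> (psl_S * psl_U) - \<psi> (psl_U * psl_S)"
    using Z1_mult[OF \<psi>, of eta "psl_U * psl_S"] by simp
  also have "\<dots> = act s (\<psi> psl_S) psl_U + \<psi> psl_U - (act s (\<psi> psl_U) psl_S + \<psi> psl_S)"
    by (simp add: Z1_mult[OF \<psi>])
  finally have *: "act s (\<psi> eta) (psl_U * psl_S) =
      (\<psi> psl_U - act s (\<psi> psl_U) psl_S) - (\<psi> psl_S - act s (\<psi> psl_S) psl_U)"
    by (simp add: algebra_simps)
  have "\<psi> eta = act s (act s (\<psi> eta) (psl_U * psl_S)) (psl_S * (psl_U * psl_U))"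
    by (simp add: act_mult[symmetric] mult.assoc act_one)
  then have "\<psi> eta = 0 \<longleftrightarrow> act s (\<psi> eta) (psl_U * psl_S) = 0" by (metis act_zero)
  then show ?thesis unfolding * by auto
qed

lemma theta_cocycle:
  assumes g: "g \<in> FE4 s {- (phi^2)<..<phi}"
  shows "theta_cocycle s g \<in> Z1 (act s) (V_fs s)" "theta_cocycle s g psl_S = - theta_c1 s g"
    "theta_cocycle s g psl_U = - theta_c2 s g" "theta_cocycle s g eta = 0"
proof -
  interpret theta_data_FE s "to_fgerm g" "to_fgerm (theta_h s g)" "to_fgerm (theta_k s g)" "theta_c1 s g" "theta_c2 s g"
    using g by (rule theta_data_FE_theta)
  have "- theta_c1 s g + act s (- theta_c1 s g) psl_S = - (theta_c1 s g + act s (theta_c1 s g) psl_S)"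
    by (simp add: act_uminus)
  then have 1: "- theta_c1 s g + act s (- theta_c1 s g) psl_S = 0" by (simp add: c1_S)
  have "- theta_c2 s g + act s (- theta_c2 s g) psl_U + act s (- theta_c2 s g) (psl_U * psl_U) =
      - (theta_c2 s g + act s (theta_c2 s g) psl_U + act s (theta_c2 s g) (psl_U * psl_U))"
    by (simp add: act_uminus)
  then have 2: "- theta_c2 s g + act s (- theta_c2 s g) psl_U + act s (- theta_c2 s g) (psl_U * psl_U) = 0"
    by (simp only: c2_U) simp
  obtain \<psi> where \<psi>: "\<psi> \<in> Z1 (act s) UNIV" "\<psi> psl_S = - theta_c1 s g" "\<psi> psl_U = - theta_c2 s g"
    using cocycle_exists[OF 1 2] by blast
  have \<psi>': "\<psi> \<in> Z1 (act s) (V_fs s)"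
    by (rule Z1_subspace[OF \<psi>(1)])
       (simp_all add: \<psi>(2,3) V_fs_uminus FE4_V_fs[OF g] V_fs_zero V_fs_add V_fs_act)
  have eq: "theta_cocycle s g = \<psi>" by (rule theta_cocycle_eqI[OF \<psi>' \<psi>(2,3)])
  show "theta_cocycle s g \<in> Z1 (act s) (V_fs s)" "theta_cocycle s g psl_S = - theta_c1 s g"
    "theta_cocycle s g psl_U = - theta_c2 s g" using \<psi>' \<psi> by (simp_all add: eq)
  show "theta_cocycle s g eta = 0"
    using c1_U_c2_S unfolding eq Z1_eta[OF \<psi>(1)] \<psi>(2,3) by (simp add: act_uminus) (simp add: algebra_simps)
qed

lemma theta_in_H1_Fib:
  assumes g: "g \<in> FE4 s {- (phi^2)<..<phi}"
  shows "theta s g \<in> H1_Fib s (V_fs s)"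
proof -
  have "theta_cocycle s g (psl_T * psl_S * psl_T^2) = 0 - act s 0 (psl_T * psl_S * psl_T^2)"
    using theta_cocycle(4)[OF g] by (simp add: eta_def act_zero)
  then show ?thesis
    unfolding theta_def H1_Fib_def using theta_cocycle(1)[OF g] V_fs_zero by blast
qed

section \<open>Injectivity\<close>

lemma eq_on_open_of_finite:
  fixes f g :: "real \<Rightarrow> complex"
  assumes X: "open X" "x \<in> X" and fin: "finite {x \<in> X. f x \<noteq> g x}"
    and "isCont f x" "isCont g x"
  shows "f x = g x"
proof -
  have "(f \<longlongrightarrow> f x) (at x)" "(g \<longlongrightarrow> g x) (at x)" using assms by (auto simp: isCont_def)
  moreover have "\<forall>\<^sub>F y in at x. f y = g y" using X fin by (rule eventually_at_eq_of_finite)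
  ultimately show "f x = g x"
    using tendsto_unique[OF trivial_limit_at] tendsto_cong by metis
qed

lemma moebius_values:
  "moebius psl_U (Some (1 - phi)) = Some (phi - 1)"
  "moebius psl_S (Some (phi - 1)) = Some (- phi)"
  "moebius psl_U (Some (- phi)) = Some (phi - 2)"
  "moebius psl_S (Some (- phi)) = Some (phi - 1)"
  "moebius psl_U (Some phi) = Some (- phi)"
  "moebius psl_U (Some (phi - 2)) = Some phi"
  "moebius psl_S (Some phi) = Some (1 - phi)"
  "moebius psl_U (Some (phi - 1)) = Some (- (phi + 1))"
proof -
  have nz: "phi \<noteq> 0" "1 - phi \<noteq> 0" "phi - 1 \<noteq> 0" "phi - 2 \<noteq> 0" "- phi \<noteq> 0" using phi_bounds by auto
  have recip: "1 / phi = phi - 1" using inverse_phi by (simp add: inverse_eq_divide)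
  have inv: "- 1 / (1 - phi) = phi" "- 1 / (phi - 1) = - phi" "- 1 / - phi = phi - 1"
    "- 1 / phi = 1 - phi" "- 1 / (phi - 2) = phi + 1"
    using nz by (simp_all add: nonzero_divide_eq_eq nonzero_neg_divide_eq_eq algebra_simps phi_sq recip)
  have U: "moebius psl_U (Some x) = Some (- 1 / x - 1)" if "x \<noteq> 0" for x
    using that by (simp add: moebius_psl_U)
  have S: "moebius psl_S (Some x) = Some (- 1 / x)" if "x \<noteq> 0" for x
    using that by (simp add: moebius_psl_S)
  show "moebius psl_U (Some (1 - phi)) = Some (phi - 1)"
    "moebius psl_S (Some (phi - 1)) = Some (- phi)"
    "moebius psl_U (Some (- phi)) = Some (phi - 2)"
    "moebius psl_S (Some (- phi)) = Some (phi - 1)"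
    "moebius psl_U (Some phi) = Some (- phi)"
    "moebius psl_U (Some (phi - 2)) = Some phi"
    "moebius psl_S (Some phi) = Some (1 - phi)"
    "moebius psl_U (Some (phi - 1)) = Some (- (phi + 1))"
    by (simp_all only: U[OF nz(1)] U[OF nz(2)] U[OF nz(3)] U[OF nz(4)] U[OF nz(5)] S[OF nz(1)] S[OF nz(3)] S[OF nz(5)] inv) (simp_all add: recip)
qed

lemma regular_at_to_fgerm: "real_analytic_at g x \<Longrightarrow> regular_at s (to_fgerm g) (Some x)"
  by (simp add: regular_at_Some analytic_germ_rep_to_fgerm real_analytic_at_imp_germ)

lemma theta_inj:
  assumes s: "0 < Re s" and g: "g \<in> FE4 s {- (phi^2)<..<phi}" "g' \<in> FE4 s {- (phi^2)<..<phi}"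
    and eq: "theta s g = theta s g'"
  shows "g = g'"
proof -
  let ?X = "{- (phi + 1)<..<phi}"
  interpret a: theta_data_FE s "to_fgerm g" "to_fgerm (theta_h s g)" "to_fgerm (theta_k s g)" "theta_c1 s g" "theta_c2 s g"
    using g(1) by (rule theta_data_FE_theta)
  interpret b: theta_data_FE s "to_fgerm g'" "to_fgerm (theta_h s g')" "to_fgerm (theta_k s g')" "theta_c1 s g'" "theta_c2 s g'"
    using g(2) by (rule theta_data_FE_theta)
  obtain v where v: "v \<in> V_fs s" "\<And>\<gamma>. theta_cocycle s g \<gamma> - theta_cocycle s g' \<gamma> = v - act s v \<gamma>"
    using eq H1_class_eq_iff[OF submodule_V_fs theta_cocycle(1)[OF g(1)] theta_cocycle(1)[OF g(2)]]
    unfolding theta_def by blast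
  have inv: "act s v eta = v" using v(2)[of eta] theta_cocycle(4) g by simp
  have c1: "theta_c1 s g - theta_c1 s g' = act s v psl_S - v"
    using v(2)[of psl_S] theta_cocycle(2) g by (simp add: algebra_simps)
  have c2: "theta_c2 s g - theta_c2 s g' = act s v psl_U - v"
    using v(2)[of psl_U] theta_cocycle(3) g by (simp add: algebra_simps)
  have "act s (theta_c1 s g - theta_c2 s g) (psl_S * psl_U) - act s (theta_c1 s g' - theta_c2 s g') (psl_S * psl_U)
    = act s ((theta_c1 s g - theta_c1 s g') - (theta_c2 s g - theta_c2 s g')) (psl_S * psl_U)"
    by (simp only: act_diff) (simp add: algebra_simps)
  also have "\<dots> = act s v psl_U - act s v (psl_U * (psl_S * psl_U))"
    unfolding c1 c2 by (simp add: act_diff act_mult[symmetric] mult.assoc)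
  finally have diff: "eqon ?X (to_fgerm g - to_fgerm g') (act s v psl_U - act s v (psl_U * (psl_S * psl_U)))"
    using a.G_eq b.G_eq by (simp add: eqon_iff_res res_diff) (simp add: res_diff[symmetric])
  \<comment> \<open>The point -1/\<phi> is sent by U to the attracting point 1/\<phi>, but by USU to
    \<open>phi - 2\<close>, which \<open>eta\<close> does not fix. The second term is thus regular
    there, and so v must be regular at 1/\<phi>.\<close>
  have x0: "1 - phi \<in> ?X" using phi_bounds by simp
  have "regular_at s (to_fgerm g - to_fgerm g') (Some (1 - phi))"
    using g x0 by (intro regular_at_diff regular_at_to_fgerm) (auto simp: FE4_iff)
  then have "regular_at s (act s v psl_U - act s v (psl_U * (psl_S * psl_U))) (Some (1 - phi))"
    using eqon_regular_at[OF diff _ x0] by simp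
  moreover have "regular_at s (act s v (psl_U * (psl_S * psl_U))) (Some (1 - phi))"
    using phi_bounds
    by (simp add: regular_at_act moebius_mult moebius_values hyperbolic_invariant(1)[OF s v(1) inv])
  ultimately have "regular_at s (act s v psl_U) (Some (1 - phi))"
    using regular_at_add by fastforce
  then have "v = 0"
    using hyperbolic_invariant(2)[OF s v(1) inv] by (simp add: regular_at_act moebius_values)
  then have "eqon ?X (to_fgerm g) (to_fgerm g')"
    using diff by (simp add: act_zero eqon_iff_res res_simps)
  then have fin: "finite {x \<in> ?X. g x \<noteq> g' x}" by (simp add: eqon_to_fgerm)
  show "g = g'"
  proof
    fix x show "g x = g' x"
    proof (cases "x \<in> ?X")
      case True
      then show ?thesis
        using g by (intro eq_on_open_of_finite[OF _ True fin] real_analytic_at_imp_isCont) (auto simp: FE4_iff)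
    next
      case False
      then show ?thesis using g by (simp add: FE4_iff)
    qed
  qed
qed

lemma eq_minus_of_sum:
  fixes a b c :: "'a::ab_group_add"
  assumes "a + b + c = 0"
  shows "a = - (b + c)" "- a = b + c" "- (b + c) = a"
proof -
  have "a + (b + c) = 0" using assms by (simp add: add.assoc)
  then show "a = - (b + c)" by (rule eq_neg_iff_add_eq_0[THEN iffD2])
  then show "- a = b + c" "- (b + c) = a" by simp_all
qed

section \<open>The image of \<open>\<theta>\<close>\<close>

lemma moebius_psl_S_cancel: "moebius psl_S (moebius psl_S p) = p"
  by (simp add: moebius_one flip: moebius_mult)

lemma moebius_psl_U_cancel: "moebius psl_U (moebius psl_U (moebius psl_U p)) = p"
  by (simp add: mult.assoc moebius_one flip: moebius_mult)

lemma moebius_psl_S_eq_iff: "moebius psl_S p = q \<longleftrightarrow> p = moebius psl_S q"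
  using moebius_psl_S_cancel by metis

lemma moebius_psl_U_eq_iff: "moebius psl_U p = q \<longleftrightarrow> p = moebius psl_U (moebius psl_U q)"
  using moebius_psl_U_cancel by metis

lemma FE4_regular_at:
  assumes g: "g \<in> FE4 s {- (phi^2)<..<phi}"
  shows "- (phi + 1) < x \<Longrightarrow> x < phi \<Longrightarrow> regular_at s (to_fgerm g) (Some x)"
    and "- phi < x \<Longrightarrow> x < phi \<Longrightarrow> regular_at s (to_fgerm (theta_h s g)) (Some x)"
    and "- phi < x \<Longrightarrow> x < phi - 1 \<Longrightarrow> regular_at s (to_fgerm (theta_k s g)) (Some x)"
proof -
  show G: "regular_at s (to_fgerm g) (Some x)" if "- (phi + 1) < x" "x < phi" for x
    using g that by (intro regular_at_to_fgerm) (simp add: FE4_iff)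
  show H: "regular_at s (to_fgerm (theta_h s g)) (Some x)" if x: "- phi < x" "x < phi" for x
  proof -
    obtain y where y: "moebius psl_ST2 (Some x) = Some y"
      using moebius_defined(1)[OF x] by blast
    have "regular_at s (to_fgerm g) (Some y)" using interval_maps(20)[OF y x] by (intro G) auto
    then show ?thesis
      unfolding to_fgerm_theta_h using x by (intro regular_at_add G) (simp_all add: regular_at_act y)
  qed
  show "regular_at s (to_fgerm (theta_k s g)) (Some x)" if x: "- phi < x" "x < phi - 1"
  proof -
    have "moebius (psl_U * (psl_U * psl_S)) (Some x) = Some (- 1 / (x - 1) - 1)"
      using that phi_bounds
      by (auto simp: psl_S_abs psl_U_abs abs_psl2z_mat2_mult moebius_abs_psl2z det_mat2 mat_moebius_def
          field_simps)
    then obtain y where y: "moebius (psl_U * (psl_U * psl_S)) (Some x) = Some y" by blast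
    have "regular_at s (to_fgerm (theta_h s g)) (Some y)"
      using interval_maps(19)[OF y x] phi_bounds by (intro H) auto
    moreover have "regular_at s (to_fgerm g) (Some (x - 1))" using x phi_bounds by (intro G) auto
    ultimately show ?thesis
      unfolding to_fgerm_theta_k by (intro regular_at_add) (simp_all add: regular_at_act y moebius_defined(3))
  qed
qed

text \<open>Inside the interval c1 is k; the outside, with infinity as the image of 0, is reached
  through c1 = -c1|S.\<close>

lemma theta_c1_regular_at:
  assumes g: "g \<in> FE4 s {- (phi^2)<..<phi}" and p: "p \<noteq> Some (- phi)" "p \<noteq> Some (phi - 1)"
  shows "regular_at s (theta_c1 s g) p"
proof -
  interpret theta_data_FE s "to_fgerm g" "to_fgerm (theta_h s g)" "to_fgerm (theta_k s g)" "theta_c1 s g" "theta_c2 s g"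
    using g by (rule theta_data_FE_theta)
  have in': "regular_at s (theta_c1 s g) (Some x)" if "- phi < x" "x < phi - 1" for x
    using eqon_regular_at[OF c1_in, of x] FE4_regular_at(3)[OF g that] that by simp
  have S: "regular_at s (theta_c1 s g) q" if "regular_at s (theta_c1 s g) (moebius psl_S q)" for q
  proof -
    have "theta_c1 s g = - act s (theta_c1 s g) psl_S" using c1_S by (simp add: eq_neg_iff_add_eq_0)
    moreover have "regular_at s (- act s (theta_c1 s g) psl_S) q" using that by (intro regular_at_uminus) (simp add: regular_at_act)
    ultimately show ?thesis by simp
  qed
  show ?thesis
  proof (cases p)
    case None
    have "regular_at s (theta_c1 s g) (Some 0)" using phi_bounds by (intro in') auto
    then have "regular_at s (theta_c1 s g) (moebius psl_S None)" by (simp add: moebius_psl_S)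
    then show ?thesis unfolding None by (rule S)
  next
    case (Some x)
    then consider "- phi < x" "x < phi - 1" | "x < - phi \<or> phi - 1 < x" using p by force
    then show ?thesis
    proof cases
      case 1
      then show ?thesis unfolding Some by (rule in')
    next
      case 2
      then have "x \<noteq> 0" using phi_bounds by auto
      then obtain y where y: "moebius psl_S (Some x) = Some y" by (simp add: moebius_psl_S)
      have "regular_at s (theta_c1 s g) (moebius psl_S (Some x))"
        using interval_maps(2)[OF y 2] by (simp add: y in')
      then show ?thesis unfolding Some by (rule S)
    qed
  qed
qed

text \<open>Inside the interval c2 is h; U and U^2 send the outside of [-\<phi>, \<phi>], infinity
  included, into the inside, and c2 = -(c2|U + c2|U^2).\<close>

lemma theta_c2_regular_at:
  assumes g: "g \<in> FE4 s {- (phi^2)<..<phi}" and p: "p \<noteq> Some (- phi)" "p \<noteq> Some phi"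
  shows "regular_at s (theta_c2 s g) p"
proof -
  interpret theta_data_FE s "to_fgerm g" "to_fgerm (theta_h s g)" "to_fgerm (theta_k s g)" "theta_c1 s g" "theta_c2 s g"
    using g by (rule theta_data_FE_theta)
  have in': "regular_at s (theta_c2 s g) (Some x)" if "- phi < x" "x < phi" for x
    using eqon_regular_at[OF c2_in, of x] FE4_regular_at(2)[OF g that] that by simp
  have U: "regular_at s (theta_c2 s g) q"
    if "regular_at s (theta_c2 s g) (moebius psl_U q)" "regular_at s (theta_c2 s g) (moebius (psl_U * psl_U) q)" for q
  proof -
    have "theta_c2 s g = - (act s (theta_c2 s g) psl_U + act s (theta_c2 s g) (psl_U * psl_U))"
      using c2_U by (rule eq_minus_of_sum)
    moreover have "regular_at s (- (act s (theta_c2 s g) psl_U + act s (theta_c2 s g) (psl_U * psl_U))) q"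
      using that by (intro regular_at_uminus regular_at_add) (simp_all add: regular_at_act)
    ultimately show ?thesis by simp
  qed
  show ?thesis
  proof (cases p)
    case None
    show ?thesis unfolding None
      by (rule U) (use phi_bounds in \<open>simp_all add: moebius_mult moebius_psl_U in'\<close>)
  next
    case (Some x)
    then consider "- phi < x" "x < phi" | "x < - phi \<or> phi < x" using p by force
    then show ?thesis
    proof cases
      case 1
      then show ?thesis unfolding Some by (rule in')
    next
      case 2
      then have "x \<noteq> 0" "x + 1 \<noteq> 0" using phi_bounds by auto
      then obtain y z where y: "moebius psl_U (Some x) = Some y" and z: "moebius (psl_U * psl_U) (Some x) = Some z"
        by (auto simp: moebius_psl_U psl_UU_abs moebius_abs_psl2z det_mat2 mat_moebius_def)
      have yz: "- phi < y" "y < phi" "- phi < z" "z < phi"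
        using interval_maps(10)[OF y 2] interval_maps(15)[OF z 2] phi_bounds by auto
      show ?thesis unfolding Some by (rule U) (simp_all add: y z in' yz)
    qed
  qed
qed

text \<open>On its domain g is (c1 - c2)|SU, and SU sends the inner point -1/\<phi> to
  -\<phi>.\<close>

lemma theta_c1_c2_regular_at:
  assumes g: "g \<in> FE4 s {- (phi^2)<..<phi}"
  shows "regular_at s (theta_c1 s g - theta_c2 s g) (Some (- phi))"
proof -
  interpret theta_data_FE s "to_fgerm g" "to_fgerm (theta_h s g)" "to_fgerm (theta_k s g)" "theta_c1 s g" "theta_c2 s g"
    using g by (rule theta_data_FE_theta)
  have x: "1 - phi \<in> {- (phi + 1)<..<phi}" using phi_bounds by simp
  have "regular_at s (to_fgerm g) (Some (1 - phi))"
    by (rule FE4_regular_at(1)[OF g]) (use phi_bounds in auto)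
  then have "regular_at s (act s (theta_c1 s g - theta_c2 s g) (psl_S * psl_U)) (Some (1 - phi))"
    using eqon_regular_at[OF G_eq _ x] by simp
  then show ?thesis by (simp add: regular_at_act moebius_mult moebius_values)
qed

lemma theta_image_subset:
  assumes g: "g \<in> FE4 s {- (phi^2)<..<phi}"
  shows "\<exists>\<psi>\<in>Z1 (act s) (V_omega s). theta s g = H1_class (act s) (V_fs s) \<psi>"
proof -
  interpret theta_data_FE s "to_fgerm g" "to_fgerm (theta_h s g)" "to_fgerm (theta_k s g)" "theta_c1 s g" "theta_c2 s g"
    using g by (rule theta_data_FE_theta)
  let ?c1 = "theta_c1 s g" and ?c2 = "theta_c2 s g"
  note \<psi> = theta_cocycle[OF g]
  obtain v where v: "v \<in> V_fs s" "\<And>p. p \<noteq> Some (- phi) \<Longrightarrow> regular_at s v p" "regular_at s (v - ?c1) (Some (- phi))"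
    using separate_singularity[OF FE4_V_fs(4)[OF g]] by blast
  define \<psi>' where "\<psi>' = (\<lambda>\<gamma>. theta_cocycle s g \<gamma> - (- v - act s (- v) \<gamma>))"
  have nv: "- v \<in> V_fs s" using v(1) by (rule V_fs_uminus)
  have \<psi>'_Z1: "\<psi>' \<in> Z1 (act s) (V_fs s)"
    unfolding \<psi>'_def by (rule Z1_minus_coboundary[OF submodule_V_fs \<psi>(1) nv])
  have \<psi>'_S: "\<psi>' psl_S = - ?c1 + v - act s v psl_S" and \<psi>'_U: "\<psi>' psl_U = - ?c2 + v - act s v psl_U"
    by (simp_all add: \<psi>'_def \<psi> act_uminus)
  have v2: "regular_at s (v - ?c2) (Some (- phi))"
    using regular_at_add[OF v(3) theta_c1_c2_regular_at[OF g]] by simp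
  have S: "regular_at s (\<psi>' psl_S) p" for p
  proof (cases "p = Some (- phi) \<or> p = Some (phi - 1)")
    case False
    then have "moebius psl_S p \<noteq> Some (- phi)" by (simp add: moebius_psl_S_eq_iff moebius_values)
    with False show ?thesis unfolding \<psi>'_S
      by (intro regular_at_diff regular_at_add regular_at_uminus theta_c1_regular_at g v) (auto simp: regular_at_act intro: v)
  next
    case True
    then show ?thesis
    proof
      assume p: "p = Some (- phi)"
      \<comment> \<open>S moves -\<phi> to 1/\<phi>, where v is regular, so v|S does no harm
        here.\<close>
      have "regular_at s ((v - ?c1) - act s v psl_S) p"
        unfolding p using phi_bounds by (intro regular_at_diff v) (simp add: regular_at_act moebius_values v)
      then show ?thesis by (simp add: \<psi>'_S)
    next
      assume p: "p = Some (phi - 1)"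
      \<comment> \<open>At 1/\<phi> the singular terms are -c1 and -v|S. The relation for S combines
        them into -(v - c1)|S, and S moves 1/\<phi> to -\<phi>.\<close>
      have "- ?c1 = act s ?c1 psl_S" using c1_S by (simp add: add_eq_0_iff)
      then have "\<psi>' psl_S = v - act s (v - ?c1) psl_S" unfolding \<psi>'_S act_diff by simp
      moreover have "regular_at s (v - act s (v - ?c1) psl_S) p"
        unfolding p using phi_bounds v(3) by (intro regular_at_diff[of s v] v) (simp_all add: regular_at_act moebius_values)
      ultimately show ?thesis by simp
    qed
  qed
  have U: "regular_at s (\<psi>' psl_U) p" for p
  proof (cases "p = Some (- phi) \<or> p = Some phi")
    case False
    then have "moebius psl_U p \<noteq> Some (- phi)" by (simp add: moebius_psl_U_eq_iff moebius_values)
    with False show ?thesis unfolding \<psi>'_U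
      by (intro regular_at_diff regular_at_add regular_at_uminus theta_c2_regular_at g v) (auto simp: regular_at_act intro: v)
  next
    case True
    then show ?thesis
    proof
      assume p: "p = Some (- phi)"
      have "regular_at s ((v - ?c2) - act s v psl_U) p"
        unfolding p using phi_bounds v2 by (intro regular_at_diff[of s "v - ?c2"]) (simp_all add: regular_at_act moebius_values v)
      then show ?thesis by (simp add: \<psi>'_U)
    next
      assume p: "p = Some phi"
      \<comment> \<open>At \<phi> the relation for U leaves (v - c2)|U, regular because U moves
        \<phi> to -\<phi>, and c2|U^2, regular because U^2 moves \<phi> to
        \<open>phi - 2\<close>.\<close>
      have "- ?c2 = act s ?c2 psl_U + act s ?c2 (psl_U * psl_U)"
        using c2_U by (rule eq_minus_of_sum)
      then have "\<psi>' psl_U = v + act s ?c2 (psl_U * psl_U) - act s (v - ?c2) psl_U"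
        unfolding \<psi>'_U act_diff by (simp add: algebra_simps)
      moreover have "regular_at s (v + act s ?c2 (psl_U * psl_U) - act s (v - ?c2) psl_U) p"
      proof (intro regular_at_diff[of s "v + act s ?c2 (psl_U * psl_U)"] regular_at_add)
        show "regular_at s v p" unfolding p using phi_bounds by (intro v) auto
        show "regular_at s (act s ?c2 (psl_U * psl_U)) p"
          unfolding p using phi_bounds by (simp add: regular_at_act moebius_mult moebius_values theta_c2_regular_at[OF g])
        show "regular_at s (act s (v - ?c2) psl_U) p" unfolding p using v2 by (simp add: regular_at_act moebius_values)
      qed
      ultimately show ?thesis by simp
    qed
  qed
  have "\<psi>' \<in> Z1 (act s) (V_omega s)"
    using S U by (intro Z1_subspace[OF \<psi>'_Z1]) (auto simp: V_omega_altdef V_omega_zero[unfolded V_omega_altdef]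
        regular_at_add regular_at_act V_omega_zero[unfolded V_omega_altdef mem_Collect_eq, rule_format])
  moreover have "theta s g = H1_class (act s) (V_fs s) \<psi>'"
    unfolding \<psi>'_def theta_def using H1_class_minus_coboundary[OF submodule_V_fs \<psi>(1) nv] by simp
  ultimately show ?thesis by blast
qed

section \<open>Every class with analytic values is attained\<close>

lemma real_analytic_at_slash:
  assumes "moebius \<gamma> (Some x) = Some y" "real_analytic_at g y"
  shows "real_analytic_at (slash s g \<gamma>) x"
  unfolding slash_eq_mat_slash
  by (rule real_analytic_at_mat_slash)
     (use assms in \<open>auto simp: moebius_eq_mat_moebius mat_moebius_def split: if_splits\<close>)

text \<open>Turns a germ that is regular on X into an actual function, normalised to vanish off X as
  \<open>FE4\<close> demands.\<close>

lemma real_analytic_restriction: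
  assumes v: "v \<in> V_fs s" and X: "open X" "\<And>x. x \<in> X \<Longrightarrow> regular_at s v (Some x)"
  obtains g where "\<And>x. x \<in> X \<Longrightarrow> real_analytic_at g x" "\<And>x. x \<notin> X \<Longrightarrow> g x = 0" "eqon X (to_fgerm g) v"
proof -
  obtain h where h: "v = to_fgerm h" "finite {x. \<not> real_analytic_at h x}" using v by (rule V_fsE)
  define g where "g = (\<lambda>x. if x \<in> X then Lim (at x) h else 0)"
  have "real_analytic_at g x" if "x \<in> X" for x
  proof -
    have "analytic_germ h x" using X(2)[OF that] by (simp add: h(1) regular_at_Some analytic_germ_rep_to_fgerm)
    then have "real_analytic_at (\<lambda>y. Lim (at y) h) x" by (rule analytic_germ_regularize)
    moreover have "\<forall>\<^sub>F y in nhds x. y \<in> X" using X(1) that by (intro eventually_nhds_in_open)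
    then have "\<forall>\<^sub>F y in nhds x. g y = Lim (at y) h" by eventually_elim (simp add: g_def)
    ultimately show ?thesis by (simp add: real_analytic_at_cong)
  qed
  moreover have "g x = 0" if "x \<notin> X" for x using that by (simp add: g_def)
  moreover have "eqon X (to_fgerm g) v"
    unfolding h(1) eqon_to_fgerm
    by (rule finite_subset[OF _ h(2)]) (auto simp: g_def dest: Lim_eq_of_real_analytic)
  ultimately show ?thesis by (rule that)
qed

lemma theta_surj:
  assumes s: "0 < Re s" and \<psi>: "\<psi> \<in> Z1 (act s) (V_omega s)"
  shows "\<exists>g\<in>FE4 s {- (phi^2)<..<phi}. theta s g = H1_class (act s) (V_fs s) \<psi>"
proof -
  let ?X = "{- (phi + 1)<..<phi}" and ?D = "{- phi<..<phi}" and ?I = "{- phi<..<phi - 1}"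
  let ?w = "psl_ST2" and ?w' = "psl_TiSTi2"
  have \<psi>_fs: "\<psi> \<in> Z1 (act s) (V_fs s)" using \<psi> Z1_mono[OF V_omega_subset_V_fs] by blast
  have \<psi>_regular_at: "regular_at s (\<psi> \<gamma>) p" for \<gamma> p using \<psi> by (auto simp: Z1_def V_omega_altdef)
  have "\<psi> eta \<in> V_omega s" using \<psi> by (simp add: Z1_def)
  then obtain f where f: "f \<in> V_fs s" "\<psi> eta = f - act s f eta" "\<And>p. p \<noteq> Some (- phi) \<Longrightarrow> regular_at s f p"
    using hyperbolic_solve[OF s] by blast
  define \<psi>' where "\<psi>' = (\<lambda>\<gamma>. \<psi> \<gamma> - (f - act s f \<gamma>))"
  have \<psi>': "\<psi>' \<in> Z1 (act s) (V_fs s)"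
    unfolding \<psi>'_def by (rule Z1_minus_coboundary[OF submodule_V_fs \<psi>_fs f(1)])
  define c1 c2 where "c1 = - \<psi>' psl_S" and "c2 = - \<psi>' psl_U"
  have S: "c1 + act s c1 psl_S = 0"
    using Z1_mult[OF \<psi>', of psl_S psl_S] Z1_one[OF \<psi>'] by (simp add: c1_def act_uminus) (metis add.commute neg_eq_iff_add_eq_0 minus_minus)
  have U: "c2 + act s c2 psl_U + act s c2 (psl_U * psl_U) = 0"
  proof -
    have "0 = \<psi>' (psl_U * (psl_U * psl_U))" by (simp add: Z1_one[OF \<psi>'])
    also have "\<dots> = act s (\<psi>' psl_U) (psl_U * psl_U) + (act s (\<psi>' psl_U) psl_U + \<psi>' psl_U)"
      by (simp only: Z1_mult[OF \<psi>'])
    finally have e: "act s (\<psi>' psl_U) (psl_U * psl_U) + (act s (\<psi>' psl_U) psl_U + \<psi>' psl_U) = 0" ..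
    have "c2 + act s c2 psl_U + act s c2 (psl_U * psl_U) =
        - (act s (\<psi>' psl_U) (psl_U * psl_U) + (act s (\<psi>' psl_U) psl_U + \<psi>' psl_U))"
      by (simp add: c2_def act_uminus)
    then show ?thesis by (simp only: e) simp
  qed
  have "\<psi>' eta = 0" using f(2) by (simp add: \<psi>'_def)
  then have SU: "c1 - act s c1 psl_U = c2 - act s c2 psl_S"
    unfolding Z1_eta[OF \<psi>'] c1_def c2_def by (simp add: act_uminus) (simp add: algebra_simps)
  define G where "G = act s (c1 - c2) (psl_S * psl_U)"
  note four = four_term_of_commuting[OF S U SU, folded G_def]
  \<comment> \<open>G is the value of \<open>\<psi>'\<close> at US = T^(-1), acted on by U. Only f
    contributes singularities: f|U at \<phi> and f|USU at \<open>- (phi + 1)\<close>, exactly the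
    end points of \<open>?X\<close>.\<close>
  have G_eq: "G = act s (\<psi> (psl_U * psl_S)) psl_U - (act s f psl_U - act s f (psl_U * (psl_S * psl_U)))"
  proof -
    have "act s (\<psi>' psl_S) psl_S + \<psi>' psl_S = 0"
      using Z1_mult[OF \<psi>', of psl_S psl_S] Z1_one[OF \<psi>'] by simp
    then have "act s (\<psi>' psl_S) psl_S = - \<psi>' psl_S" by (rule eq_neg_iff_add_eq_0[THEN iffD2])
    then have "act s (\<psi>' psl_S) (psl_S * psl_U) = - act s (\<psi>' psl_S) psl_U" by (metis act_mult act_uminus)
    then have "G = act s (\<psi>' (psl_U * psl_S)) psl_U"
      unfolding G_def Z1_mult[OF \<psi>'] c1_def c2_def
      by (simp add: act_diff act_add act_uminus act_mult[symmetric] algebra_simps)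
    then show ?thesis
      by (simp add: \<psi>'_def act_diff act_mult[symmetric] mult.assoc)
  qed
  have "G \<in> V_fs s"
    using \<psi>' unfolding G_def c1_def c2_def by (intro V_fs_act V_fs_diff V_fs_uminus) (auto simp: Z1_def)
  moreover have "regular_at s G (Some x)" if x: "x \<in> ?X" for x
  proof -
    have "moebius psl_U (Some x) \<noteq> Some (- phi)"
      using x by (simp add: moebius_psl_U_eq_iff moebius_values)
    moreover have "moebius (psl_U * (psl_S * psl_U)) (Some x) \<noteq> Some (- phi)"
      using x by (simp add: moebius_mult moebius_psl_U_eq_iff moebius_psl_S_eq_iff moebius_values)
    ultimately show ?thesis
      unfolding G_eq by (intro regular_at_diff) (simp_all add: regular_at_act \<psi>_regular_at f(3))
  qed
  ultimately obtain g where g: "\<And>x. x \<in> ?X \<Longrightarrow> real_analytic_at g x" "\<And>x. x \<notin> ?X \<Longrightarrow> g x = 0"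
    and gG: "eqon ?X (to_fgerm g) G"
    using real_analytic_restriction[of G s ?X] by (metis open_greaterThanLessThan)
  have DX: "?D \<subseteq> ?X" by auto
  have gD: "eqon ?D (to_fgerm g) G" using gG DX by (rule eqon_subset)
  have gw: "eqon ?D (act s (to_fgerm g) ?w) (act s G ?w)"
    by (rule eqon_act[OF gG]) (use interval_maps(20) in \<open>fastforce simp: interval_mem\<close>)
  have gw': "eqon ?D (act s (to_fgerm g) ?w') (act s G ?w')"
    by (rule eqon_act[OF gG]) (use interval_maps(21) in \<open>fastforce simp: interval_mem\<close>)
  have gT: "eqon ?D (act s (to_fgerm g) (psl_U * psl_S)) (act s G (psl_U * psl_S))"
    by (rule eqon_act[OF gG]) (use interval_maps(18) in \<open>fastforce simp: interval_mem\<close>)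
  \<comment> \<open>By the first and third relations in \<open>four\<close>, both sides equal c2 on
    \<open>?D\<close>.\<close>
  have FE_germ: "eqon ?D (to_fgerm g + act s (to_fgerm g) ?w)
      (act s (to_fgerm g) (psl_U * psl_S) + act s (to_fgerm g) ?w')"
    using eqon_add[OF gD gw] eqon_add[OF gT gw'] unfolding four(1,3) by (blast intro: eqon_trans eqon_sym)
  have "g \<in> FE4 s {- (phi^2)<..<phi}"
    unfolding FE4_iff
  proof (intro conjI ballI allI impI g)
    fix x assume x: "- phi < x" "x < phi"
    obtain y y' where y: "moebius ?w (Some x) = Some y" "moebius ?w' (Some x) = Some y'"
      using moebius_defined(1,2)[OF x] by blast
    have an: "real_analytic_at g x" "real_analytic_at (slash s g ?w) x"
      "real_analytic_at (slash s g (psl_U * psl_S)) x" "real_analytic_at (slash s g ?w') x"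
      using x interval_maps(20)[OF y(1) x] interval_maps(21)[OF y(2) x] phi_bounds
      by (auto intro!: g real_analytic_at_slash[OF y(1)] real_analytic_at_slash[OF y(2)]
          real_analytic_at_slash[OF moebius_defined(3)])
    \<comment> \<open>\<open>FE4\<close> asks for the equation at every point; so far it holds off a
      finite set, and both sides are continuous.\<close>
    show "g x + slash s g ?w x = slash s g (psl_U * psl_S) x + slash s g ?w' x"
    proof (rule eq_on_open_of_finite[of ?D x "\<lambda>x. g x + slash s g ?w x"
          "\<lambda>x. slash s g (psl_U * psl_S) x + slash s g ?w' x"])
      show "finite {x \<in> ?D. g x + slash s g ?w x \<noteq> slash s g (psl_U * psl_S) x + slash s g ?w' x}"
        using FE_germ unfolding act_to_fgerm plus_to_fgerm eqon_to_fgerm .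
      show "isCont (\<lambda>x. g x + slash s g ?w x) x" "isCont (\<lambda>x. slash s g (psl_U * psl_S) x + slash s g ?w' x) x"
        using an by (auto intro!: real_analytic_at_imp_isCont real_analytic_at_add)
    qed (use x in auto)
  qed auto
  note g_FE = this
  interpret theta_data_FE s "to_fgerm g" "to_fgerm (theta_h s g)" "to_fgerm (theta_k s g)" "theta_c1 s g" "theta_c2 s g"
    using g_FE by (rule theta_data_FE_theta)
  have H_eq: "eqon ?D (to_fgerm (theta_h s g)) c2"
    using eqon_add[OF gD gw] unfolding to_fgerm_theta_h four(1) .
  have K_eq: "eqon ?I (to_fgerm (theta_k s g)) c1"
  proof -
    have "eqon ?I (act s (to_fgerm g) (psl_U * psl_S)) (act s G (psl_U * psl_S))"
      by (rule eqon_subset[OF gT]) auto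
    moreover have "eqon ?I (act s (to_fgerm (theta_h s g)) (psl_U * (psl_U * psl_S))) (act s c2 (psl_U * (psl_U * psl_S)))"
      by (rule eqon_act[OF H_eq]) (use interval_maps(19) phi_bounds in \<open>fastforce simp: interval_mem\<close>)
    ultimately show ?thesis
      unfolding to_fgerm_theta_k four(2)[symmetric] by (rule eqon_add)
  qed
  \<comment> \<open>c1 = -c1|S determines c1 from its restriction to \<open>?I\<close>, and
    \<open>theta_c1\<close> continues k by the same rule; likewise for c2 with the relation for
    U.\<close>
  have "theta_c1 s g = c1"
  proof -
    have "eqon ({..<- phi} \<union> {phi - 1<..}) (act s (to_fgerm (theta_k s g)) psl_S) (act s c1 psl_S)"
      by (rule eqon_act[OF K_eq]) (unfold interval_mem, blast dest: interval_maps)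
    then have "eqon ({..<- phi} \<union> {phi - 1<..}) (theta_c1 s g) (- act s c1 psl_S)"
      using c1_out by (blast intro: eqon_trans eqon_uminus)
    moreover have "- act s c1 psl_S = c1" using S by (simp add: add_eq_0_iff)
    moreover have "eqon ?I (theta_c1 s g) c1" using c1_in K_eq by (rule eqon_trans)
    ultimately have "eqon ({..<- phi} \<union> {phi - 1<..} \<union> ?I) (theta_c1 s g) c1" by (metis eqon_Un)
    then show ?thesis
      by (rule eqon_cover) (rule finite_subset[of _ "{- phi, phi - 1}"], auto)
  qed
  moreover have "theta_c2 s g = c2"
  proof -
    let ?O = "{..<- phi} \<union> {phi<..}"
    have "eqon ?O (act s (to_fgerm (theta_h s g)) psl_U) (act s c2 psl_U)"
      by (rule eqon_act[OF H_eq]) (use interval_maps(10) phi_bounds in \<open>fastforce simp: interval_mem\<close>)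
    moreover have "eqon ?O (act s (to_fgerm (theta_h s g)) (psl_U * psl_U)) (act s c2 (psl_U * psl_U))"
      by (rule eqon_act[OF H_eq]) (use interval_maps(15) phi_bounds in \<open>fastforce simp: interval_mem\<close>)
    ultimately have "eqon ?O (theta_c2 s g) (- (act s c2 psl_U + act s c2 (psl_U * psl_U)))"
      using c2_out by (blast intro: eqon_trans eqon_uminus eqon_add)
    moreover have "- (act s c2 psl_U + act s c2 (psl_U * psl_U)) = c2"
      using U by (rule eq_minus_of_sum)
    moreover have "eqon ?D (theta_c2 s g) c2" using c2_in H_eq by (rule eqon_trans)
    ultimately have "eqon (?O \<union> ?D) (theta_c2 s g) c2" by (metis eqon_Un)
    then show ?thesis
      by (rule eqon_cover) (rule finite_subset[of _ "{- phi, phi}"], auto)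
  qed
  ultimately have "theta_cocycle s g = \<psi>'"
    by (intro theta_cocycle_eqI \<psi>') (simp_all add: c1_def c2_def)
  then have "theta s g = H1_class (act s) (V_fs s) \<psi>"
    unfolding theta_def \<psi>'_def using H1_class_minus_coboundary[OF submodule_V_fs \<psi>_fs f(1)] by simp
  with g_FE show ?thesis by blast
qed

theorem theorem2p5:
  fixes s :: complex
  assumes "0 < Re s" and "Re s < 1" and "s \<noteq> 1 / 2"
  shows "theta s ` FE4 s {- (phi^2) <..< phi} \<subseteq> H1_Fib s (V_fs s) \<and>
         inj_on (theta s) (FE4 s {- (phi^2) <..< phi}) \<and>
         theta s ` FE4 s {- (phi^2) <..< phi} = H1_incl (act s) (V_fs s) ` H1 (act s) (V_omega s)"
proof (intro conjI)
  show "theta s ` FE4 s {- (phi^2) <..< phi} \<subseteq> H1_Fib s (V_fs s)"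
    using theta_in_H1_Fib by blast
  show "inj_on (theta s) (FE4 s {- (phi^2) <..< phi})"
    by (rule inj_onI) (rule theta_inj[OF assms(1)])
  have "H1 (act s) (V_omega s) = H1_class (act s) (V_omega s) ` Z1 (act s) (V_omega s)"
    by (auto simp: H1_def H1_class_def quotient_def)
  then have "H1_incl (act s) (V_fs s) ` H1 (act s) (V_omega s) =
      H1_class (act s) (V_fs s) ` Z1 (act s) (V_omega s)"
    by (simp add: image_image H1_incl_class[OF submodule_V_omega submodule_V_fs V_omega_subset_V_fs])
  also have "\<dots> = theta s ` FE4 s {- (phi^2) <..< phi}"
  proof
    show "H1_class (act s) (V_fs s) ` Z1 (act s) (V_omega s) \<subseteq> theta s ` FE4 s {- (phi^2) <..< phi}"
    proof
      fix c assume "c \<in> H1_class (act s) (V_fs s) ` Z1 (act s) (V_omega s)"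
      then obtain \<psi> where "\<psi> \<in> Z1 (act s) (V_omega s)" "c = H1_class (act s) (V_fs s) \<psi>" by blast
      moreover obtain g where "g \<in> FE4 s {- (phi^2) <..< phi}" "theta s g = H1_class (act s) (V_fs s) \<psi>"
        using theta_surj[OF assms(1) calculation(1)] by blast
      ultimately show "c \<in> theta s ` FE4 s {- (phi^2) <..< phi}" by blast
    qed
    show "theta s ` FE4 s {- (phi^2) <..< phi} \<subseteq> H1_class (act s) (V_fs s) ` Z1 (act s) (V_omega s)"
      using theta_image_subset by blast
  qed
  finally show "theta s ` FE4 s {- (phi^2) <..< phi} = H1_incl (act s) (V_fs s) ` H1 (act s) (V_omega s)" ..
qed

end
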